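(* Let $\chi\in C^\infty_c(\mathbb{R})$ be supported in $(3/4,5/4)$ and such that $0\le\chi\le1$ and $\chi(1)=1$. Let $(T,m)$ be a locally doubling flow tree with flow Laplacian $\mathcal{L}$. For any $s>3/2$, there exist functions $F:\mathbb{R}\to\mathbb{C}$ satisfying $$\sup_{t>0}\|F(2-t\,\cdot)\chi\|_{L^2_s}<\infty$$ and such that $F(\mathcal{L})$ is not bounded from $H^1(m)$ to $L^1(m)$.
   Context: Trees. A tree $T$ is an infinite connected graph without cycles, locally finite, identified with its set of vertices and equipped with the graph distance $d$. A tree with root at infinity is such a tree with a fixed boundary point (end) $\omega_*\in\partial T$. For $x\in T$, the predecessor $\mathfrak{p}(x)$ is the neighbour of $x$ lying on the semi-infinite geodesic from $x$ to $\omega_*$; the remaining neighbours form the set $\mathfrak{s}(x)$ of successors. Write $x\le y$ if $y$ belongs to the semi-infinite geodesic from $x$ to $\omega_*$. A flow measure on $T$ is a function $m:T\to(0,\infty)$ with $m(x)=\sum_{y\in\mathfrak{s}(x)}m(y)$ for all $x\in T$, identified with the measure of density $m$ with respect to counting measure; $(T,m)$ is then a flow tree. It is locally doubling if for every $R>0$ there is $D_R$ such that $m(B_{2r}(x))\le D_R\,m(B_r(x))$ for all $x\in T$, $r\in(0,R]$, where $B_r(x)$ is the ball for $d$. The flow gradient is $\nabla f(x)=f(x)-f(\mathfrak{p}(x))$ and the flow Laplacian is $\mathcal{L}=\frac12\nabla^*\nabla$, bounded and selfadjoint on $L^2(m)$ with spectrum $[0,2]$; $F(\mathcal{L})$ is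 defined by the Borel functional calculus (functions $F$ are Borel). $L^2_s=L^2_s(\mathbb{R})$ is the inhomogeneous $L^2$ Sobolev space of order $s$, and $F(2-t\,\cdot)\chi$ denotes $\lambda\mapsto F(2-t\lambda)\chi(\lambda)$. Boundedness from $H^1(m)$ to $L^1(m)$ means that the norm inequality holds for all functions in $L^2(m)\cap H^1(m)$. Hardy space. For $x\in T$ and integers $1\le h'<h''$ let $R_{h'}^{h''}(x)=\{y\in T:y\le x,\ h'\le d(x,y)<h''\}$. An admissible trapezoid is either a singleton or a set $R_{h'}^{h''}(x)$ with $2\le h''/h'\le12$. An atom is a function $a$ supported in an admissible trapezoid $R$ with $\sum_xa(x)m(x)=0$ and $\|a\|_\infty\le1/m(R)$. $H^1(m)$ is the space of all sums $\sum_j\lambda_ja_j$ (convergence in $L^1(m)$) with $a_j$ atoms and $\sum_j|\lambda_j|<\infty$, normed by the infimum of $\sum_j|\lambda_j|$. *)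

theory Defs
  imports "HOL-Analysis.Analysis"
begin

section \<open>Trees with root at infinity\<close>

text \<open>The vertices of a tree are the elements of a type; the edges are given by an adjacency relation.\<close>

definition is_cycle :: "('a \<Rightarrow> 'a \<Rightarrow> bool) \<Rightarrow> 'a list \<Rightarrow> bool" where
  "is_cycle adj xs \<longleftrightarrow>
     length xs \<ge> 3 \<and> distinct xs \<and> successively adj xs \<and> adj (last xs) (hd xs)"

definition is_tree :: "('a \<Rightarrow> 'a \<Rightarrow> bool) \<Rightarrow> bool" where
  "is_tree adj \<longleftrightarrow>
     symp adj \<and> irreflp adj \<and>
     infinite (UNIV :: 'a set) \<and>
     (\<forall>x. finite {y. adj x y}) \<and>
     (\<forall>x y. adj\<^sup>*\<^sup>* x y) \<and>
     (\<nexists>xs. is_cycle adj xs)"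

definition graph_dist :: "('a \<Rightarrow> 'a \<Rightarrow> bool) \<Rightarrow> 'a \<Rightarrow> 'a \<Rightarrow> nat" where
  "graph_dist adj x y = (LEAST n. (adj ^^ n) x y)"

definition geodesic_ray :: "('a \<Rightarrow> 'a \<Rightarrow> bool) \<Rightarrow> (nat \<Rightarrow> 'a) \<Rightarrow> bool" where
  "geodesic_ray adj r \<longleftrightarrow> (\<forall>i j. i \<le> j \<longrightarrow> graph_dist adj (r i) (r j) = j - i)"

definition cofinal_rays :: "('a \<Rightarrow> 'a \<Rightarrow> bool) \<Rightarrow> ((nat \<Rightarrow> 'a) \<times> (nat \<Rightarrow> 'a)) set" where
  "cofinal_rays adj =
     {(r, r'). geodesic_ray adj r \<and> geodesic_ray adj r' \<and> (\<exists>k l. \<forall>n. r (k + n) = r' (l + n))}"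

definition tree_boundary :: "('a \<Rightarrow> 'a \<Rightarrow> bool) \<Rightarrow> (nat \<Rightarrow> 'a) set set" where
  "tree_boundary adj = {r. geodesic_ray adj r} // cofinal_rays adj"

text \<open>In a tree, every end contains exactly one ray that starts at a given vertex.\<close>

definition ray_to :: "(nat \<Rightarrow> 'a) set \<Rightarrow> 'a \<Rightarrow> nat \<Rightarrow> 'a" where
  "ray_to \<omega> x = (THE r. r \<in> \<omega> \<and> r 0 = x)"

definition predecessor :: "(nat \<Rightarrow> 'a) set \<Rightarrow> 'a \<Rightarrow> 'a" where
  "predecessor \<omega> x = ray_to \<omega> x 1"

definition successors :: "('a \<Rightarrow> 'a \<Rightarrow> bool) \<Rightarrow> (nat \<Rightarrow> 'a) set \<Rightarrow> 'a \<Rightarrow> 'a set" where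
  "successors adj \<omega> x = {y. adj x y} - {predecessor \<omega> x}"

definition tree_le :: "(nat \<Rightarrow> 'a) set \<Rightarrow> 'a \<Rightarrow> 'a \<Rightarrow> bool" where
  "tree_le \<omega> x y \<longleftrightarrow> y \<in> range (ray_to \<omega> x)"


section \<open>Flow measures\<close>

definition is_flow_tree ::
    "('a \<Rightarrow> 'a \<Rightarrow> bool) \<Rightarrow> (nat \<Rightarrow> 'a) set \<Rightarrow> ('a \<Rightarrow> real) \<Rightarrow> bool" where
  "is_flow_tree adj \<omega> m \<longleftrightarrow>
     is_tree adj \<and> \<omega> \<in> tree_boundary adj \<and>
     (\<forall>x. m x > 0) \<and> (\<forall>x. m x = (\<Sum>y\<in>successors adj \<omega> x. m y))"

definition flow_measure :: "('a \<Rightarrow> real) \<Rightarrow> 'a measure" where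
  "flow_measure m = point_measure UNIV (\<lambda>x. ennreal (m x))"

definition tree_ball :: "('a \<Rightarrow> 'a \<Rightarrow> bool) \<Rightarrow> 'a \<Rightarrow> real \<Rightarrow> 'a set" where
  "tree_ball adj x r = {y. real (graph_dist adj x y) \<le> r}"

definition locally_doubling :: "('a \<Rightarrow> 'a \<Rightarrow> bool) \<Rightarrow> ('a \<Rightarrow> real) \<Rightarrow> bool" where
  "locally_doubling adj m \<longleftrightarrow>
     (\<forall>R>0. \<exists>D>0. \<forall>x. \<forall>r\<in>{0<..R}.
        measure (flow_measure m) (tree_ball adj x (2 * r))
          \<le> D * measure (flow_measure m) (tree_ball adj x r))"

text \<open>Since \<open>m > 0\<close> everywhere, elements of \<open>L\<^sup>2(m)\<close> are functions and not just classes
  of functions modulo null sets.\<close>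

definition L2 :: "('a \<Rightarrow> real) \<Rightarrow> ('a \<Rightarrow> complex) set" where
  "L2 m = {f. integrable (flow_measure m) (\<lambda>x. (cmod (f x))\<^sup>2)}"

definition L2_inner :: "('a \<Rightarrow> real) \<Rightarrow> ('a \<Rightarrow> complex) \<Rightarrow> ('a \<Rightarrow> complex) \<Rightarrow> complex" where
  "L2_inner m f g = (\<integral>x. f x * cnj (g x) \<partial>flow_measure m)"

definition L1_norm :: "('a \<Rightarrow> real) \<Rightarrow> ('a \<Rightarrow> complex) \<Rightarrow> ennreal" where
  "L1_norm m f = (\<integral>\<^sup>+x. ennreal (cmod (f x)) \<partial>flow_measure m)"


section \<open>The flow Laplacian\<close>

definition L2_adjoint ::
    "('a \<Rightarrow> real) \<Rightarrow> (('a \<Rightarrow> complex) \<Rightarrow> 'a \<Rightarrow> complex) \<Rightarrow> ('a \<Rightarrow> complex) \<Rightarrow> 'a \<Rightarrow> complex" where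
  "L2_adjoint m A g = (THE h. h \<in> L2 m \<and> (\<forall>f\<in>L2 m. L2_inner m (A f) g = L2_inner m f h))"

definition flow_gradient :: "(nat \<Rightarrow> 'a) set \<Rightarrow> ('a \<Rightarrow> complex) \<Rightarrow> 'a \<Rightarrow> complex" where
  "flow_gradient \<omega> f x = f x - f (predecessor \<omega> x)"

definition flow_Laplacian ::
    "(nat \<Rightarrow> 'a) set \<Rightarrow> ('a \<Rightarrow> real) \<Rightarrow> ('a \<Rightarrow> complex) \<Rightarrow> 'a \<Rightarrow> complex" where
  "flow_Laplacian \<omega> m f x = 1/2 * L2_adjoint m (flow_gradient \<omega>) (flow_gradient \<omega> f) x"


section \<open>Borel functional calculus\<close>

text \<open>For \<open>f \<in> L\<^sup>2(m)\<close>, the scalar measure \<open>B \<mapsto> \<langle>E(B) f, f\<rangle>\<close>.\<close>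

definition spectral_dist ::
    "('a \<Rightarrow> real) \<Rightarrow> (real set \<Rightarrow> ('a \<Rightarrow> complex) \<Rightarrow> 'a \<Rightarrow> complex) \<Rightarrow> ('a \<Rightarrow> complex) \<Rightarrow> real measure" where
  "spectral_dist m E f =
     measure_of (space borel) (sets borel) (\<lambda>B. ennreal (Re (L2_inner m (E B f) f)))"

text \<open>\<open>E\<close> is a projection-valued measure on \<open>L\<^sup>2(m)\<close> with \<open>A = \<integral> \<lambda> dE(\<lambda>)\<close>. Linearity of
  \<open>E B\<close> on \<open>L\<^sup>2(m)\<close> is a consequence of its symmetry, and weak countable additivity implies
  the strong one. By the spectral theorem, every bounded selfadjoint \<open>A\<close> has
  such an \<open>E\<close>, unique on Borel sets and elements of \<open>L\<^sup>2(m)\<close>.\<close>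

definition spectral_resolution ::
    "('a \<Rightarrow> real) \<Rightarrow> (('a \<Rightarrow> complex) \<Rightarrow> 'a \<Rightarrow> complex) \<Rightarrow>
     (real set \<Rightarrow> ('a \<Rightarrow> complex) \<Rightarrow> 'a \<Rightarrow> complex) \<Rightarrow> bool" where
  "spectral_resolution m A E \<longleftrightarrow>
     (\<forall>B\<in>sets borel. \<forall>f\<in>L2 m. E B f \<in> L2 m) \<and>
     (\<forall>B\<in>sets borel. \<forall>f\<in>L2 m. \<forall>g\<in>L2 m. L2_inner m (E B f) g = L2_inner m f (E B g)) \<and>
     (\<forall>B\<in>sets borel. \<forall>C\<in>sets borel. \<forall>f\<in>L2 m. E (B \<inter> C) f = E B (E C f)) \<and>
     (\<forall>f\<in>L2 m. E UNIV f = f) \<and>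
     (\<forall>B. range B \<subseteq> sets borel \<longrightarrow> disjoint_family B \<longrightarrow>
        (\<forall>f\<in>L2 m. (\<lambda>n::nat. L2_inner m (E (B n) f) f) sums L2_inner m (E (\<Union>n. B n) f) f)) \<and>
     (\<forall>f\<in>L2 m. integrable (spectral_dist m E f) (\<lambda>l. l) \<and>
        L2_inner m (A f) f = complex_of_real (\<integral>l. l \<partial>spectral_dist m E f))"

text \<open>The integral of \<open>F\<close> with respect to the complex measure \<open>B \<mapsto> \<langle>E(B) f, h\<rangle>\<close>, expressed
  through the positive measures of \<^const>\<open>spectral_dist\<close> by polarization.\<close>

definition spectral_integral ::
    "('a \<Rightarrow> real) \<Rightarrow> (real set \<Rightarrow> ('a \<Rightarrow> complex) \<Rightarrow> 'a \<Rightarrow> complex) \<Rightarrow> (real \<Rightarrow> complex) \<Rightarrow>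
     ('a \<Rightarrow> complex) \<Rightarrow> ('a \<Rightarrow> complex) \<Rightarrow> complex" where
  "spectral_integral m E F f h =
     1/4 * (\<Sum>k<4. \<i>^k * (\<integral>l. F l \<partial>spectral_dist m E (\<lambda>x. f x + \<i>^k * h x)))"

definition calculus_domain ::
    "('a \<Rightarrow> real) \<Rightarrow> (real set \<Rightarrow> ('a \<Rightarrow> complex) \<Rightarrow> 'a \<Rightarrow> complex) \<Rightarrow> (real \<Rightarrow> complex) \<Rightarrow>
     ('a \<Rightarrow> complex) set" where
  "calculus_domain m E F = {f \<in> L2 m. integrable (spectral_dist m E f) (\<lambda>l. (cmod (F l))\<^sup>2)}"

text \<open>As \<open>F\<close> need not be bounded, \<open>F(A)\<close> is in general an unbounded operator; it is represented
  by its graph \<open>{(f, F(A) f) | f \<in> dom F(A)}\<close>. The domain is dense in \<open>L\<^sup>2(m)\<close>, so \<open>g\<close> is determined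
  by \<open>f\<close>.\<close>

definition borel_calculus ::
    "('a \<Rightarrow> real) \<Rightarrow> (('a \<Rightarrow> complex) \<Rightarrow> 'a \<Rightarrow> complex) \<Rightarrow> (real \<Rightarrow> complex) \<Rightarrow>
     (('a \<Rightarrow> complex) \<times> ('a \<Rightarrow> complex)) set" where
  "borel_calculus m A F =
     {(f, g). \<exists>E. spectral_resolution m A E \<and> f \<in> calculus_domain m E F \<and> g \<in> L2 m \<and>
        (\<forall>h\<in>calculus_domain m E F. L2_inner m g h = spectral_integral m E F f h)}"


section \<open>The Hardy space\<close>

definition trapezoid ::
    "('a \<Rightarrow> 'a \<Rightarrow> bool) \<Rightarrow> (nat \<Rightarrow> 'a) set \<Rightarrow> nat \<Rightarrow> nat \<Rightarrow> 'a \<Rightarrow> 'a set" where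
  "trapezoid adj \<omega> h' h'' x =
     {y. tree_le \<omega> y x \<and> h' \<le> graph_dist adj x y \<and> graph_dist adj x y < h''}"

definition admissible_trapezoid ::
    "('a \<Rightarrow> 'a \<Rightarrow> bool) \<Rightarrow> (nat \<Rightarrow> 'a) set \<Rightarrow> 'a set \<Rightarrow> bool" where
  "admissible_trapezoid adj \<omega> R \<longleftrightarrow>
     (\<exists>x. R = {x}) \<or>
     (\<exists>x h' h''. 1 \<le> h' \<and> h' < h'' \<and> 2 \<le> real h'' / real h' \<and> real h'' / real h' \<le> 12 \<and>
        R = trapezoid adj \<omega> h' h'' x)"

definition is_atom ::
    "('a \<Rightarrow> 'a \<Rightarrow> bool) \<Rightarrow> (nat \<Rightarrow> 'a) set \<Rightarrow> ('a \<Rightarrow> real) \<Rightarrow> ('a \<Rightarrow> complex) \<Rightarrow> bool" where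
  "is_atom adj \<omega> m a \<longleftrightarrow>
     (\<exists>R. admissible_trapezoid adj \<omega> R \<and>
        (\<forall>x. x \<notin> R \<longrightarrow> a x = 0) \<and>
        (\<Sum>\<^sub>\<infinity>x. a x * complex_of_real (m x)) = 0 \<and>
        (\<forall>x. cmod (a x) \<le> 1 / measure (flow_measure m) R))"

definition atomic_decomposition ::
    "('a \<Rightarrow> 'a \<Rightarrow> bool) \<Rightarrow> (nat \<Rightarrow> 'a) set \<Rightarrow> ('a \<Rightarrow> real) \<Rightarrow> ('a \<Rightarrow> complex) \<Rightarrow>
     (nat \<Rightarrow> complex) \<Rightarrow> (nat \<Rightarrow> 'a \<Rightarrow> complex) \<Rightarrow> bool" where
  "atomic_decomposition adj \<omega> m f c a \<longleftrightarrow>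
     (\<forall>j. is_atom adj \<omega> m (a j)) \<and> summable (\<lambda>j. cmod (c j)) \<and>
     (\<lambda>N. L1_norm m (\<lambda>x. f x - (\<Sum>j<N. c j * a j x))) \<longlonglongrightarrow> 0"

definition H1 ::
    "('a \<Rightarrow> 'a \<Rightarrow> bool) \<Rightarrow> (nat \<Rightarrow> 'a) set \<Rightarrow> ('a \<Rightarrow> real) \<Rightarrow> ('a \<Rightarrow> complex) set" where
  "H1 adj \<omega> m = {f. \<exists>c a. atomic_decomposition adj \<omega> m f c a}"

definition H1_norm ::
    "('a \<Rightarrow> 'a \<Rightarrow> bool) \<Rightarrow> (nat \<Rightarrow> 'a) set \<Rightarrow> ('a \<Rightarrow> real) \<Rightarrow> ('a \<Rightarrow> complex) \<Rightarrow> real" where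
  "H1_norm adj \<omega> m f = Inf {(\<Sum>j. cmod (c j)) | c a. atomic_decomposition adj \<omega> m f c a}"

text \<open>\<open>T\<close> is the graph of an operator on \<open>L\<^sup>2(m)\<close>.\<close>

definition bounded_H1_L1 ::
    "('a \<Rightarrow> 'a \<Rightarrow> bool) \<Rightarrow> (nat \<Rightarrow> 'a) set \<Rightarrow> ('a \<Rightarrow> real) \<Rightarrow>
     (('a \<Rightarrow> complex) \<times> ('a \<Rightarrow> complex)) set \<Rightarrow> bool" where
  "bounded_H1_L1 adj \<omega> m T \<longleftrightarrow>
     (\<exists>C. \<forall>(f, g)\<in>T. f \<in> H1 adj \<omega> m \<longrightarrow> L1_norm m g \<le> ennreal (C * H1_norm adj \<omega> m f))"


section \<open>Sobolev norms on the real line\<close>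

text \<open>\<open>g\<close> is the (unitary) Fourier--Plancherel transform of the \<open>L\<^sup>2\<close> function \<open>f\<close>: the \<open>L\<^sup>2\<close> limit
  of the Fourier integrals of the truncations of \<open>f\<close> to \<open>[-n, n]\<close>. It exists and is unique up to
  null sets.\<close>

definition plancherel_transform :: "(real \<Rightarrow> complex) \<Rightarrow> (real \<Rightarrow> complex) \<Rightarrow> bool" where
  "plancherel_transform f g \<longleftrightarrow>
     f \<in> borel_measurable lborel \<and> integrable lborel (\<lambda>x. (cmod (f x))\<^sup>2) \<and>
     g \<in> borel_measurable lborel \<and>
     (\<lambda>n. \<integral>\<^sup>+\<xi>. ennreal ((cmod (g \<xi> -
         complex_of_real (1 / sqrt (2 * pi)) *
           (LINT x:{-real n..real n}|lborel. f x * cis (- (x * \<xi>)))))\<^sup>2) \<partial>lborel) \<longlonglongrightarrow> 0"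

text \<open>The \<open>L\<^sup>2\<^sub>s\<close> norm for \<open>s \<ge> 0\<close>, with value \<open>\<infinity>\<close> outside \<open>L\<^sup>2\<^sub>s\<close> (in particular, as an infimum
  over the empty set, outside \<open>L\<^sup>2\<close>). The infimum is over one number only, as all \<open>g\<close> agree almost
  everywhere.\<close>

definition sobolev_norm :: "real \<Rightarrow> (real \<Rightarrow> complex) \<Rightarrow> ennreal" where
  "sobolev_norm s f =
     (INF g\<in>{g. plancherel_transform f g}.
        if integrable lborel (\<lambda>\<xi>. (1 + \<xi>\<^sup>2) powr s * (cmod (g \<xi>))\<^sup>2)
        then ennreal (sqrt (\<integral>\<xi>. (1 + \<xi>\<^sup>2) powr s * (cmod (g \<xi>))\<^sup>2 \<partial>lborel))
        else \<infinity>)"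

definition smooth :: "(real \<Rightarrow> real) \<Rightarrow> bool" where
  "smooth f \<longleftrightarrow> (\<forall>n x. (deriv ^^ n) f differentiable (at x))"

end

theory Submission
  imports Defs "HOL-Probability.Helly_Selection" "HOL-Probability.Sinc_Integral" "HOL-Real_Asymp.Real_Asymp"
begin

text \<open>
  The multiplier is \<open>F(\<lambda>) = (2 - \<lambda>)\<^sup>i\<close>. It satisfies \<open>F(2 - t \<lambda>) = t\<^sup>i \<lambda>\<^sup>i\<close> with \<open>|t\<^sup>i| = 1\<close>, so
  that the Sobolev norms of \<open>F(2 - t \<cdot>)\<chi>\<close> do not depend on \<open>t\<close>.

  On \<open>L\<^sup>2(m)\<close> one has \<open>\<L> = 1 - V\<close>, where \<open>V\<close> is the mean of the isometry \<open>f \<mapsto> f \<circ> \<pp>\<close> and its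
  adjoint, and \<open>V\<close> is a contraction of \<open>L\<^sup>1(m)\<close>. If \<open>h\<close> is a height function,
  the transform \<open>f \<mapsto> \<Sum>\<^sub>x f(x) e\<^sup>i\<^sup>t\<^sup>h\<^sup>(\<^sup>x\<^sup>) m(x)\<close> turns \<open>V\<close> into multiplication by
  \<open>cos t\<close>. Suppose that \<open>g = F(\<L>) f\<close> is integrable for an atom \<open>f\<close>. The
  series \<open>(1 + u)\<^sup>1\<^sup>+\<^sup>i = \<Sum>\<^sub>n a\<^sub>n u\<^sup>n\<close> converges absolutely on \<open>[-1, 1]\<close>, so \<open>(2 - \<L>) g = \<Sum>\<^sub>n a\<^sub>n V\<^sup>n f\<close>
  in \<open>L\<^sup>1(m)\<close>, and the transforms of \<open>g\<close> and \<open>f\<close> differ by the factor \<open>(1 + cos t)\<^sup>i\<close>. Both are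
  continuous, but the factor has no limit at \<open>t = \<pi>\<close>; hence the transform of \<open>f\<close> would vanish
  at \<open>\<pi>\<close>, which is false for a suitable \<open>f\<close> supported by a vertex and its predecessor.
\<close>

section \<open>The Hausdorff moment problem\<close>

text \<open>\<open>borel_calculus\<close> relates f to g only through some spectral resolution.
  Without one its graph is empty and every bound on it holds, so much of the development constructs
  a resolution for \<L>. For T = \<L>/2 the numbers \<langle>T^k (1 - T)^l f, f\<rangle> are
  nonnegative, and T + (1 - T) = 1 gives them the difference equation of the moments \<integral> x^k
  (1 - x)^l of a measure on [0, 1]. The Hausdorff moment problem returns that measure, and
  polarization turns these measures into a calculus.

  The exponent 1 + i is dictated by the endpoint u = -1: the coefficients of (1 + u)^i have size 1/n
  and are not absolutely summable, those of (1 + u)^(1 + i) have size 1/n^2. The price is the factor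
  1 + u = 2 - \<lambda>, that is 1 + cos t, which can be cancelled away from t = \<pi>.

  The singularity of F sits at the top \<lambda> = 2 of the spectrum, the frequency t = \<pi>. The
  mean-zero condition on atoms kills the transform at t = 0 only, so it does not interfere there.
  The failure is qualitative: the image of a single atom is not integrable.\<close>

lemma binomial_difference_sum:
  fixes D :: "nat \<Rightarrow> nat \<Rightarrow> real"
  assumes D: "\<And>k l. D k l = D (Suc k) l + D k (Suc l)"
  shows "(\<Sum>k\<le>n. real (n choose k) * D (j + k) (l + (n - k))) = D j l"
proof (induction n arbitrary: j l)
  case 0
  then show ?case by simp
next
  case (Suc n)
  define u where "u k = D (j + k) (l + (Suc n - k))" for k
  have "(\<Sum>k\<le>Suc n. real (Suc n choose k) * u k)
      = u 0 + (\<Sum>k\<le>n. (real (n choose k) + real (n choose Suc k)) * u (Suc k))"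
    by (subst sum.atMost_Suc_shift) simp
  also have "\<dots> = (\<Sum>k\<le>n. real (n choose k) * u (Suc k)) + (u 0 + (\<Sum>k\<le>n. real (n choose Suc k) * u (Suc k)))"
    by (simp add: algebra_simps sum.distrib)
  also have "u 0 + (\<Sum>k\<le>n. real (n choose Suc k) * u (Suc k)) = (\<Sum>k\<le>Suc n. real (n choose k) * u k)"
    by (subst sum.atMost_Suc_shift) simp
  also have "\<dots> = (\<Sum>k\<le>n. real (n choose k) * u k)"
    by simp
  also have "(\<Sum>k\<le>n. real (n choose k) * u (Suc k)) = D (Suc j) l"
    using Suc.IH[of "Suc j" l] by (simp add: u_def)
  also have "(\<Sum>k\<le>n. real (n choose k) * u k) = D j (Suc l)"
    using Suc.IH[of j "Suc l"] by (simp add: u_def Suc_diff_le)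
  finally show ?case
    using D[of j l] by (simp add: u_def)
qed

text \<open>If \<open>D k l\<close> is \<integral> x^k (1 - x)^l, the weights
  \<open>(n choose k) * D k (n - k)\<close> are the law of the number of successes in n trials with
  random success probability x, and the claim is the formula for its factorial moments. After (n
  choose k)(k choose j) = (n choose j)(n - j choose k - j), what remains is
  \<open>binomial_difference_sum\<close> started at (j, 0).\<close>

lemma binomial_factorial_moment:
  fixes D :: "nat \<Rightarrow> nat \<Rightarrow> real"
  assumes D: "\<And>k l. D k l = D (Suc k) l + D k (Suc l)" and "j \<le> n"
  shows "(\<Sum>k\<le>n. real (n choose k) * D k (n - k) * (real (k choose j) / real (n choose j))) = D j 0"
proof -
  have "(\<Sum>k\<le>n. real (n choose k) * D k (n - k) * (real (k choose j) / real (n choose j)))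
      = (\<Sum>k=j..n. real (n choose k) * D k (n - k) * (real (k choose j) / real (n choose j)))"
    by (rule sum.mono_neutral_right) (auto simp: not_le)
  also have "\<dots> = (\<Sum>k=j..n. real ((n - j) choose (k - j)) * D k (n - k))"
  proof (rule sum.cong)
    fix k assume k: "k \<in> {j..n}"
    then have "(n choose k) * (k choose j) = (n choose j) * ((n - j) choose (k - j))"
      by (intro choose_mult) auto
    then have "real (n choose k) * real (k choose j) = real (n choose j) * real ((n - j) choose (k - j))"
      by (metis of_nat_mult)
    moreover have "real (n choose j) \<noteq> 0"
      using \<open>j \<le> n\<close> by simp
    ultimately show "real (n choose k) * D k (n - k) * (real (k choose j) / real (n choose j))
        = real ((n - j) choose (k - j)) * D k (n - k)"
      by (simp add: field_simps)
  qed simp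
  also have "\<dots> = (\<Sum>k\<le>n - j. real ((n - j) choose k) * D (j + k) (0 + ((n - j) - k)))"
    by (rule sum.reindex_bij_witness[of _ "\<lambda>k. k + j" "\<lambda>k. k - j"]) (use \<open>j \<le> n\<close> in \<open>auto simp: algebra_simps\<close>)
  also have "\<dots> = D j 0"
    by (rule binomial_difference_sum[where D=D, OF D])
  finally show ?thesis .
qed

text \<open>Both quantities are products of j factors, (k - i)/(n - i) against k/n. All factors have
  modulus at most 1, so the products differ by at most the sum of the differences of the factors.
  The condition \<open>2 * j < n\<close> keeps (k - i)/(n - i) in [-1, 1] even when k < i.\<close>

lemma choose_ratio_approx_power:
  assumes "2 * j < n" "k \<le> n"
  shows "\<bar>real (k choose j) / real (n choose j) - (real k / real n) ^ j\<bar> \<le> (real j)\<^sup>2 / (real n - real j)"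
proof -
  have prod: "real (p choose j) = (\<Prod>i<j. (real p - real i)) / fact j" for p
    by (simp add: binomial_gbinomial gbinomial_prod_rev atLeast0LessThan)
  have ne: "(\<Prod>i<j. (real n - real i)) \<noteq> 0"
    using assms by auto
  have "real (k choose j) / real (n choose j) = (\<Prod>i<j. (real k - real i)) / (\<Prod>i<j. (real n - real i))"
    unfolding prod by simp
  also have "\<dots> = (\<Prod>i<j. (real k - real i) / (real n - real i))"
    by (simp add: prod_dividef)
  finally have eq: "real (k choose j) / real (n choose j) = (\<Prod>i<j. (real k - real i) / (real n - real i))" .
  have "norm ((\<Prod>i<j. (real k - real i) / (real n - real i)) - (\<Prod>i<j. real k / real n))
      \<le> (\<Sum>i<j. norm ((real k - real i) / (real n - real i) - real k / real n))"
  proof (rule norm_prod_diff)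
    fix i assume "i \<in> {..<j}"
    then have "real i < real j" by simp
    moreover have "2 * real j < real n" "real k \<le> real n" using assms by linarith+
    ultimately show "norm ((real k - real i) / (real n - real i)) \<le> 1"
      by (auto simp: divide_simps abs_if)
    show "norm (real k / real n) \<le> 1" using assms by (auto simp: divide_simps)
  qed
  also have "\<dots> \<le> (\<Sum>i<j. real j / (real n - real j))"
  proof (rule sum_mono)
    fix i assume "i \<in> {..<j}"
    then have i: "real i < real j" by simp
    have n: "2 * real j < real n" "real k \<le> real n" using assms by linarith+
    have "(real k - real i) / (real n - real i) - real k / real n
        = - (real i / (real n - real i)) * ((real n - real k) / real n)"
      using i n by (simp add: field_simps)
    then have "norm ((real k - real i) / (real n - real i) - real k / real n)
        = (real i / (real n - real i)) * ((real n - real k) / real n)"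
      using i n by (simp add: abs_mult)
    also have "\<dots> \<le> (real i / (real n - real i)) * 1"
      using i n by (intro mult_left_mono) (auto simp: divide_simps)
    also have "\<dots> \<le> real j / (real n - real j)"
      using i n by (simp, intro frac_le) auto
    finally show "norm ((real k - real i) / (real n - real i) - real k / real n) \<le> real j / (real n - real j)" .
  qed
  also have "\<dots> = (real j)\<^sup>2 / (real n - real j)"
    by (simp add: power2_eq_square)
  finally show ?thesis
    unfolding eq by simp
qed

text \<open>The measure is a weak limit of the discrete laws with mass \<open>w n k\<close> at k/n.
  Helly's selection theorem gives a convergent subsequence, and the j-th moment of the n-th law
  differs from its normalised factorial moment, which is exactly \<open>D j 0\<close>, by
  O(1/n).\<close>

lemma hausdorff_moment_prob:
  fixes D :: "nat \<Rightarrow> nat \<Rightarrow> real"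
  assumes D: "\<And>k l. D k l = D (Suc k) l + D k (Suc l)" and nonneg: "\<And>k l. 0 \<le> D k l"
    and D0: "D 0 0 = 1"
  shows "\<exists>M. real_distribution M \<and> (AE x in M. x \<in> {0..1}) \<and> (\<forall>j. (\<integral>x. x ^ j \<partial>M) = D j 0)"
proof -
  define w where "w n k = real (n choose k) * D k (n - k)" for n k
  \<comment> \<open>For n = 0 the single atom sits at \<open>0 / 0 = 0\<close>, which still lies in
    [0, 1].\<close>
  define \<nu> where "\<nu> n = distr (point_measure {..n} (\<lambda>k. ennreal (w n k))) borel (\<lambda>k. real k / real n)" for n
  have w: "0 \<le> w n k" for n k
    unfolding w_def using nonneg by simp
  have wsum: "(\<Sum>k\<le>n. w n k) = 1" for n
    using binomial_difference_sum[where D=D and n=n and j=0 and l=0, OF D] D0 by (simp add: w_def)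
  have int: "(\<integral>x. f x \<partial>\<nu> n) = (\<Sum>k\<le>n. w n k * f (real k / real n))" if "f \<in> borel_measurable borel"
    for f :: "real \<Rightarrow> real" and n
    unfolding \<nu>_def using that w
    by (subst integral_distr) (auto simp: lebesgue_integral_point_measure_finite space_point_measure)
  have prob: "real_distribution (\<nu> n)" for n
  proof -
    have "emeasure (point_measure {..n} (\<lambda>k. ennreal (w n k))) {..n} = ennreal (\<Sum>k\<le>n. w n k)"
      by (subst emeasure_point_measure_finite) (auto simp: w sum_ennreal)
    then have "prob_space (point_measure {..n} (\<lambda>k. ennreal (w n k)))"
      by (intro prob_spaceI) (simp add: space_point_measure wsum)
    then have "prob_space (\<nu> n)"
      unfolding \<nu>_def by (rule prob_space.prob_space_distr) (auto simp: space_point_measure)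
    then show ?thesis
      by (simp add: real_distribution_def real_distribution_axioms_def \<nu>_def)
  qed
  \<comment> \<open>All the laws live on [0, 1]; any half-open interval around it, the shape used in
    \<open>tight\<close>, gives tightness.\<close>
  have meas1: "measure (\<nu> n) {-1<..2} = 1" for n
  proof -
    have "measure (\<nu> n) {-1<..2} = (\<integral>x. indicator {-1<..2} x \<partial>\<nu> n)"
      by (simp add: \<nu>_def)
    also have "\<dots> = (\<Sum>k\<le>n. w n k * indicator {-1<..2} (real k / real n))"
      by (rule int) simp
    also have "\<dots> = (\<Sum>k\<le>n. w n k)"
    proof (intro sum.cong refl)
      fix k assume "k \<in> {..n}"
      then have "0 \<le> real k / real n" "real k / real n \<le> 1" by (auto simp: divide_simps)
      then have "real k / real n \<in> {-1<..2}" unfolding greaterThanAtMost_iff by linarith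
      then show "w n k * indicator {-1<..2} (real k / real n) = w n k" by simp
    qed
    finally show ?thesis using wsum by simp
  qed
  have "tight \<nu>"
    unfolding tight_def
  proof (intro conjI allI impI)
    fix e :: real assume "e > 0"
    then show "\<exists>a b. a < b \<and> (\<forall>n. 1 - e < measure (\<nu> n) {a<..b})"
      using meas1 by (intro exI[of _ "-1"] exI[of _ 2]) auto
  qed (rule prob)
  then obtain r M where r: "strict_mono r" and M: "real_distribution M"
    and conv: "weak_conv_m (\<nu> \<circ> id \<circ> r) M"
    using tight_imp_convergent_subsubsequence[of \<nu> id] strict_mono_id by blast
  have lim: "(\<lambda>n. \<integral>x. f x \<partial>\<nu> (r n)) \<longlonglongrightarrow> (\<integral>x. f x \<partial>M)"
    if "\<And>x. isCont f x" "\<And>x. norm (f x) \<le> B" for f :: "real \<Rightarrow> real" and B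
    using weak_conv_imp_integral_bdd_continuous_conv[OF _ M conv that] prob by (simp add: o_def)
  interpret M: real_distribution M by fact
  have unit: "AE x in M. x \<in> {0..1}"
  proof -
    \<comment> \<open>The truncated distance to [0, 1]: a bounded continuous test function whose
      zero set is exactly [0, 1]. Its integral is 0 for every \<open>\<nu> n\<close>, hence for the
      limit.\<close>
    define f where "f x = min 1 (max 0 (max (-x) (x - 1)))" for x :: real
    have f[measurable]: "f \<in> borel_measurable borel" unfolding f_def by measurable
    have fb: "norm (f x) \<le> 1" for x unfolding f_def by auto
    have "(\<integral>x. f x \<partial>\<nu> n) = 0" for n
      unfolding int[OF f] by (intro sum.neutral) (auto simp: f_def divide_simps)
    moreover have "(\<lambda>n. \<integral>x. f x \<partial>\<nu> (r n)) \<longlonglongrightarrow> (\<integral>x. f x \<partial>M)"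
      by (rule lim[OF _ fb]) (auto simp: f_def intro!: continuous_intros)
    ultimately have "(\<integral>x. f x \<partial>M) = 0"
      by (simp add: LIMSEQ_const_iff)
    moreover have "integrable M f"
      by (rule M.integrable_const_bound[of _ 1]) (use fb in auto)
    ultimately have "AE x in M. f x = 0"
      by (subst (asm) integral_nonneg_eq_0_iff_AE) (auto simp: f_def)
    then show ?thesis
      by eventually_elim (auto simp: f_def min_def max_def split: if_splits)
  qed
  have moment: "(\<integral>x. x ^ j \<partial>M) = D j 0" for j
  proof -
    \<comment> \<open>Powers are unbounded on the line, so they are clamped outside [0, 1] to become
      test functions for weak convergence.\<close>
    define f where "f x = (max 0 (min 1 x)) ^ j" for x :: real
    have f[measurable]: "f \<in> borel_measurable borel" unfolding f_def by measurable
    have fb: "norm (f x) \<le> 1" for x unfolding f_def by (auto intro!: power_le_one)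
    have "(\<integral>x. x ^ j \<partial>M) = (\<integral>x. f x \<partial>M)"
    proof (intro integral_cong_AE)
      show "AE x in M. x ^ j = f x"
        using unit by eventually_elim (auto simp: f_def)
    qed auto
    moreover have l1: "(\<lambda>n. \<integral>x. f x \<partial>\<nu> (r n)) \<longlonglongrightarrow> (\<integral>x. f x \<partial>M)"
      by (rule lim[OF _ fb]) (auto simp: f_def intro!: continuous_intros)
    have bound: "\<bar>(\<integral>x. f x \<partial>\<nu> n) - D j 0\<bar> \<le> (real j)\<^sup>2 / (real n - real j)" if n: "n > 2 * j" for n
    proof -
      have "(\<integral>x. f x \<partial>\<nu> n) = (\<Sum>k\<le>n. w n k * (real k / real n) ^ j)"
        unfolding int[OF f] by (intro sum.cong refl) (auto simp: f_def divide_simps min_def max_def)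
      moreover have "D j 0 = (\<Sum>k\<le>n. w n k * (real (k choose j) / real (n choose j)))"
        using binomial_factorial_moment[where D=D and j=j and n=n, OF D] n by (simp add: w_def)
      ultimately have "\<bar>(\<integral>x. f x \<partial>\<nu> n) - D j 0\<bar>
          = \<bar>\<Sum>k\<le>n. w n k * ((real k / real n) ^ j - real (k choose j) / real (n choose j))\<bar>"
        by (simp add: sum_subtractf right_diff_distrib)
      also have "\<dots> \<le> (\<Sum>k\<le>n. w n k * ((real j)\<^sup>2 / (real n - real j)))"
      proof (rule order_trans[OF sum_abs sum_mono])
        fix k assume "k \<in> {..n}"
        then have "\<bar>real (k choose j) / real (n choose j) - (real k / real n) ^ j\<bar> \<le> (real j)\<^sup>2 / (real n - real j)"
          using n by (intro choose_ratio_approx_power) auto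
        then show "\<bar>w n k * ((real k / real n) ^ j - real (k choose j) / real (n choose j))\<bar>
            \<le> w n k * ((real j)\<^sup>2 / (real n - real j))"
          unfolding abs_mult using w[of n k] by (auto intro!: mult_left_mono simp: abs_minus_commute simp del: times_divide_eq_right)
      qed
      also have "\<dots> = (real j)\<^sup>2 / (real n - real j)"
        using wsum[of n] by (simp add: sum_distrib_right[symmetric] del: times_divide_eq_right)
      finally show ?thesis .
    qed
    have "(\<lambda>n. (\<integral>x. f x \<partial>\<nu> n) - D j 0) \<longlonglongrightarrow> 0"
    proof (rule Lim_null_comparison)
      show "\<forall>\<^sub>F n in sequentially. norm ((\<integral>x. f x \<partial>\<nu> n) - D j 0) \<le> (real j)\<^sup>2 / (real n - real j)"
        using eventually_gt_at_top[of "2 * j"] by eventually_elim (use bound in auto)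
      show "(\<lambda>n. (real j)\<^sup>2 / (real n - real j)) \<longlonglongrightarrow> 0"
        by real_asymp
    qed
    then have "(\<lambda>n. \<integral>x. f x \<partial>\<nu> n) \<longlonglongrightarrow> D j 0"
      by (simp add: LIM_zero_iff)
    then have "(\<lambda>n. \<integral>x. f x \<partial>\<nu> (r n)) \<longlonglongrightarrow> D j 0"
      using LIMSEQ_subseq_LIMSEQ[OF _ r] by (auto simp: o_def)
    ultimately show ?thesis
      using LIMSEQ_unique l1 by metis
  qed
  show ?thesis
    using M unit moment by blast
qed

lemma hausdorff_moment:
  fixes D :: "nat \<Rightarrow> nat \<Rightarrow> real"
  assumes D: "\<And>k l. D k l = D (Suc k) l + D k (Suc l)" and nonneg: "\<And>k l. 0 \<le> D k l"
    and b: "0 \<le> b"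
  shows "\<exists>M. finite_measure M \<and> sets M = sets (borel :: real measure) \<and> (AE x in M. x \<in> {0..b}) \<and>
    (\<forall>j. (\<integral>x. x ^ j \<partial>M) = b ^ j * D j 0)"
proof (cases "D 0 0 = 0")
  case True
  \<comment> \<open>\<open>D j 0\<close> is nonnegative and decreasing in j, so all moments vanish
    and the null measure represents them.\<close>
  have "D j 0 = 0" for j
  proof (induction j)
    case (Suc j)
    then show ?case using D[of j 0] nonneg[of "Suc j" 0] nonneg[of j "Suc 0"] by linarith
  qed (rule True)
  then show ?thesis
    by (intro exI[of _ "null_measure borel"])
      (auto intro!: finite_measureI AE_I[of _ _ UNIV] simp: integral_null_measure)
next
  case False
  define c where "c = D 0 0"
  have c: "c > 0" using False nonneg[of 0 0] by (simp add: c_def)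
  have "\<exists>M. real_distribution M \<and> (AE x in M. x \<in> {0..1}) \<and> (\<forall>j. (\<integral>x. x ^ j \<partial>M) = D j 0 / c)"
  proof (rule hausdorff_moment_prob[where D = "\<lambda>k l. D k l / c"])
    show "D k l / c = D (Suc k) l / c + D k (Suc l) / c" for k l
      using D[of k l] by (simp add: add_divide_distrib)
  qed (use c nonneg in \<open>auto simp: c_def\<close>)
  then obtain M where "real_distribution M" and M1: "AE x in M. x \<in> {0..1}"
    and M2: "\<And>j. (\<integral>x. x ^ j \<partial>M) = D j 0 / c" by blast
  interpret M: real_distribution M by fact
  define K where "K = density M (\<lambda>_. ennreal c)"
  define N where "N = distr K borel (\<lambda>x. b * x)"
  have setsK[measurable_cong]: "sets K = sets borel" by (simp add: K_def)
  have sets[simp]: "sets N = sets borel" by (simp add: N_def)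
  have "finite_measure K"
    by (rule finite_measureI) (simp add: K_def emeasure_density M.emeasure_space_1 ennreal_mult_eq_top_iff)
  then have "finite_measure N"
    unfolding N_def by (rule finite_measure.finite_measure_distr) simp
  moreover have "AE x in N. x \<in> {0..b}"
  proof -
    have "AE x in M. b * x \<in> {0..b}"
      using M1 by eventually_elim (use b in \<open>auto simp: mult_left_le\<close>)
    then have "AE x in K. b * x \<in> {0..b}"
      unfolding K_def by (subst AE_density) auto
    then show ?thesis unfolding N_def by (subst AE_distr_iff) auto
  qed
  moreover have "(\<integral>x. x ^ j \<partial>N) = b ^ j * D j 0" for j
  proof -
    have "(\<integral>x. x ^ j \<partial>N) = (\<integral>x. (b * x) ^ j \<partial>K)"
      unfolding N_def by (subst integral_distr) auto
    also have "\<dots> = c * (\<integral>x. (b * x) ^ j \<partial>M)"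
      using c unfolding K_def by (subst integral_real_density) auto
    also have "\<dots> = b ^ j * D j 0"
      using c M2[of j] by (simp add: power_mult_distrib)
    finally show ?thesis .
  qed
  ultimately show ?thesis
    using sets by blast
qed

section \<open>Functionals on bounded Borel functions\<close>

text \<open>Boundedness is asked for only on [0, b], where the spectral measures live, so that
  polynomials belong to the class.\<close>

definition bounded_borel :: "real \<Rightarrow> (real \<Rightarrow> complex) set" where
  "bounded_borel b = {\<phi> \<in> borel_measurable borel. \<exists>C. \<forall>x\<in>{0..b}. cmod (\<phi> x) \<le> C}"

text \<open>An abstract stand-in for integration against a complex measure on [0, b]: linearity and
  continuity under bounded pointwise convergence are the properties that the uniqueness argument
  needs.\<close>

definition sigma_functional :: "real \<Rightarrow> ((real \<Rightarrow> complex) \<Rightarrow> complex) \<Rightarrow> bool" where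
  "sigma_functional b \<Lambda> \<longleftrightarrow>
     (\<forall>\<phi>\<in>bounded_borel b. \<forall>\<psi>\<in>bounded_borel b. \<Lambda> (\<lambda>x. \<phi> x + \<psi> x) = \<Lambda> \<phi> + \<Lambda> \<psi>) \<and>
     (\<forall>\<phi>\<in>bounded_borel b. \<forall>c. \<Lambda> (\<lambda>x. c * \<phi> x) = c * \<Lambda> \<phi>) \<and>
     (\<forall>f \<phi> C. (\<forall>n::nat. f n \<in> borel_measurable borel) \<longrightarrow> (\<forall>n. \<forall>x\<in>{0..b}. cmod (f n x) \<le> C) \<longrightarrow>
        \<phi> \<in> borel_measurable borel \<longrightarrow> (\<forall>x\<in>{0..b}. (\<lambda>n. f n x) \<longlonglongrightarrow> \<phi> x) \<longrightarrow>
        (\<lambda>n. \<Lambda> (f n)) \<longlonglongrightarrow> \<Lambda> \<phi>)"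

lemma bounded_borelI:
  "\<phi> \<in> borel_measurable borel \<Longrightarrow> (\<And>x. 0 \<le> x \<Longrightarrow> x \<le> b \<Longrightarrow> cmod (\<phi> x) \<le> C) \<Longrightarrow> \<phi> \<in> bounded_borel b"
  unfolding bounded_borel_def by (auto intro!: exI[of _ C])

lemma bounded_borel_measurable: "\<phi> \<in> bounded_borel b \<Longrightarrow> \<phi> \<in> borel_measurable borel"
  unfolding bounded_borel_def by auto

lemma bounded_borel_bound:
  assumes "\<phi> \<in> bounded_borel b"
  obtains C where "C > 0" "\<And>x. 0 \<le> x \<Longrightarrow> x \<le> b \<Longrightarrow> cmod (\<phi> x) \<le> C"
proof -
  obtain C where "\<And>x. x \<in> {0..b} \<Longrightarrow> cmod (\<phi> x) \<le> C"
    using assms unfolding bounded_borel_def by blast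
  then have "\<And>x. 0 \<le> x \<Longrightarrow> x \<le> b \<Longrightarrow> cmod (\<phi> x) \<le> max C 1"
    by (meson atLeastAtMost_iff le_max_iff_disj)
  then show thesis using that[of "max C 1"] by auto
qed

lemma bounded_borel_const [intro, simp]: "(\<lambda>_. c) \<in> bounded_borel b"
  by (rule bounded_borelI[where C = "cmod c"]) auto

lemma bounded_borel_add [intro]:
  assumes "\<phi> \<in> bounded_borel b" "\<psi> \<in> bounded_borel b"
  shows "(\<lambda>x. \<phi> x + \<psi> x) \<in> bounded_borel b"
proof -
  obtain C C' where "\<And>x. 0 \<le> x \<Longrightarrow> x \<le> b \<Longrightarrow> cmod (\<phi> x) \<le> C" "\<And>x. 0 \<le> x \<Longrightarrow> x \<le> b \<Longrightarrow> cmod (\<psi> x) \<le> C'"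
    using assms by (metis bounded_borel_bound)
  then show ?thesis
    using assms by (intro bounded_borelI[where C = "C + C'"])
      (auto intro!: norm_triangle_mono borel_measurable_add bounded_borel_measurable[OF assms(1)] bounded_borel_measurable[OF assms(2)])
qed

lemma bounded_borel_mult [intro]:
  assumes "\<phi> \<in> bounded_borel b" "\<psi> \<in> bounded_borel b"
  shows "(\<lambda>x. \<phi> x * \<psi> x) \<in> bounded_borel b"
proof -
  obtain C C' where "C > 0" "\<And>x. 0 \<le> x \<Longrightarrow> x \<le> b \<Longrightarrow> cmod (\<phi> x) \<le> C"
      "\<And>x. 0 \<le> x \<Longrightarrow> x \<le> b \<Longrightarrow> cmod (\<psi> x) \<le> C'"
    using assms by (metis bounded_borel_bound)
  then show ?thesis
    using assms by (intro bounded_borelI[where C = "C * C'"])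
      (auto simp: norm_mult intro!: mult_mono borel_measurable_times bounded_borel_measurable[OF assms(1)] bounded_borel_measurable[OF assms(2)])
qed

lemma bounded_borel_cmult [intro]: "\<phi> \<in> bounded_borel b \<Longrightarrow> (\<lambda>x. c * \<phi> x) \<in> bounded_borel b"
  by (rule bounded_borel_mult) auto

lemma bounded_borel_cnj [intro]: "\<phi> \<in> bounded_borel b \<Longrightarrow> (\<lambda>x. cnj (\<phi> x)) \<in> bounded_borel b"
  unfolding bounded_borel_def by (auto intro!: borel_measurable_continuous_on[of cnj] continuous_intros)

lemma bounded_borel_sum [intro]:
  "(\<And>i. i \<in> I \<Longrightarrow> \<phi> i \<in> bounded_borel b) \<Longrightarrow> (\<lambda>x. \<Sum>i\<in>I. \<phi> i x) \<in> bounded_borel b"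
  by (induction I rule: infinite_finite_induct) auto

lemma bounded_borel_indicator [intro]:
  "B \<in> sets borel \<Longrightarrow> (indicator B :: real \<Rightarrow> complex) \<in> bounded_borel b"
  by (rule bounded_borelI[where C = 1]) (auto simp: indicator_def)

lemma bounded_borel_continuous:
  assumes "continuous_on UNIV \<phi>"
  shows "\<phi> \<in> bounded_borel b"
proof -
  have "compact (\<phi> ` {0..b})"
    using assms by (intro compact_continuous_image) (auto intro: continuous_on_subset)
  then obtain C where "\<And>x. x \<in> {0..b} \<Longrightarrow> cmod (\<phi> x) \<le> C"
    using compact_imp_bounded bounded_iff by (metis imageI)
  then show ?thesis
    using assms by (intro bounded_borelI) (auto intro: borel_measurable_continuous_onI)
qed

lemma bounded_borel_power [intro, simp]: "(\<lambda>x. complex_of_real x ^ n) \<in> bounded_borel b"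
  by (rule bounded_borel_continuous) (intro continuous_intros)

lemma sigma_functional_add:
  "sigma_functional b \<Lambda> \<Longrightarrow> \<phi> \<in> bounded_borel b \<Longrightarrow> \<psi> \<in> bounded_borel b \<Longrightarrow>
   \<Lambda> (\<lambda>x. \<phi> x + \<psi> x) = \<Lambda> \<phi> + \<Lambda> \<psi>"
  unfolding sigma_functional_def by blast

lemma sigma_functional_cmult:
  "sigma_functional b \<Lambda> \<Longrightarrow> \<phi> \<in> bounded_borel b \<Longrightarrow> \<Lambda> (\<lambda>x. c * \<phi> x) = c * \<Lambda> \<phi>"
  unfolding sigma_functional_def by blast

lemma sigma_functional_zero: "sigma_functional b \<Lambda> \<Longrightarrow> \<Lambda> (\<lambda>x. 0) = 0"
  using sigma_functional_cmult[of b \<Lambda> "\<lambda>_. 0" 0] by simp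

lemma sigma_functional_sum:
  assumes \<Lambda>: "sigma_functional b \<Lambda>" and "\<And>i. i \<in> I \<Longrightarrow> \<phi> i \<in> bounded_borel b"
  shows "\<Lambda> (\<lambda>x. \<Sum>i\<in>I. \<phi> i x) = (\<Sum>i\<in>I. \<Lambda> (\<phi> i))"
  using assms(2)
proof (induction I rule: infinite_finite_induct)
  case (insert i I)
  then show ?case
    by (simp add: sigma_functional_add[OF \<Lambda>] bounded_borel_sum)
qed (simp_all add: sigma_functional_zero[OF \<Lambda>])

lemma sigma_functional_lim:
  assumes "sigma_functional b \<Lambda>" "\<And>n. f n \<in> borel_measurable borel"
    "\<And>n x. 0 \<le> x \<Longrightarrow> x \<le> b \<Longrightarrow> cmod (f n x) \<le> C" "\<phi> \<in> borel_measurable borel"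
    "\<And>x. 0 \<le> x \<Longrightarrow> x \<le> b \<Longrightarrow> (\<lambda>n. f n x) \<longlonglongrightarrow> \<phi> x"
  shows "(\<lambda>n. \<Lambda> (f n)) \<longlonglongrightarrow> \<Lambda> \<phi>"
proof -
  have "(\<forall>n. f n \<in> borel_measurable borel) \<longrightarrow> (\<forall>n. \<forall>x\<in>{0..b}. cmod (f n x) \<le> C) \<longrightarrow>
      \<phi> \<in> borel_measurable borel \<longrightarrow> (\<forall>x\<in>{0..b}. (\<lambda>n. f n x) \<longlonglongrightarrow> \<phi> x) \<longrightarrow>
      (\<lambda>n. \<Lambda> (f n)) \<longlonglongrightarrow> \<Lambda> \<phi>"
    using assms(1) unfolding sigma_functional_def by (elim conjE) (erule allE)+
  then show ?thesis using assms(2-) by simp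
qed

text \<open>Bounded pointwise limits lead from powers to all of \<open>bounded_borel\<close>:
  polynomials, continuous functions by Weierstrass, indicators of \<open>{..a}\<close>, indicators
  of Borel sets by Dynkin's argument, simple functions, and finally arbitrary functions.\<close>

lemma sigma_functional_vanish:
  assumes \<Lambda>: "sigma_functional b \<Lambda>" and pow: "\<And>n. \<Lambda> (\<lambda>x. complex_of_real x ^ n) = 0"
    and \<phi>: "\<phi> \<in> bounded_borel b"
  shows "\<Lambda> \<phi> = 0"
proof -
  have cont: "\<Lambda> (\<lambda>x. complex_of_real (u x)) = 0"
    if u: "continuous_on UNIV u" for u :: "real \<Rightarrow> real"
  proof -
    have "\<exists>g. real_polynomial_function g \<and> (\<forall>x\<in>{0..b}. \<bar>u x - g x\<bar> < 1 / real (Suc n))" for n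
      by (rule Stone_Weierstrass_real_polynomial_function[of "{0..b}" u "1 / real (Suc n)"])
        (use continuous_on_subset[OF u] in auto)
    then obtain g where g: "\<And>n. real_polynomial_function (g n)"
        "\<And>n x. x \<in> {0..b} \<Longrightarrow> \<bar>u x - g n x\<bar> < 1 / real (Suc n)"
      by metis
    have "\<Lambda> (\<lambda>x. complex_of_real (g n x)) = 0" for n
    proof -
      obtain a k where gn: "g n = (\<lambda>x. \<Sum>i\<le>k. a i * x ^ i)"
        using g(1)[of n] unfolding real_polynomial_function_iff_sum by blast
      have "\<Lambda> (\<lambda>x. complex_of_real (g n x)) = \<Lambda> (\<lambda>x. \<Sum>i\<le>k. complex_of_real (a i) * complex_of_real x ^ i)"
        by (simp add: gn)
      also have "\<dots> = (\<Sum>i\<le>k. complex_of_real (a i) * \<Lambda> (\<lambda>x. complex_of_real x ^ i))"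
        by (subst sigma_functional_sum[OF \<Lambda>]) (auto simp: sigma_functional_cmult[OF \<Lambda>])
      finally show ?thesis by (simp add: pow)
    qed
    moreover have "(\<lambda>n. \<Lambda> (\<lambda>x. complex_of_real (g n x))) \<longlonglongrightarrow> \<Lambda> (\<lambda>x. complex_of_real (u x))"
    proof -
      have "bounded (u ` {0..b})"
        using continuous_on_subset[OF u] by (intro compact_imp_bounded compact_continuous_image) auto
      then obtain C where "\<forall>y\<in>u ` {0..b}. norm y \<le> C"
        unfolding bounded_iff by blast
      then have C: "\<bar>u x\<bar> \<le> C" if "x \<in> {0..b}" for x
        using that by simp
      show ?thesis
      proof (rule sigma_functional_lim[OF \<Lambda>, where C = "C + 1"])
        show "(\<lambda>x. complex_of_real (g n x)) \<in> borel_measurable borel" for n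
          using g(1)[of n] unfolding real_polynomial_function_iff_sum by auto
        show "(\<lambda>x. complex_of_real (u x)) \<in> borel_measurable borel"
          using borel_measurable_continuous_onI[OF u] by measurable
        fix x assume x: "0 \<le> x" "x \<le> b"
        show "cmod (complex_of_real (g n x)) \<le> C + 1" for n
        proof -
          have "\<bar>u x - g n x\<bar> < 1 / real (Suc n)" "1 / real (Suc n) \<le> 1" "\<bar>u x\<bar> \<le> C"
            using x g(2) C by auto
          then show ?thesis unfolding norm_of_real by linarith
        qed
        have "(\<lambda>n. g n x - u x) \<longlonglongrightarrow> 0"
        proof (rule Lim_null_comparison)
          show "\<forall>\<^sub>F n in sequentially. norm (g n x - u x) \<le> 1 / real (Suc n)"
            using g(2) x by (intro always_eventually) (auto simp: abs_minus_commute intro: less_imp_le)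
        qed real_asymp
        then show "(\<lambda>n. complex_of_real (g n x)) \<longlonglongrightarrow> complex_of_real (u x)"
          by (intro tendsto_of_real) (simp add: LIM_zero_iff)
      qed
    qed
    ultimately show ?thesis by (simp add: LIMSEQ_const_iff)
  qed
  have ray: "\<Lambda> (indicator {..a}) = 0" for a :: real
  proof -
    \<comment> \<open>A ramp from 1 at a down to 0 at a + 1/n.\<close>
    define u where "u n x = max 0 (min 1 (1 - real n * (x - a)))" for n x
    have u: "continuous_on UNIV (u n)" for n unfolding u_def by (intro continuous_intros)
    have "(\<lambda>n. \<Lambda> (\<lambda>x. complex_of_real (u n x))) \<longlonglongrightarrow> \<Lambda> (indicator {..a})"
    proof (rule sigma_functional_lim[OF \<Lambda>, where C = 1])
      show "(\<lambda>x. complex_of_real (u n x)) \<in> borel_measurable borel" for n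
        using borel_measurable_continuous_onI[OF u] by measurable
      show "cmod (complex_of_real (u n x)) \<le> 1" for n x unfolding u_def norm_of_real by auto
      fix x :: real
      show "(\<lambda>n. complex_of_real (u n x)) \<longlonglongrightarrow> indicator {..a} x"
      proof (cases "x \<le> a")
        case True
        then have "1 \<le> 1 - real n * (x - a)" for n
          by (simp add: mult_nonneg_nonpos)
        then have "u n x = 1" for n
          unfolding u_def by (simp add: min_absorb1)
        then show ?thesis using True by simp
      next
        case False
        obtain N where N: "real N > 1 / (x - a)" using reals_Archimedean2 by blast
        have "u n x = 0" if "n \<ge> N" for n
        proof -
          have "real n > 1 / (x - a)" using N that by linarith
          then have "real n * (x - a) > 1" using False by (simp add: divide_less_eq)
          then show ?thesis unfolding u_def by auto
        qed
        then have "eventually (\<lambda>n. complex_of_real (u n x) = indicator {..a} x) sequentially"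
          using False by (auto simp: eventually_sequentially)
        then show ?thesis by (rule tendsto_eventually)
      qed
    qed simp
    then show ?thesis using cont[OF u] by (simp add: LIMSEQ_const_iff)
  qed
  have ind: "\<Lambda> (indicator B) = 0" if "B \<in> sets borel" for B
  proof -
    have eq: "sets (borel :: real measure) = sigma_sets UNIV (range atMost)"
      by (subst borel_eq_atMost) (simp add: sets_measure_of)
    have stable: "Int_stable (range (atMost :: real \<Rightarrow> real set))"
      by (auto simp: Int_stable_def)
    have "B \<in> sigma_sets UNIV (range atMost)" using that eq by simp
    with stable subset_UNIV[of "range atMost", folded Pow_UNIV] show ?thesis
    proof (induction rule: sigma_sets_induct_disjoint)
      case (basic A)
      then show ?case using ray by auto
    next
      case empty
      then show ?case using sigma_functional_zero[OF \<Lambda>] by (simp add: indicator_def of_bool_def)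
    next
      case (compl A)
      then have A: "A \<in> sets borel" by (simp add: eq)
      have "indicator (UNIV - A) = (\<lambda>x. 1 + (-1) * indicator A x :: complex)"
        by (auto simp: indicator_def fun_eq_iff)
      then have "\<Lambda> (indicator (UNIV - A)) = \<Lambda> (\<lambda>x. 1) + (-1) * \<Lambda> (indicator A)"
        using A bounded_borel_indicator[OF A] sigma_functional_cmult[OF \<Lambda> bounded_borel_indicator[OF A], of "-1"]
          sigma_functional_add[OF \<Lambda> bounded_borel_const[of 1] bounded_borel_cmult[OF bounded_borel_indicator[OF A], of "-1"]]
        by simp
      then show ?case using pow[of 0] compl by simp
    next
      case (union A)
      then have A: "\<And>i. A i \<in> sets borel" by (auto simp: eq)
      have "(\<lambda>n. \<Lambda> (\<lambda>x. \<Sum>i<n. indicator (A i) x)) \<longlonglongrightarrow> \<Lambda> (indicator (\<Union>i. A i))"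
      proof (rule sigma_functional_lim[OF \<Lambda>, where C = 1])
        show "(\<lambda>x. \<Sum>i<n. indicator (A i) x :: complex) \<in> borel_measurable borel" for n
          using A by measurable
        show "(indicator (\<Union>i. A i) :: real \<Rightarrow> complex) \<in> borel_measurable borel"
          using A by measurable
        show "cmod (\<Sum>i<n. indicator (A i) x) \<le> 1" for n x
        proof -
          have "(\<Sum>i<n. indicator (A i) x :: complex) = indicator (\<Union>i<n. A i) x"
            using union(1) by (subst indicator_UN_disjoint) (auto simp: disjoint_family_on_def)
          then show ?thesis by (simp add: indicator_def)
        qed
        fix x
        have "(\<lambda>i. indicator (A i) x :: complex) sums indicator (\<Union>i. A i) x"
        proof (cases "x \<in> (\<Union>i. A i)")
          case True
          then obtain j where j: "x \<in> A j" by blast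
          then have "indicator (A i) x = (if i = j then 1 else 0 :: complex)" for i
            using union(1) by (auto simp: disjoint_family_on_def indicator_def)
          then show ?thesis using True sums_single[of j "\<lambda>_. 1 :: complex"] by simp
        next
          case False
          then show ?thesis by simp
        qed
        then show "(\<lambda>n. \<Sum>i<n. indicator (A i) x :: complex) \<longlonglongrightarrow> indicator (\<Union>i. A i) x"
          by (simp add: sums_def)
      qed
      moreover have "\<Lambda> (\<lambda>x. \<Sum>i<n. indicator (A i) x) = 0" for n
        using union A by (subst sigma_functional_sum[OF \<Lambda>]) auto
      ultimately show ?case by (simp add: LIMSEQ_const_iff)
    qed
  qed
  \<comment> \<open>The simple functions are dominated by twice the modulus of
    \<open>\<phi>\<close>, hence uniformly bounded on [0, b].\<close>
  obtain s where s: "\<And>i. simple_function borel (s i)" "\<And>x. (\<lambda>i. s i x) \<longlonglongrightarrow> \<phi> x"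
      "\<And>i x. dist (s i x) 0 \<le> 2 * dist (\<phi> x) 0"
    using borel_measurable_implies_sequence_metric[OF bounded_borel_measurable[OF \<phi>], of 0] by (auto simp: space_borel)
  obtain C where C: "\<And>x. 0 \<le> x \<Longrightarrow> x \<le> b \<Longrightarrow> cmod (\<phi> x) \<le> C"
    using bounded_borel_bound[OF \<phi>] by metis
  have "(\<lambda>n. \<Lambda> (s n)) \<longlonglongrightarrow> \<Lambda> \<phi>"
  proof (rule sigma_functional_lim[OF \<Lambda>, where C = "2 * C"])
    fix n x assume "0 \<le> x" "x \<le> b"
    then show "cmod (s n x) \<le> 2 * C" using s(3)[of n x] C[of x] by simp
  qed (use s \<phi> in \<open>auto intro: borel_measurable_simple_function bounded_borel_measurable\<close>)
  moreover have "\<Lambda> (s n) = 0" for n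
  proof -
    have fin: "finite (range (s n))"
      using s(1)[of n] by (auto simp: simple_function_def)
    have meas: "s n -` {y} \<in> sets borel" for y
      using measurable_sets[OF borel_measurable_simple_function[OF s(1)[of n]], of "{y}"] by simp
    have "s n = (\<lambda>x. \<Sum>y\<in>range (s n). y * indicator (s n -` {y}) x)"
      using fin by (auto simp: fun_eq_iff indicator_def if_distrib sum.delta of_bool_def cong: if_cong)
    then have "\<Lambda> (s n) = \<Lambda> (\<lambda>x. \<Sum>y\<in>range (s n). y * indicator (s n -` {y}) x)" by simp
    also have "\<dots> = (\<Sum>y\<in>range (s n). y * \<Lambda> (indicator (s n -` {y})))"
      using bounded_borel_indicator[OF meas]
      by (subst sigma_functional_sum[OF \<Lambda>])
        (auto intro!: sum.cong simp: sigma_functional_cmult[OF \<Lambda> bounded_borel_indicator[OF meas]])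
    also have "\<dots> = 0" using ind[OF meas] by simp
    finally show ?thesis .
  qed
  ultimately show ?thesis by (simp add: LIMSEQ_const_iff)
qed

lemma sigma_functionalI:
  assumes "\<And>\<phi> \<psi>. \<phi> \<in> bounded_borel b \<Longrightarrow> \<psi> \<in> bounded_borel b \<Longrightarrow> \<Lambda> (\<lambda>x. \<phi> x + \<psi> x) = \<Lambda> \<phi> + \<Lambda> \<psi>"
    and "\<And>\<phi> c. \<phi> \<in> bounded_borel b \<Longrightarrow> \<Lambda> (\<lambda>x. c * \<phi> x) = c * \<Lambda> \<phi>"
    and "\<And>f \<phi> C. (\<And>n::nat. f n \<in> borel_measurable borel) \<Longrightarrow>
        (\<And>n x. 0 \<le> x \<Longrightarrow> x \<le> b \<Longrightarrow> cmod (f n x) \<le> C) \<Longrightarrow>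
        \<phi> \<in> borel_measurable borel \<Longrightarrow> (\<And>x. 0 \<le> x \<Longrightarrow> x \<le> b \<Longrightarrow> (\<lambda>n. f n x) \<longlonglongrightarrow> \<phi> x) \<Longrightarrow>
        (\<lambda>n. \<Lambda> (f n)) \<longlonglongrightarrow> \<Lambda> \<phi>"
  shows "sigma_functional b \<Lambda>"
  unfolding sigma_functional_def
proof (intro conjI ballI allI impI)
  fix f :: "nat \<Rightarrow> real \<Rightarrow> complex" and \<phi> C
  assume "\<forall>n. f n \<in> borel_measurable borel" "\<forall>n. \<forall>x\<in>{0..b}. cmod (f n x) \<le> C"
    "\<phi> \<in> borel_measurable borel" "\<forall>x\<in>{0..b}. (\<lambda>n. f n x) \<longlonglongrightarrow> \<phi> x"
  then show "(\<lambda>n. \<Lambda> (f n)) \<longlonglongrightarrow> \<Lambda> \<phi>"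
    by (intro assms(3)[where C = C]) auto
qed (use assms(1,2) in auto)

lemma sigma_functional_plus:
  assumes "sigma_functional b \<Lambda>" "sigma_functional b \<Lambda>'"
  shows "sigma_functional b (\<lambda>\<phi>. \<Lambda> \<phi> + \<Lambda>' \<phi>)"
  by (rule sigma_functionalI)
    (auto simp: sigma_functional_add[OF assms(1)] sigma_functional_cmult[OF assms(1)] algebra_simps
      sigma_functional_add[OF assms(2)] sigma_functional_cmult[OF assms(2)]
      intro!: tendsto_add sigma_functional_lim[OF assms(1)] sigma_functional_lim[OF assms(2)])

lemma sigma_functional_times:
  assumes "sigma_functional b \<Lambda>"
  shows "sigma_functional b (\<lambda>\<phi>. c * \<Lambda> \<phi>)"
  by (rule sigma_functionalI)
    (auto simp: sigma_functional_add[OF assms(1)] sigma_functional_cmult[OF assms(1)] algebra_simps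
      intro!: tendsto_mult tendsto_const sigma_functional_lim[OF assms(1)])

lemma sigma_functional_const0: "sigma_functional b (\<lambda>\<phi>. 0)"
  unfolding sigma_functional_def by simp

lemma sigma_functional_finite_sum:
  "(\<And>i. i \<in> I \<Longrightarrow> sigma_functional b (\<Lambda> i)) \<Longrightarrow> sigma_functional b (\<lambda>\<phi>. \<Sum>i\<in>I. \<Lambda> i \<phi>)"
  by (induction I rule: infinite_finite_induct) (auto intro: sigma_functional_const0 sigma_functional_plus)

lemma sigma_functional_eq:
  assumes \<Lambda>: "sigma_functional b \<Lambda>" and \<Lambda>': "sigma_functional b \<Lambda>'"
    and pow: "\<And>n. \<Lambda> (\<lambda>x. complex_of_real x ^ n) = \<Lambda>' (\<lambda>x. complex_of_real x ^ n)"
    and \<phi>: "\<phi> \<in> bounded_borel b"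
  shows "\<Lambda> \<phi> = \<Lambda>' \<phi>"
proof -
  have "\<Lambda> \<phi> + (-1) * \<Lambda>' \<phi> = 0"
    by (rule sigma_functional_vanish[OF sigma_functional_plus[OF \<Lambda> sigma_functional_times[OF \<Lambda>']]])
      (use pow \<phi> in auto)
  then show ?thesis by simp
qed

text \<open>The counterpart of passing to the measure with density \<open>\<psi>\<close>; it makes
  products accessible to the comparison on powers.\<close>

lemma sigma_functional_mult:
  assumes \<Lambda>: "sigma_functional b \<Lambda>" and \<psi>: "\<psi> \<in> bounded_borel b"
  shows "sigma_functional b (\<lambda>\<phi>. \<Lambda> (\<lambda>x. \<phi> x * \<psi> x))"
  unfolding sigma_functional_def
proof (intro conjI ballI allI impI)
  fix \<phi> \<phi>' assume "\<phi> \<in> bounded_borel b" "\<phi>' \<in> bounded_borel b"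
  then show "\<Lambda> (\<lambda>x. (\<phi> x + \<phi>' x) * \<psi> x) = \<Lambda> (\<lambda>x. \<phi> x * \<psi> x) + \<Lambda> (\<lambda>x. \<phi>' x * \<psi> x)"
    using \<psi> by (subst sigma_functional_add[OF \<Lambda>, symmetric]) (auto simp: distrib_right)
next
  fix \<phi> c assume "\<phi> \<in> bounded_borel b"
  then show "\<Lambda> (\<lambda>x. c * \<phi> x * \<psi> x) = c * \<Lambda> (\<lambda>x. \<phi> x * \<psi> x)"
    using \<psi> by (subst sigma_functional_cmult[OF \<Lambda>, symmetric]) (auto simp: mult.assoc)
next
  fix f :: "nat \<Rightarrow> real \<Rightarrow> complex" and \<phi> C
  assume f: "\<forall>n. f n \<in> borel_measurable borel" and C: "\<forall>n. \<forall>x\<in>{0..b}. cmod (f n x) \<le> C"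
    and \<phi>: "\<phi> \<in> borel_measurable borel" and lim: "\<forall>x\<in>{0..b}. (\<lambda>n. f n x) \<longlonglongrightarrow> \<phi> x"
  obtain C' where C': "C' > 0" "\<And>x. 0 \<le> x \<Longrightarrow> x \<le> b \<Longrightarrow> cmod (\<psi> x) \<le> C'"
    using bounded_borel_bound[OF \<psi>] by metis
  show "(\<lambda>n. \<Lambda> (\<lambda>x. f n x * \<psi> x)) \<longlonglongrightarrow> \<Lambda> (\<lambda>x. \<phi> x * \<psi> x)"
  proof (rule sigma_functional_lim[OF \<Lambda>, where C = "C * C'"])
    fix n x assume x: "0 \<le> x" "x \<le> b"
    have "cmod (f n x) \<le> C" "cmod (\<psi> x) \<le> C'" using x C C' by auto
    then show "cmod (f n x * \<psi> x) \<le> C * C'"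
      unfolding norm_mult by (intro mult_mono) (use norm_ge_zero[of "f n x"] in \<open>linarith | simp\<close>)+
  qed (use f \<phi> lim in \<open>auto intro!: tendsto_intros borel_measurable_times bounded_borel_measurable[OF \<psi>]\<close>)
qed

lemma sigma_functional_cnj:
  assumes \<Lambda>: "sigma_functional b \<Lambda>"
  shows "sigma_functional b (\<lambda>\<phi>. cnj (\<Lambda> (\<lambda>x. cnj (\<phi> x))))"
  unfolding sigma_functional_def
proof (intro conjI ballI allI impI)
  fix \<phi> \<phi>' assume "\<phi> \<in> bounded_borel b" "\<phi>' \<in> bounded_borel b"
  then show "cnj (\<Lambda> (\<lambda>x. cnj (\<phi> x + \<phi>' x))) = cnj (\<Lambda> (\<lambda>x. cnj (\<phi> x))) + cnj (\<Lambda> (\<lambda>x. cnj (\<phi>' x)))"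
    by (simp add: sigma_functional_add[OF \<Lambda>] bounded_borel_cnj)
next
  fix \<phi> c assume "\<phi> \<in> bounded_borel b"
  then show "cnj (\<Lambda> (\<lambda>x. cnj (c * \<phi> x))) = c * cnj (\<Lambda> (\<lambda>x. cnj (\<phi> x)))"
    by (simp add: sigma_functional_cmult[OF \<Lambda>] bounded_borel_cnj)
next
  fix f :: "nat \<Rightarrow> real \<Rightarrow> complex" and \<phi> C
  assume f: "\<forall>n. f n \<in> borel_measurable borel" and C: "\<forall>n. \<forall>x\<in>{0..b}. cmod (f n x) \<le> C"
    and \<phi>: "\<phi> \<in> borel_measurable borel" and lim: "\<forall>x\<in>{0..b}. (\<lambda>n. f n x) \<longlonglongrightarrow> \<phi> x"
  show "(\<lambda>n. cnj (\<Lambda> (\<lambda>x. cnj (f n x)))) \<longlonglongrightarrow> cnj (\<Lambda> (\<lambda>x. cnj (\<phi> x)))"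
    by (intro tendsto_cnj sigma_functional_lim[OF \<Lambda>, where C = C])
      (use f C \<phi> lim in \<open>auto intro!: tendsto_intros borel_measurable_continuous_on[of cnj] continuous_intros\<close>)
qed

lemma integrable_bounded_borel:
  assumes "finite_measure M" and sets: "sets M = sets borel" and AE: "AE x in M. x \<in> {0..b}"
    and \<phi>: "\<phi> \<in> bounded_borel b"
  shows "integrable M \<phi>"
proof -
  interpret finite_measure M by fact
  obtain C where "\<And>x. 0 \<le> x \<Longrightarrow> x \<le> b \<Longrightarrow> cmod (\<phi> x) \<le> C"
    using bounded_borel_bound[OF \<phi>] by metis
  then have "AE x in M. cmod (\<phi> x) \<le> C" using eventually_mono[OF AE] by simp
  then show ?thesis
    using bounded_borel_measurable[OF \<phi>] by (intro integrable_const_bound) (auto simp: measurable_cong_sets[OF sets])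
qed

lemma sigma_functional_integral:
  assumes M: "finite_measure M" and sets: "sets M = sets borel" and AE: "AE x in M. x \<in> {0..b}"
  shows "sigma_functional b (\<lambda>\<phi>. \<integral>x. \<phi> x \<partial>M)"
  unfolding sigma_functional_def
proof (intro conjI ballI allI impI)
  fix \<phi> \<phi>' assume "\<phi> \<in> bounded_borel b" "\<phi>' \<in> bounded_borel b"
  then show "(\<integral>x. \<phi> x + \<phi>' x \<partial>M) = (\<integral>x. \<phi> x \<partial>M) + (\<integral>x. \<phi>' x \<partial>M)"
    using integrable_bounded_borel[OF assms] by simp
next
  fix f :: "nat \<Rightarrow> real \<Rightarrow> complex" and \<phi> C
  assume f: "\<forall>n. f n \<in> borel_measurable borel" and C: "\<forall>n. \<forall>x\<in>{0..b}. cmod (f n x) \<le> C"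
    and \<phi>: "\<phi> \<in> borel_measurable borel" and lim: "\<forall>x\<in>{0..b}. (\<lambda>n. f n x) \<longlonglongrightarrow> \<phi> x"
  interpret finite_measure M by fact
  show "(\<lambda>n. \<integral>x. f n x \<partial>M) \<longlonglongrightarrow> (\<integral>x. \<phi> x \<partial>M)"
  proof (rule integral_dominated_convergence[where w = "\<lambda>_. C"])
    show "AE x in M. (\<lambda>n. f n x) \<longlonglongrightarrow> \<phi> x" using AE by eventually_elim (use lim in auto)
    show "AE x in M. cmod (f n x) \<le> C" for n using AE by eventually_elim (use C in auto)
  qed (use f \<phi> in \<open>auto simp: measurable_cong_sets[OF sets]\<close>)
qed simp

section \<open>The Hilbert space of a weighted countable set\<close>

locale weighted_space =
  fixes m :: "'a \<Rightarrow> real"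
  assumes pos: "\<And>x. m x > 0" and countable_space: "countable (UNIV :: 'a set)"
begin

abbreviation M :: "'a measure" where "M \<equiv> flow_measure m"

lemma space_M [simp]: "space M = UNIV"
  and sets_M [simp]: "sets M = UNIV"
  by (auto simp: flow_measure_def space_point_measure sets_point_measure)

lemma measurable_M [simp]: "f \<in> measurable M N \<longleftrightarrow> f \<in> UNIV \<rightarrow> space N"
  unfolding flow_measure_def by simp

lemma emeasure_singleton: "emeasure M {x} = ennreal (m x)"
  unfolding flow_measure_def by (subst emeasure_point_measure_finite2) auto

lemma emeasure_finite_set: "finite A \<Longrightarrow> emeasure M A = ennreal (\<Sum>x\<in>A. m x)"
  unfolding flow_measure_def using pos by (subst emeasure_point_measure_finite2) (auto simp: less_imp_le sum_ennreal)

text \<open>Every point has positive mass, so only the empty set is null.\<close>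

lemma AE_M [simp]: "(AE x in M. P x) \<longleftrightarrow> (\<forall>x. P x)"
  unfolding flow_measure_def point_measure_def using pos by (subst AE_density) (auto simp: AE_count_space)

lemma has_integral_finite_support:
  fixes f :: "'a \<Rightarrow> 'b :: {banach, second_countable_topology}"
  assumes "finite A" "\<And>x. x \<notin> A \<Longrightarrow> f x = 0"
  shows "has_bochner_integral M f (\<Sum>x\<in>A. m x *\<^sub>R f x)"
proof -
  have "has_bochner_integral M (\<lambda>x. \<Sum>a\<in>A. indicator {a} x *\<^sub>R f a) (\<Sum>a\<in>A. measure M {a} *\<^sub>R f a)"
    by (intro has_bochner_integral_sum has_bochner_integral_scaleR_left has_bochner_integral_real_indicator)
      (auto simp: emeasure_singleton)
  moreover have "(\<lambda>x. \<Sum>a\<in>A. indicator {a} x *\<^sub>R f a) = f"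
  proof
    fix x
    have "(\<Sum>a\<in>A. indicator {a} x *\<^sub>R f a) = (\<Sum>a\<in>A. if a = x then f a else 0)"
      by (intro sum.cong) auto
    then show "(\<Sum>a\<in>A. indicator {a} x *\<^sub>R f a) = f x" using assms by simp
  qed
  moreover have "measure M {a} = m a" for a
    using pos[of a] by (simp add: measure_def emeasure_singleton)
  ultimately show ?thesis by simp
qed

lemma L2_iff: "f \<in> L2 m \<longleftrightarrow> integrable M (\<lambda>x. (cmod (f x))\<^sup>2)"
  by (simp add: L2_def)

lemma L2_bound:
  assumes "f \<in> L2 m" "g \<in> L2 m" "\<And>x. (cmod (h x))\<^sup>2 \<le> c * ((cmod (f x))\<^sup>2 + (cmod (g x))\<^sup>2)"
  shows "h \<in> L2 m"
  unfolding L2_iff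
  by (rule Bochner_Integration.integrable_bound[of _ "\<lambda>x. c * ((cmod (f x))\<^sup>2 + (cmod (g x))\<^sup>2)"])
    (use assms in \<open>auto simp: L2_iff intro: order_trans[OF _ abs_ge_self]\<close>)

lemma cmod_add_sq: "(cmod (a + b))\<^sup>2 \<le> 2 * ((cmod a)\<^sup>2 + (cmod b)\<^sup>2)"
proof -
  have "(cmod (a + b))\<^sup>2 \<le> (cmod a + cmod b)\<^sup>2"
    by (intro power_mono norm_triangle_ineq) simp
  also have "\<dots> \<le> 2 * ((cmod a)\<^sup>2 + (cmod b)\<^sup>2)"
    using sum_squares_bound[of "cmod a" "cmod b"] by (simp add: power2_sum)
  finally show ?thesis .
qed

lemma L2_add [intro]: "f \<in> L2 m \<Longrightarrow> g \<in> L2 m \<Longrightarrow> (\<lambda>x. f x + g x) \<in> L2 m"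
  by (erule (1) L2_bound) (rule cmod_add_sq)

lemma L2_cmult [intro]: "f \<in> L2 m \<Longrightarrow> (\<lambda>x. c * f x) \<in> L2 m"
  by (simp add: L2_iff norm_mult power_mult_distrib)

lemma L2_diff [intro]:
  assumes "f \<in> L2 m" "g \<in> L2 m"
  shows "(\<lambda>x. f x - g x) \<in> L2 m"
  using L2_add[OF assms(1) L2_cmult[OF assms(2), of "-1"]] by simp

lemma L2_finite_support:
  assumes "finite A" "\<And>x. x \<notin> A \<Longrightarrow> f x = 0"
  shows "f \<in> L2 m"
  unfolding L2_iff using has_integral_finite_support[OF assms(1), of "\<lambda>x. (cmod (f x))\<^sup>2"] assms(2)
  by (auto simp: has_bochner_integral_iff)

lemma L2_indicator [intro]: "indicator {x} \<in> L2 m"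
  by (rule L2_finite_support[of "{x}"]) (auto simp: indicator_def)

lemma integrable_inner:
  assumes "f \<in> L2 m" "g \<in> L2 m"
  shows "integrable M (\<lambda>x. f x * cnj (g x))"
proof (rule Bochner_Integration.integrable_bound[of _ "\<lambda>x. (cmod (f x))\<^sup>2 + (cmod (g x))\<^sup>2"])
  show "AE x in M. norm (f x * cnj (g x)) \<le> norm ((cmod (f x))\<^sup>2 + (cmod (g x))\<^sup>2)"
  proof (simp add: norm_mult, intro allI)
    fix x
    have "2 * (cmod (f x) * cmod (g x)) \<le> (cmod (f x))\<^sup>2 + (cmod (g x))\<^sup>2"
      using sum_squares_bound[of "cmod (f x)" "cmod (g x)"] by (simp add: mult.assoc)
    moreover have "0 \<le> cmod (f x) * cmod (g x)" by simp
    ultimately show "cmod (f x) * cmod (g x) \<le> (cmod (f x))\<^sup>2 + (cmod (g x))\<^sup>2"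
      by linarith
  qed
qed (use assms in \<open>auto simp: L2_iff\<close>)

lemma inner_add_left:
  "f \<in> L2 m \<Longrightarrow> g \<in> L2 m \<Longrightarrow> h \<in> L2 m \<Longrightarrow>
   L2_inner m (\<lambda>x. f x + g x) h = L2_inner m f h + L2_inner m g h"
  unfolding L2_inner_def by (simp add: distrib_right integrable_inner)

lemma inner_diff_left:
  "f \<in> L2 m \<Longrightarrow> g \<in> L2 m \<Longrightarrow> h \<in> L2 m \<Longrightarrow>
   L2_inner m (\<lambda>x. f x - g x) h = L2_inner m f h - L2_inner m g h"
  unfolding L2_inner_def by (simp add: left_diff_distrib integrable_inner)

lemma inner_cmult_left: "L2_inner m (\<lambda>x. c * f x) h = c * L2_inner m f h"
  unfolding L2_inner_def by (simp add: mult.assoc)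

lemma inner_add_right:
  "f \<in> L2 m \<Longrightarrow> g \<in> L2 m \<Longrightarrow> h \<in> L2 m \<Longrightarrow>
   L2_inner m h (\<lambda>x. f x + g x) = L2_inner m h f + L2_inner m h g"
  unfolding L2_inner_def by (simp add: distrib_left integrable_inner)

lemma inner_diff_right:
  "f \<in> L2 m \<Longrightarrow> g \<in> L2 m \<Longrightarrow> h \<in> L2 m \<Longrightarrow>
   L2_inner m h (\<lambda>x. f x - g x) = L2_inner m h f - L2_inner m h g"
  unfolding L2_inner_def by (simp add: right_diff_distrib integrable_inner)

lemma inner_cmult_right: "L2_inner m h (\<lambda>x. c * f x) = cnj c * L2_inner m h f"
proof -
  have "(\<lambda>x. h x * cnj (c * f x)) = (\<lambda>x. cnj c * (h x * cnj (f x)))"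
    by (auto simp: fun_eq_iff)
  then show ?thesis unfolding L2_inner_def by simp
qed

lemma inner_cnj: "L2_inner m g f = cnj (L2_inner m f g)"
  unfolding L2_inner_def by (subst Bochner_Integration.integral_cnj[symmetric]) (simp add: mult.commute)

lemma inner_self: "L2_inner m f f = complex_of_real (\<integral>x. (cmod (f x))\<^sup>2 \<partial>M)"
proof -
  have "(\<lambda>x. f x * cnj (f x)) = (\<lambda>x. complex_of_real ((cmod (f x))\<^sup>2))"
    by (auto simp: fun_eq_iff complex_norm_square simp del: of_real_power)
  then show ?thesis unfolding L2_inner_def by (simp del: of_real_power)
qed

lemma inner_self_nonneg: "0 \<le> Re (L2_inner m f f)"
  unfolding inner_self by simp

lemma inner_indicator: "L2_inner m f (indicator {x}) = f x * complex_of_real (m x)"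
  unfolding L2_inner_def
  using has_integral_finite_support[of "{x}" "\<lambda>y. f y * cnj (indicator {x} y)"]
  by (auto simp: has_bochner_integral_iff indicator_def scaleR_conv_of_real mult.commute)

lemma inner_ext:
  assumes "\<And>h. h \<in> L2 m \<Longrightarrow> L2_inner m f h = L2_inner m g h"
  shows "f = g"
proof
  fix x
  show "f x = g x"
    using assms[of "indicator {x}"] pos[of x] by (auto simp: inner_indicator)
qed

lemma exhaustion:
  obtains A :: "nat \<Rightarrow> 'a set" where "\<And>n. finite (A n)" "incseq A" "\<And>x. \<exists>n. x \<in> A n"
proof -
  define A where "A n = from_nat_into (UNIV :: 'a set) ` {..n}" for n
  show thesis
  proof (rule that[of A])
    show "incseq A" unfolding A_def incseq_def by (auto intro!: image_mono)
    show "\<exists>n. x \<in> A n" for x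
      using from_nat_into_surj[OF countable_space, of x] unfolding A_def by auto
  qed (simp add: A_def)
qed

lemma exhaustion_eventually:
  assumes "incseq A" "\<exists>n. x \<in> A n"
  shows "eventually (\<lambda>n. x \<in> A n) sequentially"
proof -
  obtain N where "x \<in> A N" using assms(2) by blast
  then have "\<forall>n\<ge>N. x \<in> A n" using incseqD[OF assms(1)] by blast
  then show ?thesis unfolding eventually_sequentially by blast
qed

text \<open>\<open>\<Lambda>\<close> is antilinear because the representing vector stands in the
  first slot of the inner product, which is linear there. The bound is asked for on the unit ball
  only and extends by scaling. With the countable orthogonal family of point indicators at hand, g
  is written down directly, and Fatou's lemma along a finite exhaustion puts it into L2(m).\<close>

lemma riesz_representation:
  fixes \<Lambda> :: "('a \<Rightarrow> complex) \<Rightarrow> complex"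
  assumes add: "\<And>f g. f \<in> L2 m \<Longrightarrow> g \<in> L2 m \<Longrightarrow> \<Lambda> (\<lambda>x. f x + g x) = \<Lambda> f + \<Lambda> g"
    and cmult: "\<And>f c. f \<in> L2 m \<Longrightarrow> \<Lambda> (\<lambda>x. c * f x) = cnj c * \<Lambda> f"
    and bound: "\<And>f. f \<in> L2 m \<Longrightarrow> (\<integral>x. (cmod (f x))\<^sup>2 \<partial>M) \<le> 1 \<Longrightarrow> cmod (\<Lambda> f) \<le> C"
  shows "\<exists>g\<in>L2 m. \<forall>h\<in>L2 m. L2_inner m g h = \<Lambda> h"
proof -
  obtain A :: "nat \<Rightarrow> 'a set" where A: "\<And>n. finite (A n)" "incseq A" "\<And>x. \<exists>n. x \<in> A n"
    by (rule exhaustion) blast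
  have zero: "\<Lambda> (\<lambda>x. 0) = 0"
    using cmult[of "\<lambda>x. 0" 0] L2_finite_support[of "{}"] by simp
  have norm_bound: "cmod (\<Lambda> f) \<le> C * sqrt (\<integral>x. (cmod (f x))\<^sup>2 \<partial>M)" if f: "f \<in> L2 m" for f
  proof (cases "(\<integral>x. (cmod (f x))\<^sup>2 \<partial>M) = 0")
    case True
    then have "f = (\<lambda>x. 0)"
      using f by (subst (asm) integral_nonneg_eq_0_iff_AE) (auto simp: L2_iff)
    then show ?thesis using zero True by simp
  next
    case False
    define r where "r = sqrt (\<integral>x. (cmod (f x))\<^sup>2 \<partial>M)"
    have r0: "0 \<le> (\<integral>x. (cmod (f x))\<^sup>2 \<partial>M)" by simp
    have r: "r > 0" using False r0 unfolding r_def by (simp add: less_le)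
    have r2: "r\<^sup>2 = (\<integral>x. (cmod (f x))\<^sup>2 \<partial>M)" unfolding r_def using r0 by simp
    have "(\<integral>x. (cmod (complex_of_real (1 / r) * f x))\<^sup>2 \<partial>M) = (1 / r)\<^sup>2 * (\<integral>x. (cmod (f x))\<^sup>2 \<partial>M)"
      by (simp add: norm_mult power_mult_distrib norm_divide power_divide)
    also have "\<dots> = 1" using r unfolding r2[symmetric] by (simp add: power_divide)
    finally have "cmod (\<Lambda> (\<lambda>x. complex_of_real (1 / r) * f x)) \<le> C"
      by (intro bound L2_cmult f) simp
    then have "cmod (\<Lambda> f) / r \<le> C"
      using cmult[OF f, of "complex_of_real (1 / r)"] r by (simp add: norm_mult norm_divide)
    then show ?thesis using r unfolding r_def[symmetric] by (simp add: field_simps)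
  qed
  have C: "0 \<le> C"
    using bound[of "\<lambda>x. 0"] L2_finite_support[of "{}"] zero by simp
  \<comment> \<open>Forced: by \<open>inner_indicator\<close>, testing the desired identity on the
    indicator of x determines g x.\<close>
  define g where "g x = \<Lambda> (indicator {x}) / complex_of_real (m x)" for x
  have finite_rep: "\<Lambda> f = (\<Sum>x\<in>S. m x *\<^sub>R (g x * cnj (f x)))"
    if "finite S" "\<And>x. x \<notin> S \<Longrightarrow> f x = 0" for f S
    using that
  proof (induction S arbitrary: f rule: finite_induct)
    case empty
    then have "f = (\<lambda>x. 0)" by auto
    then show ?case using zero by simp
  next
    case (insert a S)
    define f' where "f' x = (if x = a then 0 else f x)" for x
    have f': "f' \<in> L2 m"
      using insert by (intro L2_finite_support[of S]) (auto simp: f'_def)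
    have "f = (\<lambda>x. f' x + f a * indicator {a} x)"
      by (auto simp: f'_def fun_eq_iff indicator_def)
    then have "\<Lambda> f = \<Lambda> (\<lambda>x. f' x + f a * indicator {a} x)" by simp
    also have "\<dots> = \<Lambda> f' + cnj (f a) * \<Lambda> (indicator {a})"
      using f' by (subst add) (auto simp: cmult L2_indicator)
    also have "\<Lambda> f' = (\<Sum>x\<in>S. m x *\<^sub>R (g x * cnj (f' x)))"
      by (rule insert.IH) (use insert in \<open>auto simp: f'_def\<close>)
    also have "\<dots> = (\<Sum>x\<in>S. m x *\<^sub>R (g x * cnj (f x)))"
      using insert by (intro sum.cong) (auto simp: f'_def)
    also have "cnj (f a) * \<Lambda> (indicator {a}) = m a *\<^sub>R (g a * cnj (f a))"
      using pos[of a] by (simp add: g_def scaleR_conv_of_real)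
    finally show ?case using insert by simp
  qed
  have cut: "(\<lambda>x. if x \<in> A n then f x else 0) \<in> L2 m" for f n
    by (rule L2_finite_support[OF A(1)[of n]]) auto
  \<comment> \<open>For the truncation f of g to \<open>A n\<close>, \<Lambda> f is the squared norm
    N of f, while its modulus is at most C sqrt N; hence N \<le> C^2, uniformly in n.\<close>
  have fin: "(\<integral>\<^sup>+x. ennreal ((cmod (if x \<in> A n then g x else 0))\<^sup>2) \<partial>M) \<le> ennreal (C\<^sup>2)" for n
  proof -
    define f where "f x = (if x \<in> A n then g x else 0)" for x
    define N where "N = (\<integral>x. (cmod (f x))\<^sup>2 \<partial>M)"
    have N0: "0 \<le> N" unfolding N_def by simp
    have "\<Lambda> f = (\<Sum>x\<in>A n. m x *\<^sub>R (g x * cnj (f x)))"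
      by (rule finite_rep[OF A(1)]) (auto simp: f_def)
    also have "\<dots> = (\<Sum>x\<in>A n. m x *\<^sub>R complex_of_real ((cmod (f x))\<^sup>2))"
      by (intro sum.cong) (auto simp: f_def complex_norm_square simp del: of_real_power)
    also have "\<dots> = complex_of_real (\<Sum>x\<in>A n. m x *\<^sub>R (cmod (f x))\<^sup>2)"
      by (simp add: scaleR_conv_of_real)
    also have "(\<Sum>x\<in>A n. m x *\<^sub>R (cmod (f x))\<^sup>2) = N"
      unfolding N_def using has_integral_finite_support[OF A(1)[of n], of "\<lambda>x. (cmod (f x))\<^sup>2"]
      by (auto simp: f_def has_bochner_integral_iff)
    finally have "cmod (\<Lambda> f) = N" using N0 by simp
    then have "N \<le> C * sqrt N"
      using norm_bound[of f] cut[of n g] unfolding N_def f_def by simp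
    then have "sqrt N * sqrt N \<le> C * sqrt N" using N0 by simp
    then have "sqrt N \<le> C"
      using N0 C by (cases "N = 0") (auto simp: mult_le_cancel_right simp del: real_sqrt_mult_self)
    then have "N \<le> C\<^sup>2" using sqrt_le_D by blast
    moreover have "(\<integral>\<^sup>+x. ennreal ((cmod (f x))\<^sup>2) \<partial>M) = ennreal N"
      unfolding N_def using cut[of n g] by (intro nn_integral_eq_integral) (auto simp: L2_iff f_def)
    ultimately show ?thesis unfolding f_def by (simp add: ennreal_leI)
  qed
  have g: "g \<in> L2 m"
    unfolding L2_iff
  proof (rule integrableI_bounded)
    have "(\<integral>\<^sup>+x. ennreal ((cmod (g x))\<^sup>2) \<partial>M)
        = (\<integral>\<^sup>+x. liminf (\<lambda>n. ennreal ((cmod (if x \<in> A n then g x else 0))\<^sup>2)) \<partial>M)"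
    proof (intro nn_integral_cong)
      fix x
      have "(\<lambda>n. ennreal ((cmod (if x \<in> A n then g x else 0))\<^sup>2)) \<longlonglongrightarrow> ennreal ((cmod (g x))\<^sup>2)"
        by (rule tendsto_eventually, rule eventually_mono[OF exhaustion_eventually[OF A(2) A(3)[of x]]]) simp
      from lim_imp_Liminf[OF sequentially_bot this]
      show "ennreal ((cmod (g x))\<^sup>2) = liminf (\<lambda>n. ennreal ((cmod (if x \<in> A n then g x else 0))\<^sup>2))"
        by (rule sym)
    qed
    also have "\<dots> \<le> liminf (\<lambda>n. \<integral>\<^sup>+x. ennreal ((cmod (if x \<in> A n then g x else 0))\<^sup>2) \<partial>M)"
      by (rule nn_integral_liminf) simp
    also have "\<dots> \<le> ennreal (C\<^sup>2)"
      using Liminf_mono[OF always_eventually, of _ "\<lambda>_. ennreal (C\<^sup>2)" sequentially] fin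
      by (simp add: Liminf_const)
    also have "\<dots> < \<infinity>" by simp
    finally show "(\<integral>\<^sup>+x. ennreal (norm ((cmod (g x))\<^sup>2)) \<partial>M) < \<infinity>" by simp
  qed simp
  have "L2_inner m g h = \<Lambda> h" if h: "h \<in> L2 m" for h
  proof -
    define hn where "hn n x = (if x \<in> A n then h x else 0)" for n x
    have hn: "hn n \<in> L2 m" for n unfolding hn_def by (rule cut)
    have ev: "eventually (\<lambda>n. hn n x = h x) sequentially" for x
      by (rule eventually_mono[OF exhaustion_eventually[OF A(2) A(3)[of x]]]) (simp add: hn_def)
    have "(\<lambda>n. L2_inner m g (hn n)) \<longlonglongrightarrow> L2_inner m g h"
      unfolding L2_inner_def
    proof (rule integral_dominated_convergence[where w = "\<lambda>x. cmod (g x * cnj (h x))"])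
      show "AE x in M. (\<lambda>n. g x * cnj (hn n x)) \<longlonglongrightarrow> g x * cnj (h x)"
        unfolding AE_M
      proof
        show "(\<lambda>n. g x * cnj (hn n x)) \<longlonglongrightarrow> g x * cnj (h x)" for x
          by (rule tendsto_eventually, rule eventually_mono[OF ev[of x]]) simp
      qed
    qed (use integrable_norm[OF integrable_inner[OF g h]] in \<open>auto simp: hn_def norm_mult\<close>)
    moreover have "L2_inner m g (hn n) = \<Lambda> (hn n)" for n
      using has_integral_finite_support[OF A(1)[of n], of "\<lambda>x. g x * cnj (hn n x)"]
        finite_rep[OF A(1)[of n], of "hn n"]
      by (auto simp: L2_inner_def hn_def has_bochner_integral_iff)
    moreover have "(\<lambda>n. \<Lambda> (hn n)) \<longlonglongrightarrow> \<Lambda> h"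
    proof -
      have "(\<lambda>n. \<integral>x. (cmod (h x - hn n x))\<^sup>2 \<partial>M) \<longlonglongrightarrow> (\<integral>x. 0 \<partial>M)"
      proof (rule integral_dominated_convergence[where w = "\<lambda>x. (cmod (h x))\<^sup>2"])
        show "AE x in M. (\<lambda>n. (cmod (h x - hn n x))\<^sup>2) \<longlonglongrightarrow> 0"
          unfolding AE_M
        proof
          show "(\<lambda>n. (cmod (h x - hn n x))\<^sup>2) \<longlonglongrightarrow> 0" for x
            by (rule tendsto_eventually, rule eventually_mono[OF ev[of x]]) simp
        qed
      qed (use h in \<open>auto simp: hn_def L2_iff\<close>)
      then have lim: "(\<lambda>n. C * sqrt (\<integral>x. (cmod (h x - hn n x))\<^sup>2 \<partial>M)) \<longlonglongrightarrow> 0"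
        using tendsto_mult[OF tendsto_const tendsto_real_sqrt, of _ 0 _ C] by fastforce
      have split: "\<Lambda> h - \<Lambda> (hn n) = \<Lambda> (\<lambda>x. h x - hn n x)" for n
        using add[OF L2_diff[OF h hn[of n]] hn[of n]] by simp
      have "(\<lambda>n. \<Lambda> h - \<Lambda> (hn n)) \<longlonglongrightarrow> 0"
        by (rule Lim_null_comparison[OF always_eventually lim])
          (use norm_bound[OF L2_diff[OF h hn]] split in auto)
      then have "(\<lambda>n. \<Lambda> h - (\<Lambda> h - \<Lambda> (hn n))) \<longlonglongrightarrow> \<Lambda> h - 0"
        by (intro tendsto_intros)
      then show ?thesis by simp
    qed
    ultimately show ?thesis using LIMSEQ_unique[of "\<lambda>n. \<Lambda> (hn n)"] by simp
  qed
  then show ?thesis using g by blast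
qed

end

section \<open>Spectral resolution of a bounded positive operator\<close>

locale positive_operator = weighted_space m for m :: "'a \<Rightarrow> real" +
  fixes A :: "('a \<Rightarrow> complex) \<Rightarrow> 'a \<Rightarrow> complex" and b :: real
  assumes b: "0 < b"
    and A_L2 [intro]: "\<And>f. f \<in> L2 m \<Longrightarrow> A f \<in> L2 m"
    and A_add: "\<And>f g. f \<in> L2 m \<Longrightarrow> g \<in> L2 m \<Longrightarrow> A (\<lambda>x. f x + g x) = (\<lambda>x. A f x + A g x)"
    and A_cmult: "\<And>f c. f \<in> L2 m \<Longrightarrow> A (\<lambda>x. c * f x) = (\<lambda>x. c * A f x)"
    and A_sym: "\<And>f g. f \<in> L2 m \<Longrightarrow> g \<in> L2 m \<Longrightarrow> L2_inner m (A f) g = L2_inner m f (A g)"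
    and A_nonneg: "\<And>f. f \<in> L2 m \<Longrightarrow> 0 \<le> Re (L2_inner m (A f) f)"
    and A_le: "\<And>f. f \<in> L2 m \<Longrightarrow> Re (L2_inner m (A f) f) \<le> b * Re (L2_inner m f f)"
begin

lemma pow_L2 [intro]: "f \<in> L2 m \<Longrightarrow> (A ^^ n) f \<in> L2 m"
  by (induction n) auto

lemma pow_add: "f \<in> L2 m \<Longrightarrow> g \<in> L2 m \<Longrightarrow> (A ^^ n) (\<lambda>x. f x + g x) = (\<lambda>x. (A ^^ n) f x + (A ^^ n) g x)"
  by (induction n) (auto simp: A_add pow_L2)

lemma pow_cmult: "f \<in> L2 m \<Longrightarrow> (A ^^ n) (\<lambda>x. c * f x) = (\<lambda>x. c * (A ^^ n) f x)"
  by (induction n) (auto simp: A_cmult pow_L2)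

lemma pow_sym: "f \<in> L2 m \<Longrightarrow> g \<in> L2 m \<Longrightarrow> L2_inner m ((A ^^ n) f) g = L2_inner m f ((A ^^ n) g)"
proof (induction n arbitrary: g)
  case (Suc n)
  then show ?case
    using Suc.IH[of "A g"] by (simp add: A_sym pow_L2 A_L2 funpow_swap1[of A n g])
qed simp

text \<open>\<open>T\<close> and \<open>R\<close> are the operator counterparts of x and 1 - x on
  [0, 1], the setting of the moment problem.\<close>

definition T :: "('a \<Rightarrow> complex) \<Rightarrow> 'a \<Rightarrow> complex" where "T f = (\<lambda>x. complex_of_real (1 / b) * A f x)"
definition R :: "('a \<Rightarrow> complex) \<Rightarrow> 'a \<Rightarrow> complex" where "R f = (\<lambda>x. f x - T f x)"

lemma T_L2 [intro]: "f \<in> L2 m \<Longrightarrow> T f \<in> L2 m"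
  unfolding T_def by (rule L2_cmult) (rule A_L2)

lemma R_L2 [intro]: "f \<in> L2 m \<Longrightarrow> R f \<in> L2 m"
  unfolding R_def by auto

lemma T_diff: "f \<in> L2 m \<Longrightarrow> g \<in> L2 m \<Longrightarrow> T (\<lambda>x. f x - g x) = (\<lambda>x. T f x - T g x)"
  using A_add[of f "\<lambda>x. (-1) * g x"] A_cmult[of g "-1"] L2_cmult[of g "-1"]
  by (simp add: T_def algebra_simps)

lemma T_add: "f \<in> L2 m \<Longrightarrow> g \<in> L2 m \<Longrightarrow> T (\<lambda>x. f x + g x) = (\<lambda>x. T f x + T g x)"
  by (simp add: T_def A_add algebra_simps)

lemma T_sym: "f \<in> L2 m \<Longrightarrow> g \<in> L2 m \<Longrightarrow> L2_inner m (T f) g = L2_inner m f (T g)"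
  by (simp add: T_def inner_cmult_left inner_cmult_right A_sym del: of_real_divide)

lemma R_sym: "f \<in> L2 m \<Longrightarrow> g \<in> L2 m \<Longrightarrow> L2_inner m (R f) g = L2_inner m f (R g)"
  by (simp add: R_def inner_diff_left inner_diff_right T_L2 T_sym)

lemma T_nonneg: "f \<in> L2 m \<Longrightarrow> 0 \<le> Re (L2_inner m (T f) f)"
  using b A_nonneg by (simp add: T_def inner_cmult_left del: of_real_divide)

lemma R_nonneg: "f \<in> L2 m \<Longrightarrow> 0 \<le> Re (L2_inner m (R f) f)"
proof -
  assume f: "f \<in> L2 m"
  have "L2_inner m (R f) f = L2_inner m f f - complex_of_real (1 / b) * L2_inner m (A f) f"
    using f by (simp add: R_def inner_diff_left T_L2 del: of_real_divide) (simp add: T_def inner_cmult_left del: of_real_divide)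
  then have "Re (L2_inner m (R f) f) = Re (L2_inner m f f) - Re (L2_inner m (A f) f) / b"
    by (simp del: of_real_divide)
  moreover have "Re (L2_inner m (A f) f) / b \<le> Re (L2_inner m f f)"
    using b A_le[OF f] by (simp add: divide_le_eq mult.commute)
  ultimately show ?thesis by simp
qed

lemma R_T: "f \<in> L2 m \<Longrightarrow> R (T f) = T (R f)"
  by (simp add: R_def T_diff T_L2)

lemma Tpow_L2 [intro]: "f \<in> L2 m \<Longrightarrow> (T ^^ n) f \<in> L2 m"
  by (induction n) auto

lemma Rpow_L2 [intro]: "f \<in> L2 m \<Longrightarrow> (R ^^ n) f \<in> L2 m"
  by (induction n) auto

lemma Rpow_T: "f \<in> L2 m \<Longrightarrow> (R ^^ n) (T f) = T ((R ^^ n) f)"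
  by (induction n) (auto simp: R_T Rpow_L2)

lemma R_Tpow: "f \<in> L2 m \<Longrightarrow> R ((T ^^ n) f) = (T ^^ n) (R f)"
  by (induction n) (auto simp: R_T Tpow_L2)

lemma Tpow_add: "f \<in> L2 m \<Longrightarrow> g \<in> L2 m \<Longrightarrow> (T ^^ n) (\<lambda>x. f x + g x) = (\<lambda>x. (T ^^ n) f x + (T ^^ n) g x)"
  by (induction n) (auto simp: T_add Tpow_L2)

text \<open>Positivity of x^k (1 - x)^l at operator level. Since \<open>T\<close> and
  \<open>R\<close> are symmetric and commute, two equal factors can be placed one on each side of
  the inner product, which replaces f by \<open>T f\<close> or \<open>R f\<close> and lowers k + l
  by 2. Exponents at most 1 remain, and among these only the product \<open>T R\<close> is not
  positive by assumption.\<close>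

lemma bernstein_nonneg:
  "f \<in> L2 m \<Longrightarrow> 0 \<le> Re (L2_inner m ((T ^^ k) ((R ^^ l) f)) f)"
proof (induction "k + l" arbitrary: k l f rule: less_induct)
  case less
  have f: "f \<in> L2 m" by fact
  consider k' where "k = Suc (Suc k')" | l' where "l = Suc (Suc l')"
    | "k = 0" "l = 0" | "k = 0" "l = 1" | "k = 1" "l = 0" | "k = 1" "l = 1"
    by (metis One_nat_def not0_implies_Suc)
  then show ?case
  proof cases
    case 1
    have "(T ^^ k) ((R ^^ l) f) = T ((T ^^ k') ((R ^^ l) (T f)))"
      unfolding 1 Rpow_T[OF f] by (simp add: funpow_swap1)
    then show ?thesis
      using less.hyps[of k' l "T f"] f 1 by (simp add: T_sym T_L2 Tpow_L2 Rpow_L2)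
  next
    case 2
    have "(T ^^ k) ((R ^^ l) f) = R ((T ^^ k) ((R ^^ l') (R f)))"
      unfolding 2 by (subst R_Tpow) (auto simp: Rpow_L2 R_L2 f funpow_swap1)
    then show ?thesis
      using less.hyps[of k l' "R f"] f 2 by (simp add: R_sym R_L2 Tpow_L2 Rpow_L2)
  next
    case 6
    text \<open>\<open>T R = T R (T + R) = T R T + R T R\<close>\<close>
    have "T (R f) = (\<lambda>x. T (R (T f)) x + R (T (R f)) x)"
    proof -
      have "R f = (\<lambda>x. T (R f) x + R (R f) x)" by (simp add: R_def)
      then have "T (R f) = T (\<lambda>x. T (R f) x + R (R f) x)" by simp
      also have "\<dots> = (\<lambda>x. T (T (R f)) x + T (R (R f)) x)"
        using f by (intro T_add) auto
      finally show ?thesis using R_T[OF f] R_T[OF R_L2[OF f]] by simp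
    qed
    then have "L2_inner m (T (R f)) f = L2_inner m (\<lambda>x. T (R (T f)) x + R (T (R f)) x) f"
      by (rule arg_cong)
    also have "\<dots> = L2_inner m (T (R (T f))) f + L2_inner m (R (T (R f))) f"
      using f by (intro inner_add_left) auto
    also have "\<dots> = L2_inner m (R (T f)) (T f) + L2_inner m (T (R f)) (R f)"
      using f by (simp add: T_sym R_sym T_L2 R_L2)
    finally show ?thesis
      using 6 f T_nonneg[OF R_L2[OF f]] R_nonneg[OF T_L2[OF f]] by auto
  qed (use f T_nonneg R_nonneg inner_self_nonneg in auto)
qed

lemma Tpow_eq: "f \<in> L2 m \<Longrightarrow> (T ^^ n) f = (\<lambda>x. complex_of_real ((1 / b) ^ n) * (A ^^ n) f x)"
proof (induction n)
  case (Suc n)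
  then have "(T ^^ Suc n) f = T (\<lambda>x. complex_of_real ((1 / b) ^ n) * (A ^^ n) f x)"
    by simp
  also have "\<dots> = (\<lambda>x. complex_of_real (1 / b) * (complex_of_real ((1 / b) ^ n) * A ((A ^^ n) f) x))"
    unfolding T_def using Suc.prems by (subst A_cmult) auto
  finally show ?case by (simp add: mult.assoc)
qed simp

lemma pow_inner_real: "f \<in> L2 m \<Longrightarrow> L2_inner m ((A ^^ n) f) f = complex_of_real (Re (L2_inner m ((A ^^ n) f) f))"
  using inner_cnj[of "(A ^^ n) f" f] pow_sym[of f f n] by (metis Reals_cnj_iff of_real_Re)

section \<open>Scalar spectral measures and their polarization\<close>

definition spectral_measure_of :: "('a \<Rightarrow> complex) \<Rightarrow> real measure" where
  "spectral_measure_of f = (SOME N. finite_measure N \<and> sets N = sets (borel :: real measure) \<and>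
     (AE x in N. x \<in> {0..b}) \<and> (\<forall>j. complex_of_real (\<integral>x. x ^ j \<partial>N) = L2_inner m ((A ^^ j) f) f))"

text \<open>The difference equation comes from T + R = 1 and the positivity from
  \<open>bernstein_nonneg\<close>; the scaling by b turns moments of \<open>T\<close> into moments
  of \<open>A\<close>.\<close>

lemma spectral_measure_exists:
  assumes f: "f \<in> L2 m"
  shows "\<exists>N. finite_measure N \<and> sets N = sets (borel :: real measure) \<and>
     (AE x in N. x \<in> {0..b}) \<and> (\<forall>j. complex_of_real (\<integral>x. x ^ j \<partial>N) = L2_inner m ((A ^^ j) f) f)"
proof -
  define D where "D k l = Re (L2_inner m ((T ^^ k) ((R ^^ l) f)) f)" for k l
  have "D k l = D (Suc k) l + D k (Suc l)" for k l
  proof -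
    define g where "g = (R ^^ l) f"
    have g: "g \<in> L2 m" unfolding g_def using f by auto
    have "g = (\<lambda>x. T g x + R g x)" by (simp add: R_def)
    then have "(T ^^ k) g = (T ^^ k) (\<lambda>x. T g x + R g x)" by simp
    also have "\<dots> = (\<lambda>x. (T ^^ k) (T g) x + (T ^^ k) (R g) x)"
      using g by (intro Tpow_add) auto
    finally have "L2_inner m ((T ^^ k) g) f = L2_inner m ((T ^^ k) (T g)) f + L2_inner m ((T ^^ k) (R g)) f"
      using f g by (simp add: inner_add_left Tpow_L2 T_L2 R_L2)
    then show ?thesis unfolding D_def g_def by (simp add: funpow_swap1)
  qed
  moreover have "0 \<le> D k l" for k l
    unfolding D_def using f by (rule bernstein_nonneg)
  ultimately obtain N where N: "finite_measure N" "sets N = sets (borel :: real measure)"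
      "AE x in N. x \<in> {0..b}" "\<And>j. (\<integral>x. x ^ j \<partial>N) = b ^ j * D j 0"
    using hausdorff_moment[of D b] b by (metis less_imp_le)
  have "complex_of_real (\<integral>x. x ^ j \<partial>N) = L2_inner m ((A ^^ j) f) f" for j
  proof -
    have "b ^ j * D j 0 = Re (L2_inner m ((A ^^ j) f) f)"
      unfolding D_def using f b
      by (simp add: Tpow_eq inner_cmult_left power_divide del: of_real_divide of_real_power)
    then show ?thesis using N(4) pow_inner_real[OF f] by metis
  qed
  then show ?thesis using N by blast
qed

lemma spectral_measure_of:
  assumes "f \<in> L2 m"
  shows "finite_measure (spectral_measure_of f)" "sets (spectral_measure_of f) = sets borel"
    "AE x in spectral_measure_of f. x \<in> {0..b}"
    "complex_of_real (\<integral>x. x ^ j \<partial>spectral_measure_of f) = L2_inner m ((A ^^ j) f) f"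
  using someI_ex[OF spectral_measure_exists[OF assms], folded spectral_measure_of_def] by blast+

lemma sigma_functional_spectral:
  "f \<in> L2 m \<Longrightarrow> sigma_functional b (\<lambda>\<phi>. \<integral>x. \<phi> x \<partial>spectral_measure_of f)"
  by (intro sigma_functional_integral spectral_measure_of)

lemma spectral_pow:
  "f \<in> L2 m \<Longrightarrow> (\<integral>x. complex_of_real x ^ n \<partial>spectral_measure_of f) = L2_inner m ((A ^^ n) f) f"
  using spectral_measure_of(4)[of f n] by (simp flip: of_real_power)

lemma spectral_bound:
  assumes f: "f \<in> L2 m" and C: "\<And>x. 0 \<le> x \<Longrightarrow> x \<le> b \<Longrightarrow> cmod (\<phi> x) \<le> C" and \<phi>: "\<phi> \<in> bounded_borel b"
  shows "cmod (\<integral>x. \<phi> x \<partial>spectral_measure_of f) \<le> C * Re (L2_inner m f f)"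
proof -
  note sp = spectral_measure_of[OF f]
  interpret finite_measure "spectral_measure_of f" by (rule sp)
  have "cmod (\<integral>x. \<phi> x \<partial>spectral_measure_of f) \<le> (\<integral>x. cmod (\<phi> x) \<partial>spectral_measure_of f)"
    by (rule integral_norm_bound)
  also have "\<dots> \<le> (\<integral>x. C \<partial>spectral_measure_of f)"
  proof (rule integral_mono_AE)
    show "integrable (spectral_measure_of f) (\<lambda>x. cmod (\<phi> x))"
      by (intro integrable_norm integrable_bounded_borel[OF sp(1-3) \<phi>])
    show "AE x in spectral_measure_of f. cmod (\<phi> x) \<le> C"
      using eventually_mono[OF sp(3)] C by simp
  qed simp
  also have "\<dots> = C * (\<integral>x. x ^ 0 \<partial>spectral_measure_of f)" by simp
  also have "(\<integral>x. x ^ 0 \<partial>spectral_measure_of f) = Re (L2_inner m f f)"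
    using arg_cong[OF sp(4)[of 0], of Re] by simp
  finally show ?thesis .
qed

text \<open>Integration against the complex measure \<langle>E(.) f, h\<rangle>, available before E
  is. The formula copies \<open>spectral_integral\<close>, so that the two agree as soon as the
  measures of E are identified.\<close>

definition spectral_form :: "('a \<Rightarrow> complex) \<Rightarrow> ('a \<Rightarrow> complex) \<Rightarrow> (real \<Rightarrow> complex) \<Rightarrow> complex" where
  "spectral_form f h \<phi> =
     1/4 * (\<Sum>k<4. \<i>^k * (\<integral>x. \<phi> x \<partial>spectral_measure_of (\<lambda>x. f x + \<i>^k * h x)))"

lemma sigma_functional_form:
  "f \<in> L2 m \<Longrightarrow> h \<in> L2 m \<Longrightarrow> sigma_functional b (spectral_form f h)"
  unfolding spectral_form_def[abs_def]
  by (intro sigma_functional_times sigma_functional_finite_sum sigma_functional_spectral L2_add L2_cmult)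

lemma form_pow:
  assumes f: "f \<in> L2 m" and h: "h \<in> L2 m"
  shows "spectral_form f h (\<lambda>x. complex_of_real x ^ n) = L2_inner m ((A ^^ n) f) h"
proof -
  have "L2_inner m ((A ^^ n) (\<lambda>x. f x + c * h x)) (\<lambda>x. f x + c * h x) =
      L2_inner m ((A ^^ n) f) f + cnj c * L2_inner m ((A ^^ n) f) h + c * L2_inner m ((A ^^ n) h) f
      + c * cnj c * L2_inner m ((A ^^ n) h) h" for c
    using f h by (simp add: pow_add pow_cmult L2_cmult L2_add pow_L2 inner_add_left inner_add_right
        inner_cmult_left inner_cmult_right algebra_simps)
  then have expand: "(\<integral>x. complex_of_real x ^ n \<partial>spectral_measure_of (\<lambda>x. f x + c * h x)) =
      L2_inner m ((A ^^ n) f) f + cnj c * L2_inner m ((A ^^ n) f) h + c * L2_inner m ((A ^^ n) h) f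
      + c * cnj c * L2_inner m ((A ^^ n) h) h" for c
    using f h by (simp add: spectral_pow L2_add L2_cmult)
  show ?thesis
    unfolding spectral_form_def expand by (simp add: numeral_eq_Suc lessThan_Suc algebra_simps power_Suc)
qed

text \<open>The four measures in \<open>spectral_form\<close> are chosen independently of each
  other, so not even additivity in h is visible from the definition. It becomes so on powers, where
  the form is an inner product with \<open>A ^^ n\<close>, and powers determine it.\<close>

lemma form_eqI:
  assumes "f \<in> L2 m" "h \<in> L2 m" "sigma_functional b \<Lambda>" "\<phi> \<in> bounded_borel b"
    "\<And>n. \<Lambda> (\<lambda>x. complex_of_real x ^ n) = L2_inner m ((A ^^ n) f) h"
  shows "spectral_form f h \<phi> = \<Lambda> \<phi>"
  by (rule sigma_functional_eq[OF sigma_functional_form]) (use assms form_pow in auto)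

lemma form_self:
  "f \<in> L2 m \<Longrightarrow> \<phi> \<in> bounded_borel b \<Longrightarrow> spectral_form f f \<phi> = (\<integral>x. \<phi> x \<partial>spectral_measure_of f)"
  by (rule form_eqI) (auto intro: sigma_functional_spectral spectral_pow)

lemma form_add_right:
  assumes "f \<in> L2 m" "g \<in> L2 m" "h \<in> L2 m" "\<phi> \<in> bounded_borel b"
  shows "spectral_form f (\<lambda>x. g x + h x) \<phi> = spectral_form f g \<phi> + spectral_form f h \<phi>"
  by (rule form_eqI)
    (use assms in \<open>auto intro: sigma_functional_plus sigma_functional_form simp: form_pow inner_add_right pow_L2\<close>)

lemma form_cmult_right:
  assumes "f \<in> L2 m" "h \<in> L2 m" "\<phi> \<in> bounded_borel b"
  shows "spectral_form f (\<lambda>x. c * h x) \<phi> = cnj c * spectral_form f h \<phi>"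
  by (rule form_eqI)
    (use assms in \<open>auto intro: sigma_functional_times sigma_functional_form simp: form_pow inner_cmult_right pow_L2\<close>)

lemma form_cnj:
  assumes "f \<in> L2 m" "h \<in> L2 m" "\<phi> \<in> bounded_borel b"
  shows "spectral_form f h \<phi> = cnj (spectral_form h f (\<lambda>x. cnj (\<phi> x)))"
proof (rule form_eqI)
  show "cnj (spectral_form h f (\<lambda>x. cnj (complex_of_real x ^ n))) = L2_inner m ((A ^^ n) f) h" for n
    using assms inner_cnj[of h "(A ^^ n) f"] by (simp add: form_pow pow_sym)
qed (use assms in \<open>auto intro: sigma_functional_cnj sigma_functional_form\<close>)

lemma form_pow_right:
  assumes "f \<in> L2 m" "h \<in> L2 m" "\<phi> \<in> bounded_borel b"
  shows "spectral_form f ((A ^^ n) h) \<phi> = spectral_form f h (\<lambda>x. \<phi> x * complex_of_real x ^ n)"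
proof (rule form_eqI)
  show "spectral_form f h (\<lambda>x. complex_of_real x ^ k * complex_of_real x ^ n) = L2_inner m ((A ^^ k) f) ((A ^^ n) h)" for k
  proof -
    have "spectral_form f h (\<lambda>x. complex_of_real x ^ k * complex_of_real x ^ n) = L2_inner m ((A ^^ (k + n)) f) h"
      using assms form_pow[of f h "k + n"] by (simp add: power_add)
    also have "\<dots> = L2_inner m ((A ^^ n) ((A ^^ k) f)) h"
      by (metis add.commute comp_apply funpow_add)
    finally show ?thesis using assms by (simp add: pow_sym pow_L2)
  qed
qed (use assms in \<open>auto intro: sigma_functional_mult[OF sigma_functional_form]\<close>)

text \<open>For h in the unit ball the total masses of the four spectral measures are bounded in
  terms of f alone, so the Riesz representation applies.\<close>

lemma form_representation:
  assumes f: "f \<in> L2 m" and \<phi>: "\<phi> \<in> bounded_borel b"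
  shows "\<exists>g\<in>L2 m. \<forall>h\<in>L2 m. L2_inner m g h = spectral_form f h \<phi>"
proof -
  obtain C where C: "C > 0" "\<And>x. 0 \<le> x \<Longrightarrow> x \<le> b \<Longrightarrow> cmod (\<phi> x) \<le> C"
    using bounded_borel_bound[OF \<phi>] by blast
  show ?thesis
  proof (rule riesz_representation[where \<Lambda> = "\<lambda>h. spectral_form f h \<phi>"])
    fix h assume h: "h \<in> L2 m" and h1: "(\<integral>x. (cmod (h x))\<^sup>2 \<partial>M) \<le> 1"
    \<comment> \<open>From |a + b|^2 \<le> 2 (|a|^2 + |b|^2), applied to f and a unimodular multiple
      of h with norm at most 1.\<close>
    let ?K = "2 * (Re (L2_inner m f f) + 1)"
    have "cmod (\<integral>x. \<phi> x \<partial>spectral_measure_of (\<lambda>x. f x + \<i>^k * h x)) \<le> C * ?K" for k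
    proof -
      have fh: "(\<lambda>x. f x + \<i>^k * h x) \<in> L2 m" using f h by auto
      have "(\<integral>x. (cmod (f x + \<i>^k * h x))\<^sup>2 \<partial>M) \<le> (\<integral>x. 2 * ((cmod (f x))\<^sup>2 + (cmod (h x))\<^sup>2) \<partial>M)"
        using cmod_add_sq[of "f _" "\<i>^k * h _"] fh f h
        by (intro integral_mono) (auto simp: L2_iff norm_mult norm_power)
      also have "\<dots> \<le> ?K"
        using f h h1 by (simp add: L2_iff inner_self)
      finally have "Re (L2_inner m (\<lambda>x. f x + \<i>^k * h x) (\<lambda>x. f x + \<i>^k * h x)) \<le> ?K"
        by (simp add: inner_self)
      then have "C * Re (L2_inner m (\<lambda>x. f x + \<i>^k * h x) (\<lambda>x. f x + \<i>^k * h x)) \<le> C * ?K"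
        using C(1) by (intro mult_left_mono) auto
      then show ?thesis
        using spectral_bound[OF fh C(2) \<phi>] by linarith
    qed
    then have "(\<Sum>k<4. cmod (\<i>^k * (\<integral>x. \<phi> x \<partial>spectral_measure_of (\<lambda>x. f x + \<i>^k * h x)))) \<le> (\<Sum>k<(4::nat). C * ?K)"
      by (intro sum_mono) (simp add: norm_mult norm_power)
    then have "cmod (\<Sum>k<4. \<i>^k * (\<integral>x. \<phi> x \<partial>spectral_measure_of (\<lambda>x. f x + \<i>^k * h x))) \<le> 4 * (C * ?K)"
      by (intro order_trans[OF norm_sum]) simp
    then show "cmod (spectral_form f h \<phi>) \<le> C * ?K"
      unfolding spectral_form_def by (simp add: norm_mult norm_divide)
  qed (use f \<phi> in \<open>auto simp: form_add_right form_cmult_right\<close>)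
qed

section \<open>The bounded Borel calculus and its spectral projections\<close>

definition calculus :: "(real \<Rightarrow> complex) \<Rightarrow> ('a \<Rightarrow> complex) \<Rightarrow> 'a \<Rightarrow> complex" where
  "calculus \<phi> f = (SOME g. g \<in> L2 m \<and> (\<forall>h\<in>L2 m. L2_inner m g h = spectral_form f h \<phi>))"

lemma calculus:
  assumes "f \<in> L2 m" "\<phi> \<in> bounded_borel b"
  shows "calculus \<phi> f \<in> L2 m" "\<And>h. h \<in> L2 m \<Longrightarrow> L2_inner m (calculus \<phi> f) h = spectral_form f h \<phi>"
proof -
  have "\<exists>g. g \<in> L2 m \<and> (\<forall>h\<in>L2 m. L2_inner m g h = spectral_form f h \<phi>)"
    using form_representation[OF assms] by blast
  from someI_ex[OF this, folded calculus_def]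
  show "calculus \<phi> f \<in> L2 m" "\<And>h. h \<in> L2 m \<Longrightarrow> L2_inner m (calculus \<phi> f) h = spectral_form f h \<phi>"
    by blast+
qed

text \<open>On powers, \<open>A ^^ n\<close> moves to h, where \<open>form_pow_right\<close>
  converts it back into a factor x^n. This is the source of multiplicativity, and so of the product
  rule for the projections.\<close>

lemma form_calculus_left:
  assumes f: "f \<in> L2 m" and h: "h \<in> L2 m" and \<phi>: "\<phi> \<in> bounded_borel b" and \<psi>: "\<psi> \<in> bounded_borel b"
  shows "spectral_form (calculus \<psi> f) h \<phi> = spectral_form f h (\<lambda>x. \<phi> x * \<psi> x)"
proof (rule form_eqI)
  show "spectral_form f h (\<lambda>x. complex_of_real x ^ n * \<psi> x) = L2_inner m ((A ^^ n) (calculus \<psi> f)) h" for n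
    using assms calculus[OF f \<psi>] by (simp add: pow_sym pow_L2 form_pow_right mult.commute)
qed (use assms calculus[OF f \<psi>] in \<open>auto intro: sigma_functional_mult[OF sigma_functional_form]\<close>)

lemma calculus_mult:
  assumes f: "f \<in> L2 m" and \<phi>: "\<phi> \<in> bounded_borel b" and \<psi>: "\<psi> \<in> bounded_borel b"
  shows "calculus \<phi> (calculus \<psi> f) = calculus (\<lambda>x. \<phi> x * \<psi> x) f"
  using assms by (intro inner_ext) (simp add: calculus form_calculus_left bounded_borel_mult)

definition projection :: "real set \<Rightarrow> ('a \<Rightarrow> complex) \<Rightarrow> 'a \<Rightarrow> complex" where
  "projection B = calculus (indicator B)"

lemma inner_projection_self:
  assumes f: "f \<in> L2 m" and B: "B \<in> sets borel"
  shows "L2_inner m (projection B f) f = complex_of_real (measure (spectral_measure_of f) B)"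
proof -
  have "L2_inner m (projection B f) f = (\<integral>x. complex_of_real (indicator B x) \<partial>spectral_measure_of f)"
    using f B by (simp add: projection_def calculus form_self bounded_borel_indicator of_real_indicator)
  also have "\<dots> = complex_of_real (measure (spectral_measure_of f) B)"
    using spectral_measure_of(2)[OF f] B sets_eq_imp_space_eq[OF spectral_measure_of(2)[OF f]]
    by (simp add: integral_complex_of_real)
  finally show ?thesis .
qed

text \<open>Ties the measure on which \<open>borel_calculus\<close> rests to the one built from
  moments; the set function given to \<open>measure_of\<close> is already a measure on the Borel
  sets.\<close>

lemma spectral_dist_projection:
  assumes f: "f \<in> L2 m"
  shows "spectral_dist m projection f = spectral_measure_of f"
proof -
  note sp = spectral_measure_of[OF f]
  have "spectral_dist m projection f
      = measure_of (space (spectral_measure_of f)) (sets (spectral_measure_of f)) (emeasure (spectral_measure_of f))"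
    unfolding spectral_dist_def sp(2) sets_eq_imp_space_eq[OF sp(2)]
  proof (rule measure_of_eq)
    fix B assume "B \<in> sigma_sets (space borel) (sets (borel :: real measure))"
    then have "B \<in> sets borel" by (metis sets.sigma_sets_eq)
    then show "ennreal (Re (L2_inner m (projection B f) f)) = emeasure (spectral_measure_of f) B"
      using f by (simp add: inner_projection_self finite_measure.emeasure_eq_measure[OF sp(1)])
  qed (rule sets.space_closed)
  then show ?thesis by (simp add: measure_of_of_measure)
qed

text \<open>Stated for any \<open>A'\<close> that agrees with \<open>A\<close> on L2(m): the flow
  Laplacian involves an adjoint defined by \<open>THE\<close> and is computed only there.\<close>

lemma spectral_resolution_projection:
  assumes A': "\<And>f. f \<in> L2 m \<Longrightarrow> A' f = A f"
  shows "spectral_resolution m A' projection"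
  unfolding spectral_resolution_def
proof (intro conjI ballI allI impI)
  fix B C :: "real set" and f g :: "'a \<Rightarrow> complex"
  assume B: "B \<in> sets borel" and f: "f \<in> L2 m"
  show "projection B f \<in> L2 m"
    unfolding projection_def by (intro calculus f bounded_borel_indicator B)
  show "L2_inner m (projection B f) g = L2_inner m f (projection B g)" if g: "g \<in> L2 m"
  proof -
    have "(\<lambda>x. cnj (indicator B x)) = (indicator B :: real \<Rightarrow> complex)"
      by (auto simp: fun_eq_iff indicator_def)
    then show ?thesis
      using B f g form_cnj[of f g "indicator B"] inner_cnj[of f "projection B g"]
      by (simp add: projection_def calculus bounded_borel_indicator)
  qed
  show "projection (B \<inter> C) f = projection B (projection C f)" if C: "C \<in> sets borel"
    using B C f unfolding projection_def
    by (subst calculus_mult) (auto simp: indicator_inter_arith[abs_def])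
next
  fix f :: "'a \<Rightarrow> complex" assume f: "f \<in> L2 m"
  note sp = spectral_measure_of[OF f]
  have "(indicator UNIV :: real \<Rightarrow> complex) = (\<lambda>x. complex_of_real x ^ 0)" by (auto simp: fun_eq_iff)
  then have "L2_inner m (projection UNIV f) h = L2_inner m f h" if "h \<in> L2 m" for h
    using f that form_pow[of f h 0] by (simp add: projection_def calculus)
  then show "projection UNIV f = f" by (rule inner_ext)
  have int: "integrable (spectral_measure_of f) (\<lambda>x. complex_of_real x ^ 1)"
    by (rule integrable_bounded_borel[OF sp(1-3)]) (rule bounded_borel_power)
  then have "integrable (spectral_measure_of f) (\<lambda>x. Re (complex_of_real x ^ 1))"
    by (rule integrable_Re)
  then show "integrable (spectral_dist m projection f) (\<lambda>l. l)"
    using f by (simp add: spectral_dist_projection)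
  show "L2_inner m (A' f) f = complex_of_real (\<integral>l. l \<partial>spectral_dist m projection f)"
    using f A'[OF f] sp(4)[of 1] by (simp add: spectral_dist_projection)
next
  fix B :: "nat \<Rightarrow> real set" and f :: "'a \<Rightarrow> complex"
  assume B: "range B \<subseteq> sets borel" "disjoint_family B" and f: "f \<in> L2 m"
  interpret finite_measure "spectral_measure_of f" by (rule spectral_measure_of[OF f])
  have "(\<lambda>n. measure (spectral_measure_of f) (B n)) sums measure (spectral_measure_of f) (\<Union>n. B n)"
    by (rule finite_measure_UNION) (use B spectral_measure_of(2)[OF f] in auto)
  moreover have "L2_inner m (projection (B n) f) f = complex_of_real (measure (spectral_measure_of f) (B n))" for n
    using B f by (intro inner_projection_self) auto
  moreover have "L2_inner m (projection (\<Union>n. B n) f) f = complex_of_real (measure (spectral_measure_of f) (\<Union>n. B n))"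
    using B f by (intro inner_projection_self) auto
  ultimately show "(\<lambda>n. L2_inner m (projection (B n) f) f) sums L2_inner m (projection (\<Union>n. B n) f) f"
    by (simp add: sums_of_real_iff)
qed

text \<open>As F is bounded on [0, b], its calculus domain is all of L2(m). The graph thus contains
  a pair above every f, which is what a counterexample has to be drawn from.\<close>

lemma borel_calculus_calculus:
  assumes A': "\<And>f. f \<in> L2 m \<Longrightarrow> A' f = A f" and f: "f \<in> L2 m" and F: "F \<in> bounded_borel b"
  shows "(f, calculus F f) \<in> borel_calculus m A' F"
proof -
  have F2: "(\<lambda>x. complex_of_real ((cmod (F x))\<^sup>2)) \<in> bounded_borel b"
    using bounded_borel_mult[OF F bounded_borel_cnj[OF F]] by (simp add: complex_norm_square del: of_real_power)
  have "f \<in> calculus_domain m projection F" 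
  proof -
    have "integrable (spectral_measure_of f) (\<lambda>x. Re (complex_of_real ((cmod (F x))\<^sup>2)))"
      by (intro integrable_Re integrable_bounded_borel[OF spectral_measure_of(1-3)[OF f] F2])
    then show ?thesis using f by (simp add: calculus_domain_def spectral_dist_projection)
  qed
  moreover have "L2_inner m (calculus F f) h = spectral_integral m projection F f h" if h: "h \<in> L2 m" for h
    using f h F unfolding spectral_integral_def
    by (simp add: spectral_dist_projection L2_add L2_cmult calculus spectral_form_def)
  ultimately show ?thesis
    unfolding borel_calculus_def using spectral_resolution_projection[OF A'] calculus[OF f F]
    by (auto simp: calculus_domain_def)
qed

end

section \<open>Trees with a distinguished end\<close>

text \<open>Walks without backtracking; values of w beyond n are ignored. In a tree they are
  geodesics, and they are easier to splice and cut than distances.\<close>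

definition reduced_walk :: "('a \<Rightarrow> 'a \<Rightarrow> bool) \<Rightarrow> nat \<Rightarrow> (nat \<Rightarrow> 'a) \<Rightarrow> bool" where
  "reduced_walk adj n w \<longleftrightarrow>
     (\<forall>i<n. adj (w i) (w (Suc i))) \<and> (\<forall>i. Suc i < n \<longrightarrow> w (Suc (Suc i)) \<noteq> w i)"

locale tree =
  fixes adj :: "'a \<Rightarrow> 'a \<Rightarrow> bool"
  assumes is_tree: "is_tree adj"
begin

lemma adj_sym: "adj x y \<Longrightarrow> adj y x"
  using is_tree by (auto simp: is_tree_def dest: sympD)

lemma adj_irrefl: "\<not> adj x x"
  using is_tree by (auto simp: is_tree_def irreflp_def)

lemma connected: "adj\<^sup>*\<^sup>* x y"
  using is_tree by (simp add: is_tree_def)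

lemma finite_neighbours: "finite {y. adj x y}"
  using is_tree by (simp add: is_tree_def)

lemma no_cycle: "\<not> is_cycle adj xs"
  using is_tree by (simp add: is_tree_def)

lemma countable_vertices: "countable (UNIV :: 'a set)"
proof -
  have finite: "finite {y. (adj ^^ n) x y}" for n x
  proof (induction n)
    case (Suc n)
    have "{y. (adj ^^ Suc n) x y} = (\<Union>z\<in>{z. (adj ^^ n) x z}. {y. adj z y})"
      by auto
    then show ?case using Suc finite_neighbours by simp
  qed simp
  have "(UNIV :: 'a set) = (\<Union>n. {y. (adj ^^ n) undefined y})"
    using connected by (auto simp: rtranclp_power)
  moreover have "countable (\<Union>n. {y. (adj ^^ n) undefined y})"
    using finite by (intro countable_UN) (auto intro: countable_finite)
  ultimately show ?thesis by simp
qed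

text \<open>A coincidence with minimal j - i would close a cycle. Gaps 1 and 2 do not produce a
  cycle of length 3 and are excluded by irreflexivity and by the absence of backtracking.\<close>

lemma reduced_walk_distinct:
  assumes w: "reduced_walk adj n w"
  shows "i < j \<Longrightarrow> j \<le> n \<Longrightarrow> w i \<noteq> w j"
proof (induction "j - i" arbitrary: i j rule: less_induct)
  case less
  show ?case
  proof
    assume eq: "w i = w j"
    have inner: "w i' \<noteq> w j'" if "i \<le> i'" "i' < j'" "j' < j" for i' j'
      using less.hyps[of j' i'] that less.prems by auto
    have steps: "adj (w k) (w (Suc k))" if "k < j" for k
      using w that less.prems unfolding reduced_walk_def by auto
    have "j \<noteq> Suc i"
      using steps[of i] adj_irrefl eq by auto
    moreover have "j \<noteq> Suc (Suc i)"
      using w eq less.prems unfolding reduced_walk_def by (auto simp: Suc_le_eq)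
    ultimately have long: "j - i \<ge> 3"
      using less.prems by linarith
    let ?xs = "map w [i..<j]"
    have "distinct ?xs"
      using inner by (auto simp: distinct_map inj_on_def) (metis linorder_neqE_nat)
    moreover have "successively adj ?xs"
      using steps less.prems(1)
      by (auto simp: successively_conv_nth)
    moreover have "adj (last ?xs) (hd ?xs)"
      using steps[of "j - 1"] eq less.prems by (simp add: last_map hd_map)
    ultimately have "is_cycle adj ?xs"
      using long by (simp add: is_cycle_def)
    then show False using no_cycle by blast
  qed
qed

text \<open>If the penultimate vertices agree, both walks can be shortened. Otherwise w followed by
  the reversal of v does not backtrack at the junction either and is a closed reduced walk, against
  \<open>reduced_walk_distinct\<close>.\<close>

lemma reduced_walk_unique:
  "reduced_walk adj n w \<Longrightarrow> reduced_walk adj k v \<Longrightarrow> w 0 = v 0 \<Longrightarrow> w n = v k \<Longrightarrow>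
   n = k \<and> (\<forall>i\<le>n. w i = v i)"
proof (induction n arbitrary: k)
  case 0
  then show ?case using reduced_walk_distinct[of k v 0 k] by (cases k) auto
next
  case (Suc n)
  show ?case
  proof (cases k)
    case 0
    then show ?thesis using Suc.prems reduced_walk_distinct[of "Suc n" w 0 "Suc n"] by auto
  next
    case k: (Suc k')
    show ?thesis
    proof (cases "w n = v k'")
      case True
      have "reduced_walk adj n w" "reduced_walk adj k' v"
        using Suc.prems k by (auto simp: reduced_walk_def)
      then have "n = k' \<and> (\<forall>i\<le>n. w i = v i)"
        using Suc True by blast
      then show ?thesis using Suc.prems(4) k by (auto simp: le_Suc_eq)
    next
      case False
      \<comment> \<open>The two branches agree at i = Suc n, where the second one reads
        \<open>v k = w (Suc n)\<close>.\<close>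
      define u where "u i = (if i \<le> Suc n then w i else v (Suc n + k - i))" for i
      have "reduced_walk adj (Suc n + k) u"
        unfolding reduced_walk_def
      proof (intro conjI allI impI)
        fix i assume i: "i < Suc n + k"
        show "adj (u i) (u (Suc i))"
        proof (cases "i < Suc n")
          case True
          then show ?thesis using Suc.prems(1) by (auto simp: u_def reduced_walk_def)
        next
          case False
          then have "adj (v (Suc n + k - Suc i)) (v (Suc (Suc n + k - Suc i)))"
            using Suc.prems(2) i k by (auto simp: reduced_walk_def)
          moreover have "Suc (Suc n + k - Suc i) = Suc n + k - i" using i by simp
          ultimately have "adj (v (Suc n + k - i)) (v (Suc n + k - Suc i))"
            by (metis adj_sym)
          moreover have "u i = v (Suc n + k - i)"
            using False Suc.prems(4) by (cases "i = Suc n") (auto simp: u_def)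
          ultimately show ?thesis using False by (simp add: u_def)
        qed
      next
        fix i assume i: "Suc i < Suc n + k"
        consider "Suc i < Suc n" | "i = n" | "i > n" by linarith
        then show "u (Suc (Suc i)) \<noteq> u i"
        proof cases
          case 1
          then show ?thesis using Suc.prems(1) by (auto simp: u_def reduced_walk_def)
        next
          case 2
          then show ?thesis using False k by (auto simp: u_def)
        next
          case 3
          then have "v (Suc (Suc (Suc n + k - Suc (Suc i)))) \<noteq> v (Suc n + k - Suc (Suc i))"
            using Suc.prems(2) i k unfolding reduced_walk_def by (auto simp: Suc_diff_Suc)
          moreover have "Suc (Suc (Suc n + k - Suc (Suc i))) = Suc n + k - i" using i by simp
          moreover have "u i = v (Suc n + k - i)"
            using 3 Suc.prems(4) by (cases "i = Suc n") (auto simp: u_def)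
          ultimately show ?thesis using 3 by (simp add: u_def)
        qed
      qed
      from reduced_walk_distinct[OF this, of 0 "Suc n + k"] show ?thesis
        using Suc.prems(3) k by (simp add: u_def)
    qed
  qed
qed

text \<open>A walk of minimal length is reduced, since a backtrack could be cut out, and reduced
  walks with the same ends have the same length.\<close>

lemma graph_dist_reduced_walk:
  assumes w: "reduced_walk adj n w"
  shows "graph_dist adj (w 0) (w n) = n"
proof -
  define k where "k = graph_dist adj (w 0) (w n)"
  have "(adj ^^ n) (w 0) (w n)"
    using w unfolding relpowp_fun_conv reduced_walk_def by blast
  then have k: "(adj ^^ k) (w 0) (w n)"
    unfolding k_def graph_dist_def by (rule LeastI)
  have least: "\<not> (adj ^^ l) (w 0) (w n)" if "l < k" for l
    using not_less_Least[of l "\<lambda>n'. (adj ^^ n') (w 0) (w n)"] that unfolding k_def graph_dist_def by blast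
  obtain v where v: "v 0 = w 0" "v k = w n" "\<And>i. i < k \<Longrightarrow> adj (v i) (v (Suc i))"
    using k unfolding relpowp_fun_conv by blast
  have "reduced_walk adj k v"
    unfolding reduced_walk_def
  proof (intro conjI allI impI)
    fix i assume i: "Suc i < k"
    show "v (Suc (Suc i)) \<noteq> v i"
    proof
      assume eq: "v (Suc (Suc i)) = v i"
      have "(adj ^^ (k - 2)) (w 0) (w n)"
        unfolding relpowp_fun_conv
      \<comment> \<open>Since \<open>v (i + 2) = v i\<close>, skipping the indices i + 1 and i + 2
        leaves a walk that is two steps shorter.\<close>
      proof (intro exI[of _ "\<lambda>j. if j \<le> i then v j else v (j + 2)"] conjI allI impI)
        fix j assume "j < k - 2"
        then show "adj (if j \<le> i then v j else v (j + 2)) (if Suc j \<le> i then v (Suc j) else v (Suc j + 2))"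
        proof (cases "j = i")
          case True
          then have "i + 2 < k" using \<open>j < k - 2\<close> by linarith
          then show ?thesis using v(3)[of "i + 2"] True eq by simp
        next
          case False
          then show ?thesis using v(3)[of j] v(3)[of "j + 2"] \<open>j < k - 2\<close> by (cases "j \<le> i") auto
        qed
      next
        show "(if k - 2 \<le> i then v (k - 2) else v (k - 2 + 2)) = w n"
        proof (cases "k - 2 \<le> i")
          case True
          then have "k = Suc (Suc i)" using i by linarith
          then show ?thesis using eq v(2) by simp
        next
          case False
          then have "k - 2 + 2 = k" by linarith
          then show ?thesis using False v(2) by simp
        qed
      next
        show "(if (0::nat) \<le> i then v 0 else v (0 + 2)) = w 0" using v(1) by simp
      qed
      moreover have "k - 2 < k" using i by linarith
      ultimately show False using least by blast
    qed
  qed (rule v(3))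
  from reduced_walk_unique[OF w this] v(1,2) have "n = k" by simp
  then show ?thesis by (simp add: k_def)
qed

lemma graph_dist_commute: "graph_dist adj x y = graph_dist adj y x"
proof -
  have "(adj ^^ n) y x" if xy: "(adj ^^ n) x y" for n x y
  proof -
    obtain f where f: "f 0 = x" "f n = y" "\<And>i. i < n \<Longrightarrow> adj (f i) (f (Suc i))"
      using xy unfolding relpowp_fun_conv by blast
    show ?thesis
      unfolding relpowp_fun_conv
    proof (intro exI[of _ "\<lambda>i. f (n - i)"] conjI allI impI)
      fix i assume "i < n"
      then have "n - i = Suc (n - Suc i)" "n - Suc i < n" by auto
      then show "adj (f (n - i)) (f (n - Suc i))"
        using f(3)[of "n - Suc i"] adj_sym by simp
    qed (use f in auto)
  qed
  then have "(adj ^^ n) x y = (adj ^^ n) y x" for n by blast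
  then show ?thesis by (simp add: graph_dist_def)
qed

lemma graph_dist_relpowp: "(adj ^^ graph_dist adj x y) x y"
proof -
  obtain n where "(adj ^^ n) x y" using connected rtranclp_power by metis
  then show ?thesis unfolding graph_dist_def by (rule LeastI)
qed

text \<open>Makes the metric notion local, so that vertices can be prepended to a ray or dropped
  from it.\<close>

lemma geodesic_ray_iff:
  "geodesic_ray adj r \<longleftrightarrow> (\<forall>i. adj (r i) (r (Suc i))) \<and> (\<forall>i. r (Suc (Suc i)) \<noteq> r i)"
proof
  assume r: "geodesic_ray adj r"
  have "adj (r i) (r (Suc i))" for i
  proof -
    have "graph_dist adj (r i) (r (Suc i)) = 1" using r by (auto simp: geodesic_ray_def)
    then show ?thesis using graph_dist_relpowp[of "r i" "r (Suc i)"] by (simp add: eq_OO)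
  qed
  moreover have "r (Suc (Suc i)) \<noteq> r i" for i
  proof
    assume "r (Suc (Suc i)) = r i"
    moreover have "graph_dist adj (r i) (r (Suc (Suc i))) = 2" using r by (auto simp: geodesic_ray_def)
    ultimately have "graph_dist adj (r i) (r i) = 2" by simp
    moreover have "graph_dist adj (r i) (r i) = 0"
      unfolding graph_dist_def by (rule Least_eq_0) simp
    ultimately show False by simp
  qed
  ultimately show "(\<forall>i. adj (r i) (r (Suc i))) \<and> (\<forall>i. r (Suc (Suc i)) \<noteq> r i)" by blast
next
  assume r: "(\<forall>i. adj (r i) (r (Suc i))) \<and> (\<forall>i. r (Suc (Suc i)) \<noteq> r i)"
  have "graph_dist adj (r i) (r j) = j - i" if "i \<le> j" for i j
    using graph_dist_reduced_walk[of "j - i" "\<lambda>k. r (i + k)"] r that by (simp add: reduced_walk_def)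
  then show "geodesic_ray adj r" by (simp add: geodesic_ray_def)
qed

lemma reduced_walk_ray: "geodesic_ray adj r \<Longrightarrow> reduced_walk adj n r"
  by (simp add: geodesic_ray_iff reduced_walk_def)

end

locale rooted_tree = tree adj for adj :: "'a \<Rightarrow> 'a \<Rightarrow> bool" +
  fixes \<omega> :: "(nat \<Rightarrow> 'a) set"
  assumes boundary: "\<omega> \<in> tree_boundary adj"
begin

section \<open>Rays of the end, predecessors and heights\<close>

definition base_ray :: "nat \<Rightarrow> 'a" where
  "base_ray = (SOME r. geodesic_ray adj r \<and> \<omega> = cofinal_rays adj `` {r})"

lemma base_ray: "geodesic_ray adj base_ray" "\<omega> = cofinal_rays adj `` {base_ray}"
proof -
  have "\<exists>r. geodesic_ray adj r \<and> \<omega> = cofinal_rays adj `` {r}"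
    using boundary unfolding tree_boundary_def quotient_def by auto
  from someI_ex[OF this, folded base_ray_def]
  show "geodesic_ray adj base_ray" "\<omega> = cofinal_rays adj `` {base_ray}" by auto
qed

lemma mem_end_iff:
  "r \<in> \<omega> \<longleftrightarrow> geodesic_ray adj r \<and> (\<exists>k l. \<forall>n. base_ray (k + n) = r (l + n))"
proof -
  have "r \<in> \<omega> \<longleftrightarrow> r \<in> cofinal_rays adj `` {base_ray}"
    by (rule arg_cong[OF base_ray(2)])
  also have "\<dots> \<longleftrightarrow> geodesic_ray adj r \<and> (\<exists>k l. \<forall>n. base_ray (k + n) = r (l + n))"
    using base_ray(1) by (simp add: cofinal_rays_def)
  finally show ?thesis .
qed

text \<open>Both rays eventually run along \<open>base_ray\<close>, so they meet arbitrarily far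
  out, and up to a meeting point they are reduced walks with the same ends.\<close>

lemma end_ray_unique:
  assumes "r \<in> \<omega>" "r' \<in> \<omega>" "r 0 = r' 0"
  shows "r = r'"
proof
  fix i
  obtain k l where r: "geodesic_ray adj r" "\<And>n. base_ray (k + n) = r (l + n)"
    using assms(1) unfolding mem_end_iff by blast
  obtain k' l' where r': "geodesic_ray adj r'" "\<And>n. base_ray (k' + n) = r' (l' + n)"
    using assms(2) unfolding mem_end_iff by blast
  \<comment> \<open>Both sides are \<open>base_ray (k + k' + i)\<close>. The index on the left is at
    least i, so agreement up to it covers i.\<close>
  have "r (l + (k' + i)) = r' (l' + (k + i))"
    using r(2)[of "k' + i"] r'(2)[of "k + i"] by (simp add: ac_simps)
  then have "\<forall>j\<le>l + (k' + i). r j = r' j"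
    using reduced_walk_unique[OF reduced_walk_ray[OF r(1)] reduced_walk_ray[OF r'(1)] assms(3)] by blast
  then show "r i = r' i" by simp
qed

lemma end_ray_tail:
  assumes "r \<in> \<omega>"
  shows "(\<lambda>n. r (Suc n)) \<in> \<omega>"
proof -
  obtain k l where r: "geodesic_ray adj r" "\<And>n. base_ray (k + n) = r (l + n)"
    using assms unfolding mem_end_iff by blast
  have "base_ray (Suc k + n) = r (Suc (l + n))" for n
    using r(2)[of "Suc n"] by simp
  then have "\<exists>k l. \<forall>n. base_ray (k + n) = r (Suc (l + n))" by blast
  then show ?thesis
    using r(1) unfolding mem_end_iff by (auto simp: geodesic_ray_iff)
qed

lemma end_ray_cons:
  assumes "r \<in> \<omega>" "adj x (r 0)" "r 1 \<noteq> x"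
  shows "case_nat x r \<in> \<omega>"
proof -
  obtain k l where r: "geodesic_ray adj r" "\<And>n. base_ray (k + n) = r (l + n)"
    using assms unfolding mem_end_iff by blast
  have "base_ray (k + n) = case_nat x r (Suc l + n)" for n
    using r(2)[of n] by simp
  moreover have "geodesic_ray adj (case_nat x r)"
    using r(1) assms unfolding geodesic_ray_iff by (auto split: nat.split)
  ultimately show ?thesis unfolding mem_end_iff by blast
qed

text \<open>Induction along a walk from \<open>base_ray 0\<close>: a neighbour of the starting
  vertex either is the next vertex of the ray, and the tail serves, or can be prepended without
  backtracking.\<close>

lemma end_ray_exists: "\<exists>r\<in>\<omega>. r 0 = x"
  using connected[of "base_ray 0" x]
proof (induction rule: rtranclp_induct)
  case base
  have "base_ray \<in> \<omega>" unfolding mem_end_iff using base_ray(1) by blast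
  then show ?case by blast
next
  case (step y z)
  then obtain r where r: "r \<in> \<omega>" "r 0 = y" by blast
  show ?case
  proof (cases "r 1 = z")
    case True
    then show ?thesis using end_ray_tail[OF r(1)] by (intro bexI[of _ "\<lambda>n. r (Suc n)"]) auto
  next
    case False
    then show ?thesis using end_ray_cons[OF r(1), of z] r step adj_sym
      by (intro bexI[of _ "case_nat z r"]) auto
  qed
qed

lemma ray_to: "ray_to \<omega> x \<in> \<omega>" "ray_to \<omega> x 0 = x"
proof -
  have "\<exists>!r. r \<in> \<omega> \<and> r 0 = x" using end_ray_exists end_ray_unique by metis
  from theI'[OF this, folded ray_to_def]
  show "ray_to \<omega> x \<in> \<omega>" "ray_to \<omega> x 0 = x" by auto
qed

lemma ray_to_eq: "r \<in> \<omega> \<Longrightarrow> r 0 = x \<Longrightarrow> ray_to \<omega> x = r"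
  using ray_to end_ray_unique by metis

abbreviation p :: "'a \<Rightarrow> 'a" where "p \<equiv> predecessor \<omega>"

lemma ray_to_geodesic: "geodesic_ray adj (ray_to \<omega> x)"
  using ray_to(1) mem_end_iff by blast

lemma ray_to_p: "ray_to \<omega> (p x) n = ray_to \<omega> x (Suc n)"
  using ray_to_eq[OF end_ray_tail[OF ray_to(1)[of x]], of "p x"] by (simp add: predecessor_def)

lemma ray_to_funpow: "ray_to \<omega> x n = (p ^^ n) x"
  by (induction n arbitrary: x) (auto simp: ray_to ray_to_p[symmetric] funpow_swap1)

lemma adj_p: "adj x (p x)"
  using ray_to_geodesic[of x] ray_to(2)[of x] unfolding geodesic_ray_iff predecessor_def
  by (metis One_nat_def)

lemma p_p_neq: "p (p x) \<noteq> x"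
proof -
  have "ray_to \<omega> x (Suc (Suc 0)) \<noteq> ray_to \<omega> x 0"
    using ray_to_geodesic[of x] unfolding geodesic_ray_iff by blast
  then show ?thesis by (simp add: ray_to_funpow)
qed

lemma p_neq: "p x \<noteq> x"
  using adj_p[of x] adj_irrefl by metis

lemma p_eq_of_adj:
  assumes "adj x y" "y \<noteq> p x"
  shows "p y = x"
proof -
  have "case_nat y (ray_to \<omega> x) \<in> \<omega>"
  proof (rule end_ray_cons)
    show "adj y (ray_to \<omega> x 0)" using assms(1) by (simp add: ray_to adj_sym)
    show "ray_to \<omega> x 1 \<noteq> y" using assms(2) by (simp add: predecessor_def)
  qed (rule ray_to)
  from ray_to_eq[OF this, of y] have "ray_to \<omega> y 1 = ray_to \<omega> x 0" by simp
  then show ?thesis unfolding predecessor_def ray_to(2) .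
qed

lemma successors_eq: "successors adj \<omega> x = {y. p y = x}"
proof (intro set_eqI iffI)
  fix y assume "y \<in> successors adj \<omega> x"
  then show "y \<in> {y. p y = x}" unfolding successors_def using p_eq_of_adj by blast
next
  fix y assume "y \<in> {y. p y = x}"
  then have y: "p y = x" by blast
  have "adj x y" "y \<noteq> p x" using adj_sym[OF adj_p[of y]] p_p_neq[of y] unfolding y by simp_all
  then show "y \<in> successors adj \<omega> x" by (simp add: successors_def)
qed

lemma finite_successors: "finite {y. p y = x}"
  using finite_neighbours[of x] unfolding successors_eq[symmetric] successors_def by simp

lemma base_ray_eq: "base_ray i = base_ray j \<longleftrightarrow> i = j"
  using reduced_walk_distinct[OF reduced_walk_ray[OF base_ray(1)], of i j j]
    reduced_walk_distinct[OF reduced_walk_ray[OF base_ray(1)], of j i i]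
  by (cases i j rule: linorder_cases) auto

text \<open>The Busemann function of the end, with sign such that it increases towards the end.\<close>

definition height :: "'a \<Rightarrow> int" where
  "height x = (SOME d. \<exists>k l. d = int k - int l \<and> (\<forall>n. base_ray (k + n) = ray_to \<omega> x (l + n)))"

text \<open>The difference of the shifts does not depend on their choice, because
  \<open>base_ray\<close> is injective.\<close>

lemma height_eqI:
  assumes "\<And>n. base_ray (k + n) = ray_to \<omega> x (l + n)"
  shows "height x = int k - int l"
proof -
  have "\<exists>k' l'. height x = int k' - int l' \<and> (\<forall>n. base_ray (k' + n) = ray_to \<omega> x (l' + n))"
    unfolding height_def
  proof (rule someI[where x = "int k - int l"])
    show "\<exists>k' l'. int k - int l = int k' - int l' \<and> (\<forall>n. base_ray (k' + n) = ray_to \<omega> x (l' + n))"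
      by (intro exI[of _ k] exI[of _ l] conjI refl allI assms)
  qed
  then obtain k' l' where h: "height x = int k' - int l'" "\<And>n. base_ray (k' + n) = ray_to \<omega> x (l' + n)"
    by blast
  have "base_ray (k + l') = base_ray (k' + l)"
    using assms[of l'] h(2)[of l] by (simp add: ac_simps)
  then show ?thesis using h(1) unfolding base_ray_eq by linarith
qed

lemma height_p: "height (p x) = height x + 1"
proof -
  obtain k l where *: "\<And>n. base_ray (k + n) = ray_to \<omega> x (l + n)"
    using ray_to(1)[of x] unfolding mem_end_iff by blast
  have "base_ray (Suc k + n) = ray_to \<omega> (p x) (l + n)" for n
    using *[of "Suc n"] by (simp add: ray_to_p)
  then show ?thesis using height_eqI[OF *] height_eqI[of "Suc k" "p x" l] by simp
qed

text \<open>The ratio 3 lies between 2 and 12, and the set spans two consecutive levels, as it must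
  in order to hold a vertex together with its predecessor.\<close>

lemma trapezoid_1_3: "trapezoid adj \<omega> 1 3 z = {y. p y = z} \<union> {y. p (p y) = z}"
proof -
  have dist: "graph_dist adj ((p ^^ n) y) y = n" for n y
  proof -
    have "graph_dist adj (ray_to \<omega> y 0) (ray_to \<omega> y n) = n - 0"
      using ray_to_geodesic[of y] unfolding geodesic_ray_def by blast
    then show ?thesis using graph_dist_commute[of "(p ^^ n) y" y] by (simp add: ray_to_funpow)
  qed
  have two: "(p ^^ 2) y = p (p y)" for y by (simp add: numeral_2_eq_2)
  show ?thesis
  proof (intro set_eqI iffI)
    fix y assume "y \<in> trapezoid adj \<omega> 1 3 z"
    then obtain n where n: "z = (p ^^ n) y" "1 \<le> graph_dist adj z y" "graph_dist adj z y < 3"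
      unfolding trapezoid_def tree_le_def ray_to_funpow by blast
    then have "n = 1 \<or> n = 2" using dist[of n y] by auto
    then show "y \<in> {y. p y = z} \<union> {y. p (p y) = z}" using n(1) two[of y] by auto
  next
    fix y assume "y \<in> {y. p y = z} \<union> {y. p (p y) = z}"
    then have "z = (p ^^ 1) y \<or> z = (p ^^ 2) y" using two[of y] by auto
    then show "y \<in> trapezoid adj \<omega> 1 3 z"
    proof
      assume z: "z = (p ^^ 1) y"
      then have "graph_dist adj z y = 1" using dist by blast
      moreover have "z \<in> range (\<lambda>n. (p ^^ n) y)" using z by (rule range_eqI)
      ultimately show ?thesis unfolding trapezoid_def tree_le_def ray_to_funpow by simp
    next
      assume z: "z = (p ^^ 2) y"
      then have "graph_dist adj z y = 2" using dist by blast
      moreover have "z \<in> range (\<lambda>n. (p ^^ n) y)" using z by (rule range_eqI)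
      ultimately show ?thesis unfolding trapezoid_def tree_le_def ray_to_funpow by simp
    qed
  qed
qed

lemma finite_trapezoid_1_3: "finite (trapezoid adj \<omega> 1 3 z)"
proof -
  have "{y. p (p y) = z} = (\<Union>x\<in>{x. p x = z}. {y. p y = x})" by auto
  then show ?thesis unfolding trapezoid_1_3 using finite_successors by simp
qed

end

section \<open>The flow Laplacian\<close>

locale flow_tree = rooted_tree adj \<omega>
  for adj :: "'a \<Rightarrow> 'a \<Rightarrow> bool" and \<omega> :: "(nat \<Rightarrow> 'a) set" +
  fixes m :: "'a \<Rightarrow> real"
  assumes mass_pos: "\<And>x. m x > 0" and flow: "\<And>x. (\<Sum>y | p y = x. m y) = m x"

sublocale flow_tree \<subseteq> weighted_space m
  by unfold_locales (rule mass_pos, rule countable_vertices)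

section \<open>Averages over successors\<close>

context flow_tree
begin

text \<open>By the flow condition the weights add up to 1. This is the conditional expectation given
  the predecessor, and on L2(m) the adjoint of composition with \<open>p\<close>; the range type
  covers real and complex functions.\<close>

definition avg :: "('a \<Rightarrow> 'b :: real_normed_vector) \<Rightarrow> 'a \<Rightarrow> 'b" where
  "avg k y = (1 / m y) *\<^sub>R (\<Sum>x | p x = y. m x *\<^sub>R k x)"

lemma avg_const [simp]: "avg (\<lambda>_. c) y = c"
  using flow[of y] mass_pos[of y] by (simp add: avg_def flip: scaleR_sum_left)

lemma avg_add: "avg (\<lambda>x. f x + g x) y = avg f y + avg g y"
  by (simp add: avg_def scaleR_add_right sum.distrib)

lemma avg_diff: "avg (\<lambda>x. f x - g x) y = avg f y - avg g y"
  by (simp add: avg_def scaleR_diff_right sum_subtractf)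

lemma avg_linear:
  assumes "bounded_linear T"
  shows "avg (\<lambda>x. T (k x)) y = T (avg k y)"
  using bounded_linear.linear[OF assms] by (simp add: avg_def linear_sum linear_cmul)

lemma avg_mult_p:
  fixes f k :: "'a \<Rightarrow> 'b :: real_normed_algebra"
  shows "avg (\<lambda>x. f (p x) * k x) y = f y * avg k y"
proof -
  have "(\<Sum>x | p x = y. m x *\<^sub>R (f (p x) * k x)) = (\<Sum>x | p x = y. f y * (m x *\<^sub>R k x))"
    by (intro sum.cong) auto
  then show ?thesis by (simp add: avg_def sum_distrib_left)
qed

lemma avg_p [simp]: "avg (\<lambda>x. f (p x)) y = f y"
proof -
  have "(\<Sum>x | p x = y. m x *\<^sub>R f (p x)) = (\<Sum>x | p x = y. m x *\<^sub>R f y)"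
    by (intro sum.cong) auto
  then show ?thesis using flow[of y] mass_pos[of y] by (simp add: avg_def flip: scaleR_sum_left)
qed

lemma avg_p_eq [simp]: "avg (\<lambda>x. f (p x)) = f"
  by (simp add: fun_eq_iff)

lemma avg_mono:
  fixes f g :: "'a \<Rightarrow> real"
  shows "(\<And>x. f x \<le> g x) \<Longrightarrow> avg f y \<le> avg g y"
  using mass_pos[THEN less_imp_le] by (auto simp: avg_def intro!: divide_right_mono sum_mono mult_left_mono)

lemma avg_nonneg: "(\<And>x. 0 \<le> f x) \<Longrightarrow> 0 \<le> (avg f y :: real)"
  using avg_mono[of "\<lambda>_. 0" f y] by simp

lemma norm_avg: "norm (avg k y) \<le> avg (\<lambda>x. norm (k x)) y"
proof -
  have "norm (\<Sum>x | p x = y. m x *\<^sub>R k x) \<le> (\<Sum>x | p x = y. m x * norm (k x))"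
    using mass_pos by (intro order_trans[OF norm_sum] sum_mono) (simp add: less_imp_le)
  then show ?thesis
    using mass_pos[of y] by (simp add: avg_def divide_right_mono)
qed

text \<open>Jensen's inequality, from the nonnegativity of the variance about the mean c.\<close>

lemma avg_square: "(avg u y)\<^sup>2 \<le> avg (\<lambda>x. (u x :: real)\<^sup>2) y"
proof -
  define c where "c = avg u y"
  have scale: "avg (\<lambda>x. 2 * c * u x) y = 2 * c * avg u y"
    using avg_linear[of "\<lambda>v. 2 * c * v" u y] bounded_linear_mult_right[of "2 * c"] by simp
  have "0 \<le> avg (\<lambda>x. (u x - c)\<^sup>2) y" by (rule avg_nonneg) simp
  also have "(\<lambda>x. (u x - c)\<^sup>2) = (\<lambda>x. ((u x)\<^sup>2 + c\<^sup>2) - 2 * c * u x)"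
    by (auto simp: power2_eq_square algebra_simps)
  also have "avg \<dots> y = avg (\<lambda>x. (u x)\<^sup>2) y + c\<^sup>2 - 2 * c * avg u y"
    by (simp add: avg_diff avg_add scale)
  finally show ?thesis unfolding c_def by (simp add: power2_eq_square)
qed

text \<open>The image under \<open>p\<close> of the measure with density k has density
  \<open>avg k\<close>; compare total masses.\<close>

lemma nn_integral_avg:
  assumes k: "\<And>x. 0 \<le> k x"
  shows "(\<integral>\<^sup>+x. ennreal (avg k x) \<partial>M) = (\<integral>\<^sup>+x. ennreal (k x) \<partial>M)"
proof -
  have "distr (density M (\<lambda>x. ennreal (k x))) (count_space UNIV) p = density M (\<lambda>y. ennreal (avg k y))"
  proof (rule measure_eqI_countable[of _ UNIV])
    fix y
    have fin: "finite (p -` {y})"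
      using finite_successors[of y] by (simp add: vimage_def)
    have "emeasure (distr (density M (\<lambda>x. ennreal (k x))) (count_space UNIV) p) {y}
        = (\<integral>\<^sup>+x. ennreal (k x) * indicator (p -` {y}) x \<partial>M)"
      by (subst emeasure_distr) (auto simp: emeasure_density)
    also have "\<dots> = (\<integral>\<^sup>+x. ennreal (k x * indicator (p -` {y}) x) \<partial>M)"
      by (intro nn_integral_cong) (auto simp: indicator_def)
    also have "\<dots> = ennreal (\<Sum>x\<in>p -` {y}. m x *\<^sub>R (k x * indicator (p -` {y}) x))"
      using has_integral_finite_support[OF fin, of "\<lambda>x. k x * indicator (p -` {y}) x"] k
      by (subst nn_integral_eq_integral) (auto simp: has_bochner_integral_iff)
    also have "(\<Sum>x\<in>p -` {y}. m x *\<^sub>R (k x * indicator (p -` {y}) x)) = avg k y * m y"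
      using mass_pos[of y] by (simp add: avg_def vimage_def)
    also have "ennreal (avg k y * m y) = ennreal (avg k y) * emeasure M {y}"
      using k mass_pos[of y] by (simp add: emeasure_singleton ennreal_mult avg_nonneg)
    also have "\<dots> = emeasure (density M (\<lambda>y. ennreal (avg k y))) {y}"
      by (simp add: emeasure_density nn_integral_indicator_singleton)
    finally show "emeasure (distr (density M (\<lambda>x. ennreal (k x))) (count_space UNIV) p) {y}
        = emeasure (density M (\<lambda>y. ennreal (avg k y))) {y}" .
  qed (auto intro: countable_vertices)
  then have "emeasure (distr (density M (\<lambda>x. ennreal (k x))) (count_space UNIV) p) UNIV
      = emeasure (density M (\<lambda>y. ennreal (avg k y))) UNIV" by simp
  then show ?thesis
    by (subst (asm) emeasure_distr) (auto simp: emeasure_density)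
qed

lemma integrable_avg:
  fixes k :: "'a \<Rightarrow> 'b :: {banach, second_countable_topology}"
  assumes "integrable M k"
  shows "integrable M (avg k)"
proof (rule integrableI_bounded)
  have "(\<integral>\<^sup>+x. ennreal (norm (avg k x)) \<partial>M) \<le> (\<integral>\<^sup>+x. ennreal (avg (\<lambda>x. norm (k x)) x) \<partial>M)"
    by (intro nn_integral_mono ennreal_leI norm_avg)
  also have "\<dots> = (\<integral>\<^sup>+x. ennreal (norm (k x)) \<partial>M)"
    by (rule nn_integral_avg) simp
  also have "\<dots> < \<infinity>" using assms by (simp add: integrable_iff_bounded)
  finally show "(\<integral>\<^sup>+x. ennreal (norm (avg k x)) \<partial>M) < \<infinity>" .
qed simp

lemma integral_avg_real:
  fixes k :: "'a \<Rightarrow> real"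
  assumes k: "integrable M k"
  shows "(\<integral>x. avg k x \<partial>M) = (\<integral>x. k x \<partial>M)"
proof -
  have nonneg: "(\<integral>x. avg g x \<partial>M) = (\<integral>x. g x \<partial>M)" if "\<And>x. 0 \<le> g x" for g :: "'a \<Rightarrow> real"
    using that avg_nonneg nn_integral_avg[of g] by (simp add: integral_eq_nn_integral)
  have int: "integrable M (\<lambda>x. max 0 (k x))" "integrable M (\<lambda>x. max 0 (- k x))"
    using k by auto
  have "k = (\<lambda>x. max 0 (k x) - max 0 (- k x))" by (auto simp: max_def)
  then have "(\<integral>x. avg k x \<partial>M) = (\<integral>x. avg (\<lambda>x. max 0 (k x) - max 0 (- k x)) x \<partial>M)" by simp
  also have "\<dots> = (\<integral>x. max 0 (k x) \<partial>M) - (\<integral>x. max 0 (- k x) \<partial>M)"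
    unfolding avg_diff using integrable_avg[OF int(1)] integrable_avg[OF int(2)]
    by (subst Bochner_Integration.integral_diff) (auto simp: nonneg)
  also have "\<dots> = (\<integral>x. max 0 (k x) - max 0 (- k x) \<partial>M)"
    using int by simp
  also have "(\<lambda>x. max 0 (k x) - max 0 (- k x)) = k" by (auto simp: max_def)
  finally show ?thesis .
qed

lemma integral_avg:
  fixes k :: "'a \<Rightarrow> complex"
  assumes k: "integrable M k"
  shows "(\<integral>x. avg k x \<partial>M) = (\<integral>x. k x \<partial>M)"
proof (rule complex_eqI)
  have "Re (\<integral>x. avg k x \<partial>M) = (\<integral>x. avg (\<lambda>x. Re (k x)) x \<partial>M)"
    by (simp only: avg_linear[OF bounded_linear_Re] integral_Re[OF integrable_avg[OF k]])
  then show "Re (\<integral>x. avg k x \<partial>M) = Re (\<integral>x. k x \<partial>M)"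
    using k by (simp add: integral_avg_real)
  have "Im (\<integral>x. avg k x \<partial>M) = (\<integral>x. avg (\<lambda>x. Im (k x)) x \<partial>M)"
    by (simp only: avg_linear[OF bounded_linear_Im] integral_Im[OF integrable_avg[OF k]])
  then show "Im (\<integral>x. avg k x \<partial>M) = Im (\<integral>x. k x \<partial>M)"
    using k by (simp add: integral_avg_real)
qed

lemma integrable_p:
  fixes f :: "'a \<Rightarrow> 'b :: {banach, second_countable_topology}"
  assumes "integrable M f"
  shows "integrable M (\<lambda>x. f (p x))"
proof (rule integrableI_bounded)
  have "(\<integral>\<^sup>+x. ennreal (norm (f (p x))) \<partial>M) = (\<integral>\<^sup>+x. ennreal (avg (\<lambda>x. norm (f (p x))) x) \<partial>M)"
    by (rule nn_integral_avg[symmetric]) simp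
  also have "\<dots> = (\<integral>\<^sup>+x. ennreal (norm (f x)) \<partial>M)"
    using avg_p[of "\<lambda>x. norm (f x)"] by simp
  also have "\<dots> < \<infinity>" using assms by (simp add: integrable_iff_bounded)
  finally show "(\<integral>\<^sup>+x. ennreal (norm (f (p x))) \<partial>M) < \<infinity>" .
qed simp

lemma L2_p [intro]: "f \<in> L2 m \<Longrightarrow> (\<lambda>x. f (p x)) \<in> L2 m"
  unfolding L2_iff by (rule integrable_p)

lemma L2_avg [intro]:
  assumes "f \<in> L2 m"
  shows "avg f \<in> L2 m"
  unfolding L2_iff
proof (rule Bochner_Integration.integrable_bound)
  show "integrable M (avg (\<lambda>x. (cmod (f x))\<^sup>2))"
    using assms by (intro integrable_avg) (simp add: L2_iff)
  have "(cmod (avg f x))\<^sup>2 \<le> avg (\<lambda>x. (cmod (f x))\<^sup>2) x" for x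
    by (rule order_trans[OF power_mono[OF norm_avg] avg_square]) simp
  then show "AE x in M. norm ((cmod (avg f x))\<^sup>2) \<le> norm (avg (\<lambda>x. (cmod (f x))\<^sup>2) x)"
    by (auto intro: order_trans[OF _ abs_ge_self])
qed simp

lemma inner_p_left:
  assumes "f \<in> L2 m" "g \<in> L2 m"
  shows "L2_inner m (\<lambda>x. f (p x)) g = L2_inner m f (avg g)"
proof -
  have "L2_inner m (\<lambda>x. f (p x)) g = (\<integral>x. avg (\<lambda>x. f (p x) * cnj (g x)) x \<partial>M)"
    unfolding L2_inner_def using assms by (intro integral_avg[symmetric] integrable_inner) auto
  also have "avg (\<lambda>x. f (p x) * cnj (g x)) = (\<lambda>x. f x * cnj (avg g x))"
    by (rule ext) (simp only: avg_mult_p[of f "\<lambda>x. cnj (g x)"] avg_linear[OF bounded_linear_cnj])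
  finally show ?thesis by (simp add: L2_inner_def)
qed

lemma inner_p_right:
  assumes "f \<in> L2 m" "g \<in> L2 m"
  shows "L2_inner m f (\<lambda>x. g (p x)) = L2_inner m (avg f) g"
  using inner_p_left[OF assms(2,1)] inner_cnj[of f "\<lambda>x. g (p x)"] inner_cnj[of "avg f" g] by simp

lemma inner_p_p:
  assumes "f \<in> L2 m"
  shows "L2_inner m (\<lambda>x. f (p x)) (\<lambda>x. f (p x)) = L2_inner m f f"
  using assms by (simp add: inner_p_left L2_p)

section \<open>The operator \<open>step\<close>, which is V in the overview, and the Laplacian 1 -
  V\<close>

definition step :: "('a \<Rightarrow> complex) \<Rightarrow> 'a \<Rightarrow> complex" where
  "step f x = 1/2 * (f (p x) + avg f x)"

definition lap :: "('a \<Rightarrow> complex) \<Rightarrow> 'a \<Rightarrow> complex" where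
  "lap f x = f x - step f x"

lemma step_eq: "step f = (\<lambda>x. 1/2 * (f (p x) + avg f x))"
  by (simp add: step_def fun_eq_iff)

lemma lap_eq: "lap f = (\<lambda>x. f x - step f x)"
  by (simp add: lap_def fun_eq_iff)

lemma step_L2 [intro]: "f \<in> L2 m \<Longrightarrow> step f \<in> L2 m"
  unfolding step_eq by (intro L2_cmult L2_add L2_p L2_avg)

lemma lap_L2 [intro]: "f \<in> L2 m \<Longrightarrow> lap f \<in> L2 m"
  unfolding lap_eq by (intro L2_diff step_L2)

lemma inner_step_left:
  assumes "f \<in> L2 m" "g \<in> L2 m"
  shows "L2_inner m (step f) g = 1/2 * (L2_inner m (\<lambda>x. f (p x)) g + L2_inner m f (\<lambda>x. g (p x)))"
  using assms unfolding step_eq by (simp only: inner_cmult_left inner_add_left L2_p L2_avg inner_p_right)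

lemma inner_step_right:
  assumes "f \<in> L2 m" "g \<in> L2 m"
  shows "L2_inner m f (step g) = L2_inner m (step f) g"
  using assms inner_cnj[of f "step g"] inner_cnj[of f "\<lambda>x. g (p x)"] inner_cnj[of "\<lambda>x. f (p x)" g]
  by (simp add: inner_step_left add.commute)

lemma flow_Laplacian_eq:
  assumes f: "f \<in> L2 m"
  shows "flow_Laplacian \<omega> m f = lap f"
proof -
  define g where "g = flow_gradient \<omega> f"
  have g_eq: "g = (\<lambda>x. f x - f (p x))" by (simp add: g_def flow_gradient_def fun_eq_iff)
  have g: "g \<in> L2 m" unfolding g_eq using f by (intro L2_diff L2_p)
  have "L2_adjoint m (flow_gradient \<omega>) g = (\<lambda>x. g x - avg g x)"
    unfolding L2_adjoint_def
  proof (rule the_equality)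
    have "L2_inner m (flow_gradient \<omega> k) g = L2_inner m k (\<lambda>x. g x - avg g x)" if k: "k \<in> L2 m" for k
    proof -
      have "flow_gradient \<omega> k = (\<lambda>x. k x - k (p x))" by (simp add: flow_gradient_def fun_eq_iff)
      then show ?thesis using k g
        by (simp add: inner_diff_left inner_diff_right inner_p_left L2_p L2_avg)
    qed
    then show "(\<lambda>x. g x - avg g x) \<in> L2 m \<and>
        (\<forall>k\<in>L2 m. L2_inner m (flow_gradient \<omega> k) g = L2_inner m k (\<lambda>x. g x - avg g x))"
      using g by (auto intro: L2_diff L2_avg)
    fix h assume h: "h \<in> L2 m \<and> (\<forall>k\<in>L2 m. L2_inner m (flow_gradient \<omega> k) g = L2_inner m k h)"
    show "h = (\<lambda>x. g x - avg g x)"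
    proof (rule inner_ext)
      fix k assume k: "k \<in> L2 m"
      have "L2_inner m k h = L2_inner m k (\<lambda>x. g x - avg g x)"
        using h k \<open>\<And>k. k \<in> L2 m \<Longrightarrow> L2_inner m (flow_gradient \<omega> k) g = L2_inner m k (\<lambda>x. g x - avg g x)\<close>
        by simp
      then show "L2_inner m h k = L2_inner m (\<lambda>x. g x - avg g x) k"
        using inner_cnj[of h k] inner_cnj[of "\<lambda>x. g x - avg g x" k] by simp
    qed
  qed
  then show ?thesis
    unfolding flow_Laplacian_def[abs_def] g_def[symmetric]
    by (simp add: fun_eq_iff g_eq avg_diff lap_def step_def field_simps)
qed

text \<open>Expand the squares and use that composition with \<open>p\<close> preserves the norm.
  The two identities are the bounds 0 \<le> \<L> and \<L> \<le> 2.\<close>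

lemma inner_lap_self:
  assumes f: "f \<in> L2 m"
  shows "L2_inner m (lap f) f = 1/2 * L2_inner m (\<lambda>x. f x - f (p x)) (\<lambda>x. f x - f (p x))"
    and "2 * L2_inner m f f - L2_inner m (lap f) f = 1/2 * L2_inner m (\<lambda>x. f x + f (p x)) (\<lambda>x. f x + f (p x))"
proof -
  have lap: "L2_inner m (lap f) f
      = L2_inner m f f - 1/2 * (L2_inner m (\<lambda>x. f (p x)) f + L2_inner m f (\<lambda>x. f (p x)))"
    using f by (simp only: lap_eq inner_diff_left step_L2 inner_step_left)
  show "L2_inner m (lap f) f = 1/2 * L2_inner m (\<lambda>x. f x - f (p x)) (\<lambda>x. f x - f (p x))"
    using f unfolding lap
    by (simp add: inner_diff_left inner_diff_right L2_p L2_diff inner_p_p field_simps)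
  show "2 * L2_inner m f f - L2_inner m (lap f) f = 1/2 * L2_inner m (\<lambda>x. f x + f (p x)) (\<lambda>x. f x + f (p x))"
    using f unfolding lap
    by (simp add: inner_add_left inner_add_right L2_p L2_add inner_p_p field_simps)
qed

end

sublocale flow_tree \<subseteq> lap: positive_operator m lap 2
proof unfold_locales
  fix f g :: "'a \<Rightarrow> complex" and c :: complex assume f: "f \<in> L2 m"
  have c: "avg (\<lambda>x. c * f x) y = c * avg f y" for y
    by (rule avg_linear[OF bounded_linear_mult_right])
  show "lap f \<in> L2 m" using f by (rule lap_L2)
  show "lap (\<lambda>x. f x + g x) = (\<lambda>x. lap f x + lap g x)"
    by (simp add: fun_eq_iff lap_def step_def avg_add field_simps)
  show "lap (\<lambda>x. c * f x) = (\<lambda>x. c * lap f x)"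
    by (simp add: fun_eq_iff lap_def step_def c field_simps)
  show "L2_inner m (lap f) g = L2_inner m f (lap g)" if "g \<in> L2 m"
    using f that by (simp add: lap_eq inner_diff_left inner_diff_right step_L2 inner_step_right)
  have "0 \<le> Re (1/2 * L2_inner m (\<lambda>x. f x - f (p x)) (\<lambda>x. f x - f (p x)))"
    using inner_self_nonneg[of "\<lambda>x. f x - f (p x)"] by simp
  then show "0 \<le> Re (L2_inner m (lap f) f)" unfolding inner_lap_self(1)[OF f] .
  have "0 \<le> Re (1/2 * L2_inner m (\<lambda>x. f x + f (p x)) (\<lambda>x. f x + f (p x)))"
    using inner_self_nonneg[of "\<lambda>x. f x + f (p x)"] by simp
  then show "Re (L2_inner m (lap f) f) \<le> 2 * Re (L2_inner m f f)"
    unfolding inner_lap_self(2)[OF f, symmetric] by simp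
qed simp

section \<open>Fourier transform along the levels of the tree\<close>

context flow_tree
begin

text \<open>A Fourier series in t whose n-th coefficient is the integral of f over the level of
  height n. Since heights are integers, the phases at t = \<pi> are signs that alternate from level
  to level.\<close>

definition level_transform :: "('a \<Rightarrow> complex) \<Rightarrow> real \<Rightarrow> complex" where
  "level_transform f t = (\<integral>x. f x * cis (t * of_int (height x)) \<partial>M)"

lemma integrable_mult_cis: "integrable M f \<Longrightarrow> integrable M (\<lambda>x. f x * cis (u x))"
  by (rule Bochner_Integration.integrable_bound[of _ f]) (auto simp: norm_mult)

lemma level_transform_p:
  assumes "integrable M f"
  shows "level_transform (\<lambda>x. f (p x)) t = cis (- t) * level_transform f t"
proof -
  let ?k = "\<lambda>x. cis (- t) * (f x * cis (t * of_int (height x)))"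
  have int: "integrable M ?k" using assms by (intro integrable_mult_right integrable_mult_cis)
  have shift: "f (p x) * cis (t * of_int (height x)) = ?k (p x)" for x
    by (simp add: height_p cis_mult algebra_simps flip: mult.assoc)
  have "level_transform (\<lambda>x. f (p x)) t = (\<integral>x. ?k (p x) \<partial>M)"
    by (simp only: level_transform_def shift)
  also have "\<dots> = (\<integral>x. avg (\<lambda>x. ?k (p x)) x \<partial>M)"
    by (rule integral_avg[OF integrable_p[OF int], symmetric])
  also have "\<dots> = (\<integral>x. ?k x \<partial>M)" by (simp only: avg_p[of ?k])
  finally show ?thesis by (simp add: level_transform_def)
qed

lemma level_transform_avg:
  assumes "integrable M f"
  shows "level_transform (avg f) t = cis t * level_transform f t"
proof -
  let ?e = "\<lambda>x. cis (t * of_int (height x))"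
  have "level_transform (avg f) t = (\<integral>x. ?e x * avg f x \<partial>M)"
    by (simp add: level_transform_def mult.commute)
  also have "\<dots> = (\<integral>x. avg (\<lambda>x. ?e (p x) * f x) x \<partial>M)"
    by (simp only: avg_mult_p[of ?e f])
  also have "\<dots> = (\<integral>x. ?e (p x) * f x \<partial>M)"
    using integrable_mult_cis[OF assms, of "\<lambda>x. t * of_int (height (p x))"]
    by (intro integral_avg) (simp add: mult.commute)
  also have "(\<lambda>x. ?e (p x) * f x) = (\<lambda>x. cis t * (f x * ?e x))"
    by (auto simp: height_p algebra_simps cis_mult simp flip: mult.assoc)
  finally show ?thesis by (simp add: level_transform_def)
qed

lemma integrable_step: "integrable M f \<Longrightarrow> integrable M (step f)"
  unfolding step_eq using integrable_p[of f] integrable_avg[of f] by auto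

lemma level_transform_step:
  assumes f: "integrable M f"
  shows "level_transform (step f) t = complex_of_real (cos t) * level_transform f t"
proof -
  let ?e = "\<lambda>x. cis (t * of_int (height x))"
  have "level_transform (step f) t = (\<integral>x. 1/2 * (f (p x) * ?e x + avg f x * ?e x) \<partial>M)"
    by (simp add: level_transform_def step_def algebra_simps)
  also have "\<dots> = 1/2 * (level_transform (\<lambda>x. f (p x)) t + level_transform (avg f) t)"
    unfolding level_transform_def using integrable_mult_cis[OF integrable_p[OF f]] integrable_mult_cis[OF integrable_avg[OF f]]
    by (subst integral_mult_right_zero, subst Bochner_Integration.integral_add) auto
  also have "\<dots> = 1/2 * (cis (-t) + cis t) * level_transform f t"
    by (simp add: level_transform_p[OF f] level_transform_avg[OF f] algebra_simps)
  also have "1/2 * (cis (-t) + cis t) = complex_of_real (cos t)"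
    by (simp add: complex_eq_iff)
  finally show ?thesis .
qed

lemma norm_step_integral:
  assumes f: "integrable M f"
  shows "(\<integral>x. cmod (step f x) \<partial>M) \<le> (\<integral>x. cmod (f x) \<partial>M)"
proof -
  have n: "integrable M (\<lambda>x. cmod (f x))" using f by simp
  have "(\<integral>x. cmod (step f x) \<partial>M) \<le> (\<integral>x. 1/2 * (cmod (f (p x)) + avg (\<lambda>x. cmod (f x)) x) \<partial>M)"
  proof (rule integral_mono)
    show "integrable M (\<lambda>x. 1/2 * (cmod (f (p x)) + avg (\<lambda>x. cmod (f x)) x))"
      using integrable_p[OF n] integrable_avg[OF n] by auto
    show "cmod (step f x) \<le> 1/2 * (cmod (f (p x)) + avg (\<lambda>x. cmod (f x)) x)" for x
      using norm_triangle_mono[OF order_refl norm_avg, of "f (p x)" f x]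
      by (simp add: step_def norm_mult)
  qed (use integrable_step[OF f] in simp)
  also have "\<dots> = 1/2 * ((\<integral>x. cmod (f (p x)) \<partial>M) + (\<integral>x. avg (\<lambda>x. cmod (f x)) x \<partial>M))"
    using integrable_p[OF n] integrable_avg[OF n] by simp
  also have "(\<integral>x. cmod (f (p x)) \<partial>M) = (\<integral>x. cmod (f x) \<partial>M)"
    using integral_avg_real[OF integrable_p[OF n]] unfolding avg_p_eq[of "\<lambda>x. cmod (f x)"] by simp
  also have "(\<integral>x. avg (\<lambda>x. cmod (f x)) x \<partial>M) = (\<integral>x. cmod (f x) \<partial>M)"
    by (rule integral_avg_real[OF n])
  finally show ?thesis by simp
qed

end

lemma flow_treeI:
  assumes "is_flow_tree adj \<omega> m"
  shows "flow_tree adj \<omega> m"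
proof -
  interpret rooted_tree adj \<omega>
    by unfold_locales (use assms in \<open>unfold is_flow_tree_def, blast+\<close>)
  show ?thesis
  proof
    fix x
    show "m x > 0" using assms unfolding is_flow_tree_def by blast
    have "m x = (\<Sum>y\<in>successors adj \<omega> x. m y)" using assms unfolding is_flow_tree_def by blast
    then show "(\<Sum>y | p y = x. m y) = m x" unfolding successors_eq by (rule sym)
  qed
qed

section \<open>The Sobolev condition for imaginary powers\<close>

lemma has_vector_derivative_cis:
  assumes "(u has_real_derivative d) (at x)"
  shows "((\<lambda>x. cis (u x)) has_vector_derivative complex_of_real d * (\<i> * cis (u x))) (at x)"
proof -
  have "(u has_derivative (\<lambda>h. d * h)) (at x)"
    using assms by (simp add: has_field_derivative_def)
  from has_derivative_cis[OF this] show ?thesis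
    by (simp add: has_vector_derivative_def scaleR_conv_of_real algebra_simps)
qed

lemma has_vector_derivative_complex_of_real:
  "(u has_real_derivative d) (at x) \<Longrightarrow> ((\<lambda>x. complex_of_real (u x)) has_vector_derivative complex_of_real d) (at x)"
  by (simp add: has_real_derivative_iff_has_vector_derivative has_vector_derivative_of_real)

locale bump =
  fixes chi :: "real \<Rightarrow> real"
  assumes smooth: "smooth chi" and support: "closure {x. chi x \<noteq> 0} \<subseteq> {3/4<..<5/4}"
begin

lemma deriv_chi: "((deriv ^^ j) chi has_real_derivative (deriv ^^ Suc j) chi x) (at x)"
  using smooth by (simp add: smooth_def DERIV_deriv_iff_real_differentiable)

lemma deriv_chi_zero: "x \<notin> closure {x. chi x \<noteq> 0} \<Longrightarrow> (deriv ^^ j) chi x = 0"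
proof (induction j arbitrary: x)
  case 0
  then show ?case using closure_subset[of "{x. chi x \<noteq> 0}"] by auto
next
  case (Suc j)
  have "((\<lambda>_. 0) has_real_derivative (deriv ^^ Suc j) chi x) (at x)"
  proof (rule has_field_derivative_transform_within_open[OF deriv_chi])
    show "open (- closure {x. chi x \<noteq> 0})" by auto
  qed (use Suc in auto)
  then show ?case using DERIV_unique DERIV_const by blast
qed

lemma deriv_chi_zero': "x \<notin> {3/4<..<5/4} \<Longrightarrow> (deriv ^^ j) chi x = 0"
  using deriv_chi_zero support by blast

text \<open>The span of the functions \<open>x\<^sup>i x\<^sup>-\<^sup>a \<chi>\<^sup>(\<^sup>j\<^sup>)(x)\<close>, which is closed under differentiation.\<close>

inductive twisted :: "(real \<Rightarrow> complex) \<Rightarrow> bool" where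
  base: "twisted (\<lambda>x. cis (ln x) * complex_of_real (inverse x ^ a * (deriv ^^ j) chi x))"
| add: "twisted f \<Longrightarrow> twisted g \<Longrightarrow> twisted (\<lambda>x. f x + g x)"
| cmult: "twisted f \<Longrightarrow> twisted (\<lambda>x. c * f x)"

lemma twisted_zero: "twisted f \<Longrightarrow> x \<notin> {3/4<..<5/4} \<Longrightarrow> f x = 0"
  by (induction rule: twisted.induct) (auto simp: deriv_chi_zero' simp del: greaterThanLessThan_iff)

text \<open>On x > 0 the derivative of x^i x^(-a) is (i - a) x^i x^(-a-1), where x^i is
  \<open>cis (ln x)\<close>; the other term differentiates the bump once more.\<close>

lemma twisted_derivative:
  "twisted f \<Longrightarrow> \<exists>f'. twisted f' \<and> (\<forall>x. (f has_vector_derivative f' x) (at x))"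
proof (induction rule: twisted.induct)
  case (base a j)
  let ?B = "\<lambda>a j x. cis (ln x) * complex_of_real (inverse x ^ a * (deriv ^^ j) chi x)"
  define f' where "f' x = (\<i> - of_nat a) * ?B (Suc a) j x + ?B a (Suc j) x" for x
  have f': "twisted f'"
    unfolding f'_def by (intro twisted.intros)
  have "(?B a j has_vector_derivative f' x) (at x)" for x
  proof (cases "x > 0")
    case True
    have 1: "(ln has_real_derivative inverse x) (at x)"
      using True by (rule DERIV_ln)
    have "((\<lambda>x. inverse x ^ a) has_real_derivative of_nat a * inverse x ^ (a - 1) * (- (inverse x * inverse x))) (at x)"
      using True by (auto intro!: derivative_eq_intros simp: power2_eq_square)
    moreover have "of_nat a * inverse x ^ (a - 1) * (- (inverse x * inverse x)) = - of_nat a * inverse x ^ Suc a"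
      by (cases a) (auto simp: algebra_simps)
    ultimately have "((\<lambda>x. inverse x ^ a) has_real_derivative - of_nat a * inverse x ^ Suc a) (at x)"
      by (simp only:)
    from DERIV_mult[OF this deriv_chi[of j x]]
    have 2: "((\<lambda>x. inverse x ^ a * (deriv ^^ j) chi x) has_real_derivative
        - of_nat a * inverse x ^ Suc a * (deriv ^^ j) chi x + (deriv ^^ Suc j) chi x * inverse x ^ a) (at x)"
      by simp
    show ?thesis
      by (rule has_vector_derivative_eq_rhs[OF has_vector_derivative_mult
            [OF has_vector_derivative_cis[OF 1] has_vector_derivative_complex_of_real[OF 2]]])
        (simp add: f'_def algebra_simps)
  next
    case False
    have "f' x = 0" using twisted_zero[OF f', of x] False by simp
    moreover have "((\<lambda>_. 0) has_vector_derivative 0) (at x)" by simp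
    moreover have "\<forall>y\<in>{..<3/4}. ?B a j y = 0"
    proof
      fix y :: real assume "y \<in> {..<3/4}"
      then have "(deriv ^^ j) chi y = 0" by (intro deriv_chi_zero') simp
      then show "?B a j y = 0" by simp
    qed
    ultimately show ?thesis
      using False by (auto intro: has_vector_derivative_transform_within_open[of "\<lambda>_. 0" _ _ "{..<3/4}"])
  qed
  then show ?case using f' by blast
next
  case (add f g)
  then obtain f' g' where "twisted f'" "\<forall>x. (f has_vector_derivative f' x) (at x)"
    "twisted g'" "\<forall>x. (g has_vector_derivative g' x) (at x)" by blast
  then show ?case
    by (intro exI[of _ "\<lambda>x. f' x + g' x"]) (auto intro: twisted.add has_vector_derivative_add)
next
  case (cmult f c)
  then obtain f' where "twisted f'" "\<forall>x. (f has_vector_derivative f' x) (at x)" by blast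
  then show ?case
    by (intro exI[of _ "\<lambda>x. c * f' x"]) (auto intro: twisted.cmult has_vector_derivative_mult_right)
qed

lemma twisted_continuous: "twisted f \<Longrightarrow> continuous_on UNIV f"
  using twisted_derivative has_vector_derivative_continuous
  by (metis continuous_at_imp_continuous_on)

lemma integrable_compact_support:
  fixes f :: "real \<Rightarrow> 'b :: {banach, second_countable_topology}"
  assumes "continuous_on UNIV f" "\<And>x. x \<notin> {3/4<..<5/4} \<Longrightarrow> f x = 0"
  shows "integrable lborel f"
proof -
  have "set_integrable lborel {0..2} f"
    using assms(1) by (intro borel_integrable_atLeastAtMost') (rule continuous_on_subset, auto)
  moreover have "indicator {0..2} x *\<^sub>R f x = f x" for x
    using assms(2)[of x] by (auto simp: indicator_def)
  ultimately show ?thesis by (simp add: set_integrable_def)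
qed

section \<open>Fourier transforms of the twisted bumps\<close>

definition fourier :: "(real \<Rightarrow> complex) \<Rightarrow> real \<Rightarrow> complex" where
  "fourier f \<xi> = (\<integral>x. f x * cis (- (x * \<xi>)) \<partial>lborel)"

lemma integrable_fourier: 
  assumes "twisted f"
  shows "integrable lborel (\<lambda>x. f x * cis (- (x * \<xi>)))"
  by (rule integrable_compact_support)
    (use twisted_continuous[OF assms] twisted_zero[OF assms] in \<open>auto intro!: continuous_intros\<close>)

text \<open>Integration by parts on [0, 2], which contains the support in its interior, so that the
  boundary terms vanish.\<close>

lemma fourier_derivative:
  assumes f: "twisted f" and f': "twisted f'" and d: "\<And>x. (f has_vector_derivative f' x) (at x)"
  shows "fourier f' \<xi> = \<i> * complex_of_real \<xi> * fourier f \<xi>"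
proof -
  let ?e = "\<lambda>x. cis (- (x * \<xi>))"
  let ?G = "\<lambda>x. f x * (complex_of_real (- \<xi>) * (\<i> * ?e x)) + f' x * ?e x"
  have G: "((\<lambda>x. f x * ?e x) has_vector_derivative ?G x) (at x)" for x
  proof -
    have "((\<lambda>x. - (x * \<xi>)) has_real_derivative - \<xi>) (at x)"
      by (auto intro!: derivative_eq_intros)
    from has_vector_derivative_mult[OF d has_vector_derivative_cis[OF this]] show ?thesis .
  qed
  have cont: "continuous_on UNIV ?G"
    using twisted_continuous[OF f] twisted_continuous[OF f'] by (auto intro!: continuous_intros)
  have "(\<integral>x. indicator {0..2} x *\<^sub>R ?G x \<partial>lborel) = f 2 * ?e 2 - f 0 * ?e 0"
  proof (rule integral_FTC_Icc)
    show "((\<lambda>x. f x * ?e x) has_vector_derivative ?G x) (at x within {0..2})" for x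
      by (rule has_vector_derivative_at_within[OF G])
    show "continuous_on {0..2} ?G" by (rule continuous_on_subset[OF cont]) simp
  qed simp
  also have "\<dots> = 0" using twisted_zero[OF f, of 2] twisted_zero[OF f, of 0] by simp
  also have "(\<lambda>x. indicator {0..2} x *\<^sub>R ?G x) = (\<lambda>x. (- \<i> * complex_of_real \<xi>) * (f x * ?e x) + f' x * ?e x)"
  proof
    fix x
    show "indicator {0..2} x *\<^sub>R ?G x = (- \<i> * complex_of_real \<xi>) * (f x * ?e x) + f' x * ?e x"
      using twisted_zero[OF f, of x] twisted_zero[OF f', of x]
      by (cases "x \<in> {0..2}") (auto simp: indicator_def)
  qed
  also have "(\<integral>x. (- \<i> * complex_of_real \<xi>) * (f x * ?e x) + f' x * ?e x \<partial>lborel)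
      = (- \<i> * complex_of_real \<xi>) * fourier f \<xi> + fourier f' \<xi>"
    unfolding fourier_def using integrable_fourier[OF f] integrable_fourier[OF f']
    by (subst Bochner_Integration.integral_add) auto
  finally show ?thesis by (simp add: add_eq_0_iff)
qed

lemma fourier_decay:
  "twisted f \<Longrightarrow> \<exists>C. \<forall>\<xi>. \<bar>\<xi>\<bar> ^ N * cmod (fourier f \<xi>) \<le> C"
proof (induction N arbitrary: f)
  case 0
  have "cmod (fourier f \<xi>) \<le> (\<integral>x. cmod (f x) \<partial>lborel)" for \<xi>
    unfolding fourier_def by (rule order_trans[OF integral_norm_bound]) (simp add: norm_mult)
  then show ?case by auto
next
  case (Suc N)
  obtain f' where f': "twisted f'" "\<And>x. (f has_vector_derivative f' x) (at x)"
    using twisted_derivative[OF Suc.prems] by blast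
  obtain C where C: "\<And>\<xi>. \<bar>\<xi>\<bar> ^ N * cmod (fourier f' \<xi>) \<le> C"
    using Suc.IH[OF f'(1)] by blast
  have eq: "\<bar>\<xi>\<bar> ^ Suc N * cmod (fourier f \<xi>) = \<bar>\<xi>\<bar> ^ N * cmod (fourier f' \<xi>)" for \<xi>
    unfolding fourier_derivative[OF Suc.prems f'] by (simp add: norm_mult)
  show ?case by (intro exI[of _ C] allI) (simp only: eq C)
qed

lemma fourier_measurable [measurable]:
  assumes "twisted f"
  shows "fourier f \<in> borel_measurable borel"
proof -
  have [measurable]: "f \<in> borel_measurable borel"
    using twisted_continuous[OF assms] by (rule borel_measurable_continuous_onI)
  have [measurable]: "cis \<in> borel_measurable borel"
    by (intro borel_measurable_continuous_onI continuous_intros)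
  show ?thesis unfolding fourier_def[abs_def] by measurable
qed

lemma integrable_weight: "integrable lborel (\<lambda>x::real. K * inverse (1 + x\<^sup>2))"
  using integrable_inverse_1_plus_square
  by (intro integrable_mult_right) (simp add: set_integrable_def einterval_def)

text \<open>With N \<ge> s + 1, rapid decay bounds even the weight of order s + 1; the spare factor
  1/(1 + \<xi>^2) is integrable.\<close>

lemma weighted_fourier_integrable:
  assumes f: "twisted f"
  shows "integrable lborel (\<lambda>\<xi>. (1 + \<xi>\<^sup>2) powr s * (cmod (fourier f \<xi>))\<^sup>2)"
proof -
  obtain N :: nat where N: "s + 1 \<le> real N" using real_arch_simple by blast
  obtain C where C: "\<And>\<xi>. \<bar>\<xi>\<bar> ^ N * cmod (fourier f \<xi>) \<le> C" using fourier_decay[OF f] by blast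
  obtain C0 where C0: "\<And>\<xi>. \<bar>\<xi>\<bar> ^ 0 * cmod (fourier f \<xi>) \<le> C0" using fourier_decay[OF f, of 0] by blast
  \<comment> \<open>From (1 + y)^N \<le> 2^N (1 + y^N) at y = \<xi>^2, with \<open>C0\<close> and
    \<open>C\<close> the decay constants of orders 0 and N.\<close>
  define K where "K = 2 ^ N * (C0\<^sup>2 + C\<^sup>2)"
  have bound: "(1 + \<xi>\<^sup>2) powr s * (cmod (fourier f \<xi>))\<^sup>2 \<le> K * inverse (1 + \<xi>\<^sup>2)" for \<xi> :: real
  proof -
    have pos: "1 + \<xi>\<^sup>2 > 0" "1 \<le> 1 + \<xi>\<^sup>2" by (auto intro: add_pos_nonneg)
    have two: "(1 + y) ^ N \<le> 2 ^ N * (1 + y ^ N)" if "0 \<le> y" for y :: real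
    proof (cases "y \<le> 1")
      case True
      then have "(1 + y) ^ N \<le> 2 ^ N" using that by (intro power_mono) auto
      also have "\<dots> \<le> 2 ^ N * (1 + y ^ N)" using that by simp
      finally show ?thesis .
    next
      case False
      then have "(1 + y) ^ N \<le> (2 * y) ^ N" using that by (intro power_mono) auto
      also have "\<dots> \<le> 2 ^ N * (1 + y ^ N)" by (simp add: power_mult_distrib)
      finally show ?thesis .
    qed
    have "(1 + \<xi>\<^sup>2) powr (s + 1) \<le> (1 + \<xi>\<^sup>2) powr real N"
      using N pos by (intro powr_mono) auto
    also have "\<dots> = (1 + \<xi>\<^sup>2) ^ N" by (rule powr_realpow[OF pos(1)])
    also have "\<dots> \<le> 2 ^ N * (1 + (\<xi>\<^sup>2) ^ N)" by (rule two) simp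
    finally have "(1 + \<xi>\<^sup>2) powr (s + 1) * (cmod (fourier f \<xi>))\<^sup>2
        \<le> 2 ^ N * (1 + (\<xi>\<^sup>2) ^ N) * (cmod (fourier f \<xi>))\<^sup>2"
      by (rule mult_right_mono) simp
    also have "\<dots> = 2 ^ N * ((cmod (fourier f \<xi>))\<^sup>2 + (\<bar>\<xi>\<bar> ^ N * cmod (fourier f \<xi>))\<^sup>2)"
    proof -
      have "(\<bar>\<xi>\<bar> ^ N)\<^sup>2 = (\<xi>\<^sup>2) ^ N"
        by (metis mult.commute power2_abs power_mult)
      then show ?thesis by (simp add: algebra_simps power_mult_distrib)
    qed
    also have "\<dots> \<le> K"
      unfolding K_def using C[of \<xi>] C0[of \<xi>] by (intro mult_left_mono add_mono power_mono) auto
    finally have "(1 + \<xi>\<^sup>2) * ((1 + \<xi>\<^sup>2) powr s * (cmod (fourier f \<xi>))\<^sup>2) \<le> K"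
      using pos by (simp add: powr_add mult_ac)
    then show ?thesis
      unfolding divide_inverse[symmetric] pos_le_divide_eq[OF pos(1)]
      by (simp only: mult.commute[of _ "1 + \<xi>\<^sup>2"])
  qed
  show ?thesis
  proof (rule Bochner_Integration.integrable_bound[OF integrable_weight[of K]])
    show "AE \<xi> in lborel. norm ((1 + \<xi>\<^sup>2) powr s * (cmod (fourier f \<xi>))\<^sup>2) \<le> norm (K * inverse (1 + \<xi>\<^sup>2))"
      using bound by (intro AE_I2) (auto intro: order_trans[OF _ abs_ge_self])
  qed (use fourier_measurable[OF f] in measurable)
qed

text \<open>The support lies in [-n, n] as soon as n \<ge> 2, so the sequence of L2 errors is
  eventually 0.\<close>

lemma plancherel_twisted:
  assumes f: "twisted f"
  shows "plancherel_transform f (\<lambda>\<xi>. complex_of_real (1 / sqrt (2 * pi)) * fourier f \<xi>)"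
  unfolding plancherel_transform_def
proof (intro conjI)
  note [measurable] = borel_measurable_continuous_onI[OF twisted_continuous[OF f]] fourier_measurable[OF f]
  show "f \<in> borel_measurable lborel" by simp
  show "integrable lborel (\<lambda>x. (cmod (f x))\<^sup>2)"
    by (rule integrable_compact_support)
      (use twisted_continuous[OF f] twisted_zero[OF f] in \<open>auto intro!: continuous_intros\<close>)
  show "(\<lambda>\<xi>. complex_of_real (1 / sqrt (2 * pi)) * fourier f \<xi>) \<in> borel_measurable lborel" by measurable
  have "(LINT x:{-real n..real n}|lborel. f x * cis (- (x * \<xi>))) = fourier f \<xi>" if "n \<ge> 2" for n \<xi>
    unfolding fourier_def set_lebesgue_integral_def
  proof (rule Bochner_Integration.integral_cong)
    fix x
    have "real n \<ge> 2" using that by simp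
    then show "indicator {- real n..real n} x *\<^sub>R (f x * cis (- (x * \<xi>))) = f x * cis (- (x * \<xi>))"
      using twisted_zero[OF f, of x] by (cases "x \<in> {3/4<..<5/4}") (auto simp: indicator_def)
  qed simp
  then have "\<forall>\<^sub>F n in sequentially. (\<integral>\<^sup>+\<xi>. ennreal ((cmod (complex_of_real (1 / sqrt (2 * pi)) * fourier f \<xi> -
         complex_of_real (1 / sqrt (2 * pi)) *
           (LINT x:{-real n..real n}|lborel. f x * cis (- (x * \<xi>)))))\<^sup>2) \<partial>lborel) = 0"
    by (intro eventually_mono[OF eventually_ge_at_top[of "2 :: nat"]]) simp
  then show "(\<lambda>n. \<integral>\<^sup>+\<xi>. ennreal ((cmod (complex_of_real (1 / sqrt (2 * pi)) * fourier f \<xi> -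
         complex_of_real (1 / sqrt (2 * pi)) *
           (LINT x:{-real n..real n}|lborel. f x * cis (- (x * \<xi>)))))\<^sup>2) \<partial>lborel) \<longlonglongrightarrow> 0"
    by (rule tendsto_eventually)
qed

text \<open>Uniformity over unimodular c is what will absorb the dilation parameter t, which enters
  only through the factor t^i.\<close>

lemma sobolev_norm_twisted:
  assumes f: "twisted f"
  shows "\<exists>K<\<infinity>. \<forall>c. cmod c = 1 \<longrightarrow> sobolev_norm s (\<lambda>x. c * f x) \<le> K"
proof -
  let ?w = "\<lambda>\<xi>. (1 + \<xi>\<^sup>2) powr s * (cmod (complex_of_real (1 / sqrt (2 * pi)) * fourier f \<xi>))\<^sup>2"
  define K where "K = ennreal (sqrt (\<integral>\<xi>. ?w \<xi> \<partial>lborel))"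
  have "integrable lborel (\<lambda>\<xi>. (cmod (complex_of_real (1 / sqrt (2 * pi))))\<^sup>2 *
      ((1 + \<xi>\<^sup>2) powr s * (cmod (fourier f \<xi>))\<^sup>2))"
    by (intro integrable_mult_right weighted_fourier_integrable[OF f])
  then have int: "integrable lborel ?w"
    by (simp only: norm_mult power_mult_distrib mult_ac)
  have "sobolev_norm s (\<lambda>x. c * f x) \<le> K" if c: "cmod c = 1" for c
  proof -
    define g where "g \<xi> = complex_of_real (1 / sqrt (2 * pi)) * fourier (\<lambda>x. c * f x) \<xi>" for \<xi>
    have "fourier (\<lambda>x. c * f x) \<xi> = c * fourier f \<xi>" for \<xi>
      by (simp add: fourier_def mult.assoc)
    then have g: "(1 + \<xi>\<^sup>2) powr s * (cmod (g \<xi>))\<^sup>2 = ?w \<xi>" for \<xi>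
      by (simp add: g_def norm_mult norm_divide c)
    have "plancherel_transform (\<lambda>x. c * f x) g"
      unfolding g_def by (intro plancherel_twisted twisted.cmult f)
    then have "sobolev_norm s (\<lambda>x. c * f x) \<le>
        (if integrable lborel (\<lambda>\<xi>. (1 + \<xi>\<^sup>2) powr s * (cmod (g \<xi>))\<^sup>2)
         then ennreal (sqrt (\<integral>\<xi>. (1 + \<xi>\<^sup>2) powr s * (cmod (g \<xi>))\<^sup>2 \<partial>lborel)) else \<infinity>)"
      unfolding sobolev_norm_def by (intro INF_lower) simp
    also have "\<dots> = K" unfolding g K_def using int by simp
    finally show ?thesis .
  qed
  then show ?thesis by (intro exI[of _ K]) (auto simp: K_def)
qed

end

definition imaginary_power :: "real \<Rightarrow> complex" where
  "imaginary_power l = (if l < 2 then cis (ln (2 - l)) else 0)"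

lemma imaginary_power_measurable [measurable]: "imaginary_power \<in> borel_measurable borel"
proof -
  have [measurable]: "cis \<in> borel_measurable borel"
    by (intro borel_measurable_continuous_onI continuous_intros)
  show ?thesis unfolding imaginary_power_def[abs_def] by measurable
qed

lemma norm_imaginary_power: "cmod (imaginary_power l) \<le> 1"
  by (simp add: imaginary_power_def)

lemma sobolev_norm_imaginary_power:
  assumes "smooth chi" and "closure {x. chi x \<noteq> 0} \<subseteq> {3/4<..<5/4}"
  shows "(SUP t\<in>{0<..}. sobolev_norm s (\<lambda>l. imaginary_power (2 - t * l) * complex_of_real (chi l))) < \<infinity>"
proof -
  interpret bump chi using assms by unfold_locales
  let ?f = "\<lambda>x. cis (ln x) * complex_of_real (inverse x ^ 0 * (deriv ^^ 0) chi x)"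
  obtain K where K: "K < \<infinity>" "\<And>c. cmod c = 1 \<Longrightarrow> sobolev_norm s (\<lambda>x. c * ?f x) \<le> K"
    using sobolev_norm_twisted[OF twisted.base[of 0 0]] by blast
  have "sobolev_norm s (\<lambda>l. imaginary_power (2 - t * l) * complex_of_real (chi l)) \<le> K" if t: "t > 0" for t
  proof -
    have "imaginary_power (2 - t * l) * complex_of_real (chi l) = cis (ln t) * ?f l" for l
    proof (cases "l > 0")
      case True
      then show ?thesis
        using t by (simp add: imaginary_power_def ln_mult cis_mult[symmetric])
    next
      case False
      then have "chi l = 0" using deriv_chi_zero'[of l 0] by simp
      then show ?thesis by simp
    qed
    then have "(\<lambda>l. imaginary_power (2 - t * l) * complex_of_real (chi l)) = (\<lambda>l. cis (ln t) * ?f l)"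
      by (rule ext)
    then show ?thesis using K(2)[of "cis (ln t)"] by (simp only: norm_cis simp_thms)
  qed
  then have "(SUP t\<in>{0<..}. sobolev_norm s (\<lambda>l. imaginary_power (2 - t * l) * complex_of_real (chi l))) \<le> K"
    by (intro SUP_least) simp
  then show ?thesis using K(1) by (rule le_less_trans)
qed

section \<open>The binomial series on the closed interval\<close>

text \<open>Raabe's test with limit 2 = 1 + Re (1 + i). The ratios make sense because 1 + i is not a
  natural number, so no coefficient vanishes.\<close>

lemma binomial_coefficients_summable: "summable (\<lambda>n. cmod ((1 + \<i>) gchoose n))"
proof (rule raabes_test_convergence)
  have ne: "1 + \<i> - of_nat n \<noteq> 0" for n
    by (simp add: complex_eq_iff)
  have pos: "(1 + \<i>) gchoose n \<noteq> 0" for n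
    using ne by (simp add: gbinomial_prod_rev)
  then show "eventually (\<lambda>n. cmod ((1 + \<i>) gchoose n) > 0) sequentially" by simp
  have ratio: "cmod ((1 + \<i>) gchoose n) / cmod ((1 + \<i>) gchoose Suc n)
      = (real n + 1) / sqrt ((1 - real n)\<^sup>2 + 1)" for n
  proof -
    have "(1 + \<i>) gchoose Suc n = ((1 + \<i>) gchoose n) * ((1 + \<i> - of_nat n) / of_nat (Suc n))"
      by (simp add: gbinomial_prod_rev atLeast0_lessThan_Suc field_simps del: of_nat_Suc) 
    moreover have "cmod (1 + \<i> - of_nat n) = sqrt ((1 - real n)\<^sup>2 + 1)"
      by (simp add: cmod_def)
    ultimately have "cmod ((1 + \<i>) gchoose Suc n) = cmod ((1 + \<i>) gchoose n) * (sqrt ((1 - real n)\<^sup>2 + 1) / (real n + 1))"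
      by (simp add: norm_mult norm_divide add.commute del: of_nat_Suc)
    moreover have "sqrt ((1 - real n)\<^sup>2 + 1) > 0" by (simp add: add_nonneg_pos)
    moreover have "cmod ((1 + \<i>) gchoose n) > 0" using pos by simp
    moreover have "B = A * (S / t) \<Longrightarrow> S > 0 \<Longrightarrow> A > 0 \<Longrightarrow> A / B = t / S" for A B S t :: real
      by simp
    ultimately show ?thesis by blast
  qed
  have "(\<lambda>n. real n * ((real n + 1) / sqrt ((1 - real n)\<^sup>2 + 1) - 1)) \<longlonglongrightarrow> 2"
    by real_asymp
  then have "(\<lambda>n. ereal (real n * ((real n + 1) / sqrt ((1 - real n)\<^sup>2 + 1) - 1))) \<longlonglongrightarrow> ereal 2"
    by simp
  from lim_imp_Liminf[OF sequentially_bot this]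
  show "1 < liminf (\<lambda>n. ereal (real n * (cmod ((1 + \<i>) gchoose n) / cmod ((1 + \<i>) gchoose Suc n) - 1)))"
    unfolding ratio by simp
qed

lemma binomial_series_interior:
  assumes "\<bar>u\<bar> < 1"
  shows "(\<lambda>n. ((1 + \<i>) gchoose n) * complex_of_real u ^ n) sums (complex_of_real (1 + u) * cis (ln (1 + u)))"
proof -
  have "(1 + complex_of_real u) powr (1 + \<i>) = complex_of_real (1 + u) * cis (ln (1 + u))"
  proof -
    have pos: "1 + u > 0" using assms by simp
    have "(1 + complex_of_real u) powr (1 + \<i>) = exp ((1 + \<i>) * Ln (complex_of_real (1 + u)))"
      using pos by (simp add: powr_def complex_eq_iff)
    also have "Ln (complex_of_real (1 + u)) = complex_of_real (ln (1 + u))"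
      using pos by (rule Ln_of_real)
    also have "exp ((1 + \<i>) * complex_of_real (ln (1 + u))) = exp (complex_of_real (ln (1 + u))) * exp (\<i> * complex_of_real (ln (1 + u)))"
      by (simp add: exp_add[symmetric] algebra_simps)
    also have "\<dots> = complex_of_real (1 + u) * cis (ln (1 + u))"
      using pos by (simp add: cis_conv_exp exp_of_real del: of_real_add)
    finally show ?thesis .
  qed
  then show ?thesis
    using gen_binomial_complex[of "complex_of_real u" "1 + \<i>"] assms by simp
qed

text \<open>Abel's theorem in the absolutely convergent case: the sum H is continuous on [-1, 1] by
  the Weierstrass test, and the identity passes from the interior to the endpoints.\<close>

lemma binomial_series:
  assumes u: "\<bar>u\<bar> \<le> 1"
  shows "(\<lambda>n. ((1 + \<i>) gchoose n) * complex_of_real u ^ n) sums (complex_of_real (1 + u) * cis (ln (1 + u)))"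
proof -
  define a where "a n = (1 + \<i>) gchoose n" for n
  define G where "G u = complex_of_real (1 + u) * cis (ln (1 + u))" for u :: real
  define H where "H u = (\<Sum>n. a n * complex_of_real u ^ n)" for u :: real
  have bound: "norm (a n * complex_of_real u ^ n) \<le> cmod (a n)" if "u \<in> {-1..1}" for u n
    using that by (simp add: norm_mult norm_power mult_left_le power_le_one abs_le_iff)
  have unif: "uniform_limit {-1..1} (\<lambda>n u. \<Sum>i<n. a i * complex_of_real u ^ i) H sequentially"
    unfolding H_def a_def
    by (rule Weierstrass_m_test[OF _ binomial_coefficients_summable]) (use bound in \<open>simp add: a_def\<close>)
  have H: "continuous_on {-1..1} H"
    by (rule uniform_limit_theorem[OF _ unif]) (auto intro!: always_eventually continuous_intros)
  \<comment> \<open>Interior points converging to u.\<close>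
  define v where "v n = u * (1 - 1 / real (n + 2))" for n
  have v: "\<bar>v n\<bar> < 1" for n
  proof -
    have "0 \<le> 1 - 1 / real (n + 2)" "1 - 1 / real (n + 2) < 1" by auto
    then have "\<bar>v n\<bar> \<le> 1 * (1 - 1 / real (n + 2))"
      unfolding v_def abs_mult using u by (intro mult_mono) auto
    also have "\<dots> < 1" by simp
    finally show ?thesis .
  qed
  have vu: "v \<longlonglongrightarrow> u"
  proof -
    have "(\<lambda>n. 1 - 1 / real (n + 2)) \<longlonglongrightarrow> 1" by real_asymp
    from tendsto_mult[OF tendsto_const[of u] this] show ?thesis by (simp add: v_def[abs_def])
  qed
  have "(\<lambda>n. H (v n)) \<longlonglongrightarrow> H u"
    by (rule continuous_on_tendsto_compose[OF H vu]) (use u v in \<open>auto simp: abs_less_iff abs_le_iff less_imp_le intro!: always_eventually\<close>)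
  moreover have "H (v n) = G (v n)" for n
    using sums_unique[OF binomial_series_interior[OF v[of n]]] by (simp add: H_def G_def a_def)
  moreover have "(\<lambda>n. G (v n)) \<longlonglongrightarrow> G u"
  proof (cases "u = -1")
    case True
    \<comment> \<open>Here \<open>cis (ln (1 + v n))\<close> has modulus 1, so the factor 1 + v n
      forces the limit 0, which is also the value of G at -1.\<close>
    have "(\<lambda>n. 1 + v n) \<longlonglongrightarrow> 0" using tendsto_add[OF tendsto_const[of 1] vu] True by simp
    then have "(\<lambda>n. G (v n)) \<longlonglongrightarrow> 0"
      by (rule Lim_null_comparison[rotated, OF tendsto_rabs_zero]) (simp add: G_def norm_mult del: of_real_add)
    then show ?thesis using True by (simp add: G_def)
  next
    case False
    then have "1 + u > 0" using u by (simp add: abs_le_iff)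
    then show ?thesis unfolding G_def by (intro tendsto_intros vu) auto
  qed
  ultimately have "H u = G u" using LIMSEQ_unique[of "\<lambda>n. H (v n)"] by simp
  moreover have "summable (\<lambda>n. a n * complex_of_real u ^ n)"
    by (rule summable_comparison_test'[OF binomial_coefficients_summable, of 0])
      (use bound[of u] u in \<open>auto simp: a_def abs_le_iff\<close>)
  ultimately show ?thesis
    using summable_sums unfolding G_def H_def a_def by metis
qed

section \<open>Unboundedness on the Hardy space\<close>

context flow_tree
begin

lemma imaginary_power_bounded_borel: "imaginary_power \<in> bounded_borel b"
  by (rule bounded_borelI[where C = 1]) (auto simp: norm_imaginary_power)

lemma step_pow_L2: "f \<in> L2 m \<Longrightarrow> (step ^^ n) f \<in> L2 m"
  by (induction n) auto

text \<open>The induction splits off one factor 1 - x and lets it act on h, as 1 -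
  \<open>lap\<close> = \<open>step\<close>.\<close>

lemma form_step_pow:
  assumes f: "f \<in> L2 m"
  shows "h \<in> L2 m \<Longrightarrow> lap.spectral_form f h (\<lambda>x. (1 - complex_of_real x) ^ n) = L2_inner m ((step ^^ n) f) h"
proof (induction n arbitrary: h)
  case 0
  then show ?case using lap.form_pow[OF f, of h 0] by simp
next
  case (Suc n)
  note \<Lambda> = lap.sigma_functional_form[OF f Suc.prems]
  have pow: "(\<lambda>x. (1 - complex_of_real x) ^ n) \<in> bounded_borel 2"
    by (intro bounded_borel_continuous continuous_intros)
  have pow1: "(\<lambda>x. (1 - complex_of_real x) ^ n * complex_of_real x ^ 1) \<in> bounded_borel 2"
    by (intro bounded_borel_continuous continuous_intros)
  have "(\<lambda>x. (1 - complex_of_real x) ^ Suc n)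
      = (\<lambda>x. (1 - complex_of_real x) ^ n + (-1) * ((1 - complex_of_real x) ^ n * complex_of_real x ^ 1))"
    by (simp add: algebra_simps)
  then have "lap.spectral_form f h (\<lambda>x. (1 - complex_of_real x) ^ Suc n)
      = lap.spectral_form f h (\<lambda>x. (1 - complex_of_real x) ^ n)
        + (-1) * lap.spectral_form f h (\<lambda>x. (1 - complex_of_real x) ^ n * complex_of_real x ^ 1)"
    by (simp only: sigma_functional_add[OF \<Lambda> pow bounded_borel_cmult[OF pow1]] sigma_functional_cmult[OF \<Lambda> pow1])
  also have "\<dots> = L2_inner m ((step ^^ n) f) h + (-1) * L2_inner m ((step ^^ n) f) (lap h)"
    using lap.form_pow_right[OF f Suc.prems pow, of 1] Suc.IH[OF Suc.prems] Suc.IH[OF lap_L2[OF Suc.prems]]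
    by simp
  also have "\<dots> = L2_inner m ((step ^^ n) f) (step h)"
    using Suc.prems step_pow_L2[OF f, of n] by (simp add: lap_eq inner_diff_right step_L2)
  also have "\<dots> = L2_inner m ((step ^^ Suc n) f) h"
    using Suc.prems step_pow_L2[OF f, of n] by (simp add: inner_step_right)
  finally show ?case .
qed

text \<open>The identity (2 - \<L>) g = (1 + V)^(1 + i) f, read at the point x by testing against
  its indicator. On [0, 2] the partial sums are bounded by the sum of the moduli of the
  coefficients, so they may be inserted into the spectral form and passed to the limit.\<close>

lemma binomial_series_calculus:
  assumes f: "f \<in> L2 m"
  defines "g \<equiv> lap.calculus imaginary_power f"
  shows "(\<lambda>n. ((1 + \<i>) gchoose n) * (step ^^ n) f x) sums (g x + step g x)"
proof -
  define a where "a n = (1 + \<i>) gchoose n" for n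
  define e where "e = (indicator {x} :: 'a \<Rightarrow> complex)"
  have e: "e \<in> L2 m" unfolding e_def by (rule L2_indicator)
  note \<Lambda> = lap.sigma_functional_form[OF f e]
  note F = imaginary_power_bounded_borel[of 2]
  have g: "g \<in> L2 m" and inner_g: "\<And>h. h \<in> L2 m \<Longrightarrow> L2_inner m g h = lap.spectral_form f h imaginary_power"
    unfolding g_def by (rule lap.calculus[OF f F])+
  have FX: "(\<lambda>l. imaginary_power l * complex_of_real l ^ 1) \<in> bounded_borel 2"
    by (rule bounded_borel_mult[OF F bounded_borel_power])
  have pow: "(\<lambda>l. (1 - complex_of_real l) ^ n) \<in> bounded_borel 2" for n
    by (intro bounded_borel_continuous continuous_intros)
  have "L2_inner m (\<lambda>x. g x + step g x) e = 2 * L2_inner m g e - L2_inner m g (lap e)"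
    using g e by (simp add: inner_add_left step_L2 lap_eq inner_diff_right inner_step_right)
  also have "\<dots> = 2 * lap.spectral_form f e imaginary_power
      + (-1) * lap.spectral_form f e (\<lambda>l. imaginary_power l * complex_of_real l ^ 1)"
    using lap.form_pow_right[OF f e F, of 1] inner_g e lap_L2[OF e] by simp
  also have "\<dots> = lap.spectral_form f e (\<lambda>l. 2 * imaginary_power l + (-1) * (imaginary_power l * complex_of_real l ^ 1))"
    by (simp only: sigma_functional_add[OF \<Lambda> bounded_borel_cmult[OF F] bounded_borel_cmult[OF FX]]
        sigma_functional_cmult[OF \<Lambda> F] sigma_functional_cmult[OF \<Lambda> FX])
  finally have lhs: "(g x + step g x) * complex_of_real (m x)
      = lap.spectral_form f e (\<lambda>l. 2 * imaginary_power l + (-1) * (imaginary_power l * complex_of_real l ^ 1))"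
    unfolding e_def inner_indicator .
  have "(\<lambda>N. lap.spectral_form f e (\<lambda>l. \<Sum>n<N. a n * (1 - complex_of_real l) ^ n))
      \<longlonglongrightarrow> lap.spectral_form f e (\<lambda>l. 2 * imaginary_power l + (-1) * (imaginary_power l * complex_of_real l ^ 1))"
  proof (rule sigma_functional_lim[OF \<Lambda>, where C = "\<Sum>n. cmod (a n)"])
    show "(\<lambda>l. \<Sum>n<N. a n * (1 - complex_of_real l) ^ n) \<in> borel_measurable borel" for N
      by measurable
    show "(\<lambda>l. 2 * imaginary_power l + (-1) * (imaginary_power l * complex_of_real l ^ 1)) \<in> borel_measurable borel"
      by measurable
    fix l :: real assume l: "0 \<le> l" "l \<le> 2"
    show "cmod (\<Sum>n<N. a n * (1 - complex_of_real l) ^ n) \<le> (\<Sum>n. cmod (a n))" for N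
    proof -
      have "cmod (1 - complex_of_real l) = \<bar>1 - l\<bar>"
        by (metis norm_of_real of_real_1 of_real_diff)
      then have "cmod (1 - complex_of_real l) \<le> 1" using l by simp
      then have "cmod (\<Sum>n<N. a n * (1 - complex_of_real l) ^ n) \<le> (\<Sum>n<N. cmod (a n))"
        by (intro order_trans[OF norm_sum] sum_mono) (simp add: norm_mult norm_power mult_left_le power_le_one)
      also have "\<dots> \<le> (\<Sum>n. cmod (a n))"
        unfolding a_def by (intro sum_le_suminf binomial_coefficients_summable) auto
      finally show ?thesis .
    qed
    have "(\<lambda>n. a n * complex_of_real (1 - l) ^ n) sums (complex_of_real (1 + (1 - l)) * cis (ln (1 + (1 - l))))"
      unfolding a_def using l by (intro binomial_series) auto
    \<comment> \<open>Here 1 + (1 - l) = 2 - l; at l = 2 both sides are 0.\<close>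
    also have "complex_of_real (1 + (1 - l)) * cis (ln (1 + (1 - l)))
        = 2 * imaginary_power l + (-1) * (imaginary_power l * complex_of_real l ^ 1)"
      using l by (cases "l = 2") (auto simp: imaginary_power_def algebra_simps)
    finally show "(\<lambda>N. \<Sum>n<N. a n * (1 - complex_of_real l) ^ n)
        \<longlonglongrightarrow> 2 * imaginary_power l + (-1) * (imaginary_power l * complex_of_real l ^ 1)"
      by (simp add: sums_def)
  qed
  moreover have "lap.spectral_form f e (\<lambda>l. \<Sum>n<N. a n * (1 - complex_of_real l) ^ n)
      = (\<Sum>n<N. a n * (step ^^ n) f x) * complex_of_real (m x)" for N
  proof -
    have "lap.spectral_form f e (\<lambda>l. \<Sum>n<N. a n * (1 - complex_of_real l) ^ n)
        = (\<Sum>n<N. a n * lap.spectral_form f e (\<lambda>l. (1 - complex_of_real l) ^ n))"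
      using bounded_borel_cmult[OF pow]
      by (simp add: sigma_functional_sum[OF \<Lambda>] sigma_functional_cmult[OF \<Lambda> pow])
    also have "\<dots> = (\<Sum>n<N. a n * ((step ^^ n) f x * complex_of_real (m x)))"
      unfolding form_step_pow[OF f e] unfolding e_def inner_indicator ..
    finally show ?thesis by (simp add: sum_distrib_right mult.assoc)
  qed
  ultimately have "(\<lambda>N. (\<Sum>n<N. a n * (step ^^ n) f x) * complex_of_real (m x))
      \<longlonglongrightarrow> (g x + step g x) * complex_of_real (m x)"
    unfolding lhs by simp
  from tendsto_mult[OF this tendsto_const[of "1 / complex_of_real (m x)"]]
  have "(\<lambda>N. \<Sum>n<N. a n * (step ^^ n) f x) \<longlonglongrightarrow> g x + step g x"
    using mass_pos[of x] by simp
  then show ?thesis by (simp add: sums_def a_def)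
qed

lemma integrable_step_pow: "integrable M f \<Longrightarrow> integrable M ((step ^^ n) f)"
  by (induction n) (auto intro: integrable_step)

lemma norm_step_pow_integral:
  assumes "integrable M f"
  shows "(\<integral>x. cmod ((step ^^ n) f x) \<partial>M) \<le> (\<integral>x. cmod (f x) \<partial>M)"
proof (induction n)
  case (Suc n)
  then show ?case using norm_step_integral[OF integrable_step_pow[OF assms, of n]] by simp
qed simp

lemma norm_point_le:
  assumes "integrable M f"
  shows "cmod (f x) * m x \<le> (\<integral>x. cmod (f x) \<partial>M)"
proof -
  have "(\<integral>y. indicator {x} y * cmod (f y) \<partial>M) \<le> (\<integral>y. cmod (f y) \<partial>M)"
    using assms has_integral_finite_support[of "{x}" "\<lambda>y. indicator {x} y * cmod (f y)"]
    by (intro integral_mono) (auto simp: has_bochner_integral_iff indicator_def)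
  moreover have "(\<integral>y. indicator {x} y * cmod (f y) \<partial>M) = m x * cmod (f x)"
    using has_integral_finite_support[of "{x}" "\<lambda>y. indicator {x} y * cmod (f y)"]
    by (auto simp: has_bochner_integral_iff)
  ultimately show ?thesis by (simp add: mult.commute)
qed

lemma level_transform_step_pow:
  "integrable M f \<Longrightarrow> level_transform ((step ^^ n) f) t = complex_of_real (cos t) ^ n * level_transform f t"
  by (induction n) (auto simp: level_transform_step integrable_step_pow)

text \<open>Integrability of g is assumed because the calculus only provides g in L2(m), where its
  transform need not converge. Termwise integration is licensed by summable coefficients and the
  contraction property of V on L1(m). The condition on t allows the factor 1 + cos t to be cancelled
  at the end.\<close>

lemma level_transform_imaginary_power:
  assumes f: "f \<in> L2 m" "integrable M f" and g: "integrable M (lap.calculus imaginary_power f)"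
    and t: "1 + cos t > 0"
  shows "level_transform (lap.calculus imaginary_power f) t = cis (ln (1 + cos t)) * level_transform f t"
proof -
  define g where "g = lap.calculus imaginary_power f"
  define a where "a n = (1 + \<i>) gchoose n" for n
  define I where "I = (\<integral>x. cmod (f x) \<partial>M)"
  define c where "c x = cis (t * of_int (height x))" for x
  define F where "F n x = a n * (step ^^ n) f x * c x" for n x
  have gi: "integrable M g" using g by (simp add: g_def)
  have norm_F: "cmod (F n x) = cmod (a n) * cmod ((step ^^ n) f x)" for n x
    by (simp add: F_def c_def norm_mult)
  have Fi: "integrable M (F n)" for n
    unfolding F_def c_def using integrable_step_pow[OF f(2), of n]
    by (intro integrable_mult_cis integrable_mult_right)
  have "(\<lambda>n. \<integral>x. F n x \<partial>M) sums (\<integral>x. (\<Sum>n. F n x) \<partial>M)"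
  proof (rule sums_integral[OF Fi])
    show "summable (\<lambda>n. \<integral>x. norm (F n x) \<partial>M)"
    proof (rule summable_comparison_test'[of "\<lambda>n. cmod (a n) * I" 0])
      show "summable (\<lambda>n. cmod (a n) * I)"
        unfolding a_def by (intro summable_mult2 binomial_coefficients_summable)
      show "norm (\<integral>x. norm (F n x) \<partial>M) \<le> cmod (a n) * I" for n
        using norm_step_pow_integral[OF f(2), of n] by (simp add: norm_F I_def mult_left_mono)
    qed
    \<comment> \<open>The point x carries mass \<open>m x\<close>, so the L1 bound I gives the
      pointwise bound \<open>I / m x\<close> for all iterates.\<close>
    show "AE x in M. summable (\<lambda>n. norm (F n x))"
      unfolding AE_M
    proof
      fix x
      show "summable (\<lambda>n. norm (F n x))"
      proof (rule summable_comparison_test'[of "\<lambda>n. cmod (a n) * (I / m x)" 0])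
        show "summable (\<lambda>n. cmod (a n) * (I / m x))"
          unfolding a_def by (intro summable_mult2 binomial_coefficients_summable)
        show "norm (norm (F n x)) \<le> cmod (a n) * (I / m x)" for n
        proof -
          have "cmod ((step ^^ n) f x) * m x \<le> I"
            unfolding I_def using norm_point_le[OF integrable_step_pow[OF f(2)]] norm_step_pow_integral[OF f(2)]
            by (rule order_trans)
          then have "cmod ((step ^^ n) f x) \<le> I / m x"
            using mass_pos[of x] by (simp add: pos_le_divide_eq)
          then show ?thesis by (simp add: norm_F mult_left_mono del: times_divide_eq_right)
        qed
      qed
    qed
  qed
  also have "(\<lambda>n. \<integral>x. F n x \<partial>M) = (\<lambda>n. a n * complex_of_real (cos t) ^ n * level_transform f t)"
  proof
    fix n
    have "(\<integral>x. F n x \<partial>M) = a n * level_transform ((step ^^ n) f) t"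
      by (simp add: F_def c_def level_transform_def mult.assoc)
    then show "(\<integral>x. F n x \<partial>M) = a n * complex_of_real (cos t) ^ n * level_transform f t"
      by (simp add: level_transform_step_pow[OF f(2)])
  qed
  also have "(\<lambda>x. \<Sum>n. F n x) = (\<lambda>x. g x * c x + step g x * c x)"
  proof
    fix x
    have "(\<lambda>n. F n x) sums ((g x + step g x) * c x)"
      unfolding F_def a_def g_def by (intro sums_mult2 binomial_series_calculus f)
    then show "(\<Sum>n. F n x) = g x * c x + step g x * c x"
      by (simp add: sums_iff algebra_simps)
  qed
  also have "(\<integral>x. g x * c x + step g x * c x \<partial>M) = level_transform g t + level_transform (step g) t"
    unfolding c_def level_transform_def
    by (intro Bochner_Integration.integral_add integrable_mult_cis gi integrable_step)
  also have "\<dots> = complex_of_real (1 + cos t) * level_transform g t"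
    by (simp add: level_transform_step[OF gi] algebra_simps)
  finally have 1: "(\<lambda>n. a n * complex_of_real (cos t) ^ n * level_transform f t)
      sums (complex_of_real (1 + cos t) * level_transform g t)" .
  have 2: "(\<lambda>n. a n * complex_of_real (cos t) ^ n * level_transform f t)
      sums (complex_of_real (1 + cos t) * cis (ln (1 + cos t)) * level_transform f t)"
    unfolding a_def by (intro sums_mult2 binomial_series abs_cos_le_one)
  have "complex_of_real (1 + cos t) * level_transform g t
      = complex_of_real (1 + cos t) * (cis (ln (1 + cos t)) * level_transform f t)"
    using sums_unique2[OF 1 2] by (simp only: mult.assoc)
  moreover have "complex_of_real (1 + cos t) \<noteq> 0"
    unfolding of_real_eq_0_iff using t by simp
  ultimately show ?thesis unfolding g_def by (simp only: mult_cancel_left simp_thms)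
qed

section \<open>Failure of integrability at the frequency \<pi>\<close>

lemma level_transform_continuous:
  assumes f: "integrable M f" and T: "T \<longlonglongrightarrow> t"
  shows "(\<lambda>n. level_transform f (T n)) \<longlonglongrightarrow> level_transform f t"
  unfolding level_transform_def
proof (rule integral_dominated_convergence[where w = "\<lambda>x. cmod (f x)"])
  show "AE x in M. (\<lambda>n. f x * cis (T n * of_int (height x))) \<longlonglongrightarrow> f x * cis (t * of_int (height x))"
    unfolding AE_M by (intro allI tendsto_intros T)
qed (use f in \<open>auto simp: norm_mult\<close>)

text \<open>Near \<open>t = \<pi>\<close> the factor \<open>(1 + cos t)\<^sup>i\<close> oscillates, whereas the level transforms of
  integrable functions are continuous.\<close>

lemma calculus_imaginary_power_not_integrable:
  assumes f: "f \<in> L2 m" "integrable M f" and pi: "level_transform f pi \<noteq> 0"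
  shows "\<not> integrable M (lap.calculus imaginary_power f)"
proof
  let ?g = "lap.calculus imaginary_power f"
  assume g: "integrable M ?g"
  \<comment> \<open>Chosen so that ln (1 + cos (T n)) = - \<pi> n. The factor is then (-1)^n while T
    n tends to \<pi>, and comparing even with odd n gives two opposite limits.\<close>
  define T where "T n = arccos (exp (- pi * real n) - 1)" for n
  have cos_T: "1 + cos (T n) = exp (- pi * real n)" for n
  proof -
    have "exp (- pi * real n) \<le> 1" "exp (- pi * real n) > 0" by simp_all
    then show ?thesis unfolding T_def by (subst cos_arccos) linarith+
  qed
  have T: "T \<longlonglongrightarrow> pi"
  proof -
    have range: "exp (- pi * real n) - 1 \<in> {-1..1}" for n
    proof -
      have "exp (- pi * real n) \<le> 1" "exp (- pi * real n) > 0" by simp_all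
      then show ?thesis unfolding atLeastAtMost_iff by linarith
    qed
    have "(\<lambda>n. exp (- pi * real n) - 1) \<longlonglongrightarrow> -1"
      using pi_gt_zero by real_asymp
    then have "(\<lambda>n. arccos (exp (- pi * real n) - 1)) \<longlonglongrightarrow> arccos (-1)"
      by (intro continuous_on_tendsto_compose[OF continuous_on_arccos']) (use range in auto)
    then show ?thesis by (simp add: T_def[abs_def])
  qed
  have eq: "level_transform ?g (T n) = (-1) ^ n * level_transform f (T n)" for n
  proof -
    have "cis (ln (1 + cos (T n))) = cis (- (real n * pi))"
      unfolding cos_T by (simp add: mult.commute)
    also have "\<dots> = cis (- pi) ^ n"
      using Complex.DeMoivre[of "- pi" n] by (simp only: mult_minus_right)
    also have "cis (- pi) = -1" by (simp add: complex_eq_iff)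
    finally show ?thesis
      using level_transform_imaginary_power[OF f g, of "T n"] by (simp add: cos_T)
  qed
  have even: "strict_mono (\<lambda>n::nat. 2 * n)" and odd: "strict_mono (\<lambda>n::nat. 2 * n + 1)"
    by (auto simp: strict_mono_def)
  have "(\<lambda>n. level_transform f (T (2 * n))) \<longlonglongrightarrow> level_transform ?g pi"
    using level_transform_continuous[OF g LIMSEQ_subseq_LIMSEQ[OF T even]] by (simp add: o_def eq)
  moreover have "(\<lambda>n. level_transform f (T (2 * n))) \<longlonglongrightarrow> level_transform f pi"
    using level_transform_continuous[OF f(2) LIMSEQ_subseq_LIMSEQ[OF T even]] by (simp add: o_def)
  moreover have "(\<lambda>n. - level_transform f (T (2 * n + 1))) \<longlonglongrightarrow> level_transform ?g pi"
    using level_transform_continuous[OF g LIMSEQ_subseq_LIMSEQ[OF T odd]] by (simp add: o_def eq)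
  moreover have "(\<lambda>n. - level_transform f (T (2 * n + 1))) \<longlonglongrightarrow> - level_transform f pi"
    using tendsto_minus[OF level_transform_continuous[OF f(2) LIMSEQ_subseq_LIMSEQ[OF T odd]]] by (simp add: o_def)
  ultimately have "level_transform f pi = - level_transform f pi"
    by (metis LIMSEQ_unique)
  then show False using pi by simp
qed

text \<open>A two-point function on x and \<open>p x\<close>, with the masses interchanged to have
  mean zero. The two points lie on adjacent levels, so at t = \<pi> their contributions, which
  cancel at t = 0, add up.\<close>

lemma atom_level_transform:
  "\<exists>a. is_atom adj \<omega> m a \<and> a \<in> L2 m \<and> integrable M a \<and> level_transform a pi \<noteq> 0"
proof -
  define x :: 'a where "x = undefined"
  \<comment> \<open>The apex two levels above x: x and \<open>p x\<close> are then at distances 2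
    and 1 from it.\<close>
  define z where "z = p (p x)"
  define R where "R = trapezoid adj \<omega> 1 3 z"
  have R: "finite R" "x \<in> R" "p x \<in> R"
    unfolding R_def by (rule finite_trapezoid_1_3) (unfold trapezoid_1_3 z_def, auto)
  have "measure M R = (\<Sum>x\<in>R. m x)"
    using R(1) mass_pos by (simp add: measure_def emeasure_finite_set sum_nonneg less_imp_le)
  moreover have "m x \<le> (\<Sum>x\<in>R. m x)"
    using R mass_pos by (intro member_le_sum) (auto simp: less_imp_le)
  ultimately have Rpos: "measure M R > 0" using mass_pos[of x] by simp
  \<comment> \<open>Both values of a are at most c times the sum of the two masses, which this
    choice makes equal to \<open>1 / measure M R\<close>.\<close>
  define c where "c = 1 / (measure M R * (m x + m (p x)))"
  have c: "c > 0" unfolding c_def using Rpos mass_pos[of x] mass_pos[of "p x"] by simp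
  define a where "a y = complex_of_real (c * (if y = x then m (p x) else if y = p x then - m x else 0))" for y
  have supp: "a y = 0" if "y \<notin> {x, p x}" for y using that by (simp add: a_def)
  have a_vals: "a x = complex_of_real (c * m (p x))" "a (p x) = - complex_of_real (c * m x)"
    using p_neq[of x] by (auto simp: a_def)
  have "is_atom adj \<omega> m a"
    unfolding is_atom_def
  proof (intro exI[of _ R] conjI allI impI)
    show "admissible_trapezoid adj \<omega> R"
      unfolding admissible_trapezoid_def R_def
      by (intro disjI2 exI[of _ z] exI[of _ 1] exI[of _ 3]) simp
    show "a y = 0" if "y \<notin> R" for y
      by (rule supp) (use that R in auto)
    have "(\<Sum>\<^sub>\<infinity>y. a y * complex_of_real (m y)) = (\<Sum>\<^sub>\<infinity>y\<in>{x, p x}. a y * complex_of_real (m y))"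
      by (rule infsum_cong_neutral) (use supp in auto)
    also have "\<dots> = 0"
      using p_neq[of x] by (simp add: a_vals)
    finally show "(\<Sum>\<^sub>\<infinity>y. a y * complex_of_real (m y)) = 0" .
    show "cmod (a y) \<le> 1 / measure M R" for y
    proof -
      have "cmod (a y) \<le> c * (m x + m (p x))"
        using c mass_pos[of x] mass_pos[of "p x"] unfolding a_def norm_of_real
        by (auto simp: abs_mult intro!: mult_left_mono)
      also have "\<dots> = 1 / measure M R"
        using mass_pos[of x] mass_pos[of "p x"] unfolding c_def by (simp add: add_pos_pos less_imp_neq[symmetric])
      finally show ?thesis .
    qed
  qed
  moreover have "a \<in> L2 m" by (rule L2_finite_support[of "{x, p x}"]) (use supp in auto)
  moreover have "integrable M a"
    using has_integral_finite_support[of "{x, p x}" a] supp by (auto simp: has_bochner_integral_iff)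
  moreover have "level_transform a pi \<noteq> 0"
  proof -
    let ?e = "cis (pi * of_int (height x))"
    have e: "cis (pi * of_int (height (p x))) = - ?e"
      by (simp add: height_p distrib_left cis_mult[symmetric])
    have "level_transform a pi = (\<Sum>y\<in>{x, p x}. m y *\<^sub>R (a y * cis (pi * of_int (height y))))"
      unfolding level_transform_def
      using has_integral_finite_support[of "{x, p x}" "\<lambda>y. a y * cis (pi * of_int (height y))"] supp
      by (auto simp: has_bochner_integral_iff)
    also have "\<dots> = complex_of_real (2 * c * m x * m (p x)) * ?e"
      using p_neq[of x] by (simp add: a_vals e scaleR_conv_of_real)
    finally show ?thesis using c mass_pos[of x] mass_pos[of "p x"] by simp
  qed
  ultimately show ?thesis by blast
qed

lemma atom_in_H1:
  assumes "is_atom adj \<omega> m a"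
  shows "a \<in> H1 adj \<omega> m"
proof -
  define c :: "nat \<Rightarrow> complex" where "c j = (if j = 0 then 1 else 0)" for j
  have "(\<Sum>j<N. c j * a x) = a x" if "N \<ge> 1" for N x
  proof -
    have "(\<Sum>j<N. c j * a x) = (\<Sum>j\<in>{0}. c j * a x)"
      by (rule sum.mono_neutral_right) (use that in \<open>auto simp: c_def\<close>)
    then show ?thesis by (simp add: c_def)
  qed
  then have "\<forall>\<^sub>F N in sequentially. L1_norm m (\<lambda>x. a x - (\<Sum>j<N. c j * a x)) = 0"
    by (intro eventually_mono[OF eventually_ge_at_top[of "1 :: nat"]]) (simp add: L1_norm_def)
  moreover have "summable (\<lambda>j. cmod (c j))"
    by (rule summable_finite[of "{0}"]) (auto simp: c_def)
  ultimately have "atomic_decomposition adj \<omega> m a c (\<lambda>_. a)"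
    unfolding atomic_decomposition_def using assms by (auto intro: tendsto_eventually)
  then show ?thesis unfolding H1_def by blast
qed

text \<open>Whatever the constant C, the right-hand side for one fixed atom is
  \<open>ennreal\<close> of a real number, hence finite, and would make the image of the atom
  integrable.\<close>

lemma imaginary_power_not_bounded:
  "\<not> bounded_H1_L1 adj \<omega> m (borel_calculus m (flow_Laplacian \<omega> m) imaginary_power)"
proof
  assume "bounded_H1_L1 adj \<omega> m (borel_calculus m (flow_Laplacian \<omega> m) imaginary_power)"
  then obtain C where C: "\<And>f g. (f, g) \<in> borel_calculus m (flow_Laplacian \<omega> m) imaginary_power \<Longrightarrow>
      f \<in> H1 adj \<omega> m \<Longrightarrow> L1_norm m g \<le> ennreal (C * H1_norm adj \<omega> m f)"
    unfolding bounded_H1_L1_def by blast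
  obtain a where a: "is_atom adj \<omega> m a" "a \<in> L2 m" "integrable M a" "level_transform a pi \<noteq> 0"
    using atom_level_transform by blast
  let ?g = "lap.calculus imaginary_power a"
  have "(a, ?g) \<in> borel_calculus m (flow_Laplacian \<omega> m) imaginary_power"
    by (rule lap.borel_calculus_calculus[OF flow_Laplacian_eq a(2) imaginary_power_bounded_borel])
  then have "L1_norm m ?g \<le> ennreal (C * H1_norm adj \<omega> m a)"
    using C atom_in_H1[OF a(1)] by blast
  then have "L1_norm m ?g < \<infinity>" by (rule le_less_trans) simp
  then have "integrable M ?g" unfolding L1_norm_def by (intro integrableI_bounded) auto
  then show False using calculus_imaginary_power_not_integrable[OF a(2-4)] by blast
qed

end

theorem proposition6p11:
  fixes chi :: "real \<Rightarrow> real"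
    and adj :: "'a \<Rightarrow> 'a \<Rightarrow> bool" and \<omega> :: "(nat \<Rightarrow> 'a) set" and m :: "'a \<Rightarrow> real"
    and s :: real
  assumes "smooth chi"
    and "closure {x. chi x \<noteq> 0} \<subseteq> {3/4<..<5/4}"
    and "\<And>x. 0 \<le> chi x \<and> chi x \<le> 1"
    and "chi 1 = 1"
    and "is_flow_tree adj \<omega> m"
    and "locally_doubling adj m"
    and "s > 3/2"
  shows "\<exists>F :: real \<Rightarrow> complex.
           F \<in> borel_measurable borel \<and>
           (SUP t\<in>{0<..}. sobolev_norm s (\<lambda>l. F (2 - t * l) * complex_of_real (chi l))) < \<infinity> \<and>
           \<not> bounded_H1_L1 adj \<omega> m (borel_calculus m (flow_Laplacian \<omega> m) F)"
proof (intro exI[of _ imaginary_power] conjI)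
  show "imaginary_power \<in> borel_measurable borel" by (rule imaginary_power_measurable)
  show "(SUP t\<in>{0<..}. sobolev_norm s (\<lambda>l. imaginary_power (2 - t * l) * complex_of_real (chi l))) < \<infinity>"
    by (rule sobolev_norm_imaginary_power[OF assms(1,2)])
  show "\<not> bounded_H1_L1 adj \<omega> m (borel_calculus m (flow_Laplacian \<omega> m) imaginary_power)"
    by (rule flow_tree.imaginary_power_not_bounded[OF flow_treeI[OF assms(5)]])
qed

end
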